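(* The Riemann hypothesis is true if and only if the polynomials $$Q^{d,n,\alpha}(x):=\sum_{j=0}^d\binom{d+\alpha}{j}\gamma(n+j)\,x^j\,L^{(\alpha)}_{d-j}(x)$$ have only real zeros for all integers $d\ge1$, $n\ge0$ and all real $\alpha\ge-2$.
   Context: $\xi(s):=\tfrac12 s(s-1)\pi^{-s/2}\Gamma(s/2)\zeta(s)$, $\gamma(m):=\frac{m!}{(2m)!}\xi^{(2m)}(1/2)$. For real $y$, $\binom yj=y(y-1)\cdots(y-j+1)/j!$. The generalized Laguerre polynomials are $L^{(\alpha)}_d(x):=\sum_{k=0}^d\binom{d+\alpha}{d-k}(-1)^k\frac{x^k}{k!}$. *)

theory Defs
  imports "HOL-Complex_Analysis.Complex_Analysis" "HOL-Computational_Algebra.Polynomial"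
begin

text \<open>The analytic continuation of the Dirichlet series; by the identity theorem it is unique
  away from the pole, where the value 0 is a dummy.\<close>

definition riemann_zeta :: "complex \<Rightarrow> complex" where
  "riemann_zeta = (THE f. f holomorphic_on (- {1}) \<and> f 1 = 0 \<and>
     (\<forall>s. Re s > 1 \<longrightarrow> f s = (\<Sum>n. 1 / of_nat (Suc n) powr s)))"

text \<open>The zeros at the negative even integers are the trivial ones.\<close>

definition riemann_hypothesis :: bool where
  "riemann_hypothesis \<longleftrightarrow>
     (\<forall>s. s \<noteq> 1 \<and> riemann_zeta s = 0 \<and> \<not> (\<exists>k::nat. k \<ge> 1 \<and> s = - 2 * of_nat k)
        \<longrightarrow> Re s = 1 / 2)"

text \<open>At 1 (pole of zeta) and at 0, -2, -4, ... (poles of Gamma) the product uses dummy values;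
  \<^const>\<open>remove_sings\<close> fills these removable singularities, so that the result is the entire function.\<close>

definition riemann_xi :: "complex \<Rightarrow> complex" where
  "riemann_xi = remove_sings (\<lambda>s.
     1 / 2 * s * (s - 1) * of_real pi powr (- s / 2) * Gamma (s / 2) * riemann_zeta s)"

definition xi_gamma :: "nat \<Rightarrow> complex" where
  "xi_gamma m = fact m / fact (2 * m) * (deriv ^^ (2 * m)) riemann_xi (1 / 2)"

definition gen_laguerre :: "real \<Rightarrow> nat \<Rightarrow> real poly" where
  "gen_laguerre \<alpha> d =
     (\<Sum>k\<le>d. monom (((of_nat d + \<alpha>) gchoose (d - k)) * (- 1) ^ k / fact k) k)"

text \<open>Coefficients are complex because \<^const>\<open>xi_gamma\<close> is; its values are in fact real.\<close>

definition Q_poly :: "nat \<Rightarrow> nat \<Rightarrow> real \<Rightarrow> complex poly" where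
  "Q_poly d n \<alpha> =
     (\<Sum>j\<le>d. monom (of_real ((of_nat d + \<alpha>) gchoose j) * xi_gamma (n + j)) j
              * map_poly of_real (gen_laguerre \<alpha> (d - j)))"

definition only_real_zeros :: "complex poly \<Rightarrow> bool" where
  "only_real_zeros p \<longleftrightarrow> (\<forall>z. poly p z = 0 \<longrightarrow> z \<in> \<real>)"

end

theory Submission
  imports Defs "HOL-Computational_Algebra.Fundamental_Theorem_Algebra"
    "HOL-Probability.Characteristic_Functions" "HOL-Real_Asymp.Real_Asymp"
begin

text \<open>
  Let \<open>F(w) = \<Sum> \<gamma>(m) w\<^sup>m / m!\<close>, an entire function with \<open>F(z\<^sup>2) = \<xi>(1/2 + z)\<close>. Jacobi's theta
  inversion writes \<open>\<xi>(1/2 + z)\<close> as the integral of \<open>\<Phi>(u) exp (z u)\<close> with \<open>\<Phi>\<close> even, positive and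
  decaying faster than every Gaussian. Hence \<open>\<gamma>(m) > 0\<close>, \<open>\<xi>\<close> has no real zeros,
  \<open>log |F(w)| = o(|w|)\<close>, and the Riemann hypothesis says that \<open>F\<close> has only real zeros.

  The reversed polynomial \<open>x\<^sup>d Q(1/x)\<close> is \<open>F\<^sup>(\<^sup>n\<^sup>)(D) P\<close>, where \<open>P\<close> is the reversed Laguerre
  polynomial. If \<open>F\<close> has only real zeros, the growth bound makes it a locally uniform limit of
  polynomials with only real zeros; since \<open>D - a\<close> preserves real-rootedness for real \<open>a\<close>, so
  does \<open>F\<^sup>(\<^sup>n\<^sup>)(D)\<close>. Laguerre polynomials with \<open>\<alpha> \<ge> - 2\<close> have only real zeros by their
  three-term recurrence.

  Conversely, for \<open>\<alpha> = 0\<close> and \<open>n = 0\<close> the polynomials \<open>Q(x/d)\<close> converge to \<open>F\<close> times a Bessel-type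
  function as \<open>d\<close> tends to infinity, so by Hurwitz's theorem \<open>F\<close> has only real zeros.
\<close>

section \<open>Polynomials with only real zeros\<close>

text \<open>Passing from xi to \<open>F\<close> pays twice: squaring turns the critical line into a
  ray of real numbers, so that statements about real zeros apply, and it lowers the growth. The
  bound \<open>log |F(w)| = o(|w|)\<close> makes the quotient of \<open>F\<close> by its zeros in a
  large disc nearly constant on a fixed disc, so the approximating polynomials have no zeros other
  than zeros of \<open>F\<close>. The bound comes from the kernel: \<open>|z u|\<close> is at most
  \<open>e |z|^2 + u^2 / (4 e)\<close> for every \<open>e > 0\<close>, and a decay faster than every
  Gaussian absorbs the second term. The lack of real zeros of xi matters because \<open>z^2\<close>
  is real for real \<open>z\<close> as well as for imaginary \<open>z\<close>. As
  \<open>only_real_zeros 0\<close> is false, nonvanishing has to be carried through every closure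
  property; the positivity of the moments supplies it at the end. Since \<open>riemann_zeta\<close>
  is given by a description, existence and uniqueness of the continuation are part of the proof.
  Both follow from an explicit formula in terms of the integral of the kernel.\<close>

lemma Im_mult_logderiv_prod:
  fixes z :: complex
  assumes "Im z \<noteq> 0" "\<And>a. a \<in># A \<Longrightarrow> a \<in> \<real>"
  defines "p \<equiv> (\<Prod>a\<in>#A. [:-a, 1:])"
  shows "poly p z \<noteq> 0" "Im z * Im (poly (pderiv p) z / poly p z) \<le> 0"
    "A \<noteq> {#} \<Longrightarrow> Im z * Im (poly (pderiv p) z / poly p z) < 0"
proof -
  have "poly p z \<noteq> 0 \<and> Im z * Im (poly (pderiv p) z / poly p z) \<le> 0 \<and>
    (A \<noteq> {#} \<longrightarrow> Im z * Im (poly (pderiv p) z / poly p z) < 0)"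
    using assms(2) unfolding p_def
  proof (induction A)
    case empty
    then show ?case by simp
  next
    case (add a A)
    define q where "q = (\<Prod>a\<in>#A. [:-a, 1:])"
    have IH: "poly q z \<noteq> 0" "Im z * Im (poly (pderiv q) z / poly q z) \<le> 0"
      using add unfolding q_def by auto
    have a: "a \<in> \<real>" using add.prems by simp
    then have za: "z - a \<noteq> 0" "Im a = 0"
      using assms(1) by (auto simp: complex_is_Real_iff)
    have "poly (pderiv ([:-a, 1:] * q)) z = poly q z + (z - a) * poly (pderiv q) z"
      "poly ([:-a, 1:] * q) z = (z - a) * poly q z"
      unfolding pderiv_mult poly_mult poly_add by (simp_all add: pderiv_pCons algebra_simps)
    then have "poly (pderiv ([:-a, 1:] * q)) z / poly ([:-a, 1:] * q) z
      = 1 / (z - a) + poly (pderiv q) z / poly q z"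
      using za IH(1) by (simp add: divide_simps)
    \<comment> \<open>\<open>p'/p\<close> is the sum of \<open>1/(z - a)\<close> over the roots, and
      for real \<open>a\<close> each summand has imaginary part of sign opposite to
      \<open>Im z\<close>. The factor \<open>Im z\<close> treats both half-planes at once.\<close>
    moreover have "Im z * Im (1 / (z - a)) < 0"
    proof -
      have "Im z * Im (1 / (z - a)) = - ((Im z)\<^sup>2 / (cmod (z - a))\<^sup>2)"
        using za(2) cmod_power2[of "z - a"] by (simp add: Im_divide power2_eq_square)
      moreover have "(Im z)\<^sup>2 / (cmod (z - a))\<^sup>2 > 0"
        using za assms(1) by (simp add: divide_pos_pos)
      ultimately show ?thesis by linarith
    qed
    ultimately show ?case
      using IH za by (simp add: q_def[symmetric] distrib_left del: mult_pCons_left)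
  qed
  then show "poly p z \<noteq> 0" "Im z * Im (poly (pderiv p) z / poly p z) \<le> 0"
    "A \<noteq> {#} \<Longrightarrow> Im z * Im (poly (pderiv p) z / poly p z) < 0" by auto
qed

text \<open>The zero polynomial vanishes at the imaginary unit. This is why the closure lemmas below
  carry a nonvanishing hypothesis.\<close>

lemma only_real_zeros_nonzero: "only_real_zeros p \<Longrightarrow> p \<noteq> 0"
  unfolding only_real_zeros_def
  by (metis complex_is_Real_iff imaginary_unit.simps(2) poly_0 zero_neq_one)

lemma only_real_zeros_factorization:
  assumes "only_real_zeros p"
  obtains A where "p = smult (lead_coeff p) (\<Prod>a\<in>#A. [:-a, 1:])" "size A = degree p"
    "\<And>a. a \<in># A \<Longrightarrow> a \<in> \<real>"
proof -
  have "p \<noteq> 0" by (rule only_real_zeros_nonzero[OF assms])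
  then obtain A where A: "size A = degree p" "p = smult (lead_coeff p) (\<Prod>a\<in>#A. [:-a, 1:])"
    using alg_closed_imp_factorization[OF \<open>p \<noteq> 0\<close>] by metis
  have "a \<in> \<real>" if "a \<in># A" for a
  proof -
    have "poly (\<Prod>a\<in>#A. [:-a, 1:]) a = 0"
      using that by (simp add: poly_prod_mset prod_mset_zero_iff image_iff) 
    then have "poly p a = 0" by (subst A(2)) simp
    then show ?thesis using assms by (simp add: only_real_zeros_def)
  qed
  then show ?thesis using that A by blast
qed

text \<open>At a non-real zero of \<open>a p' + b p\<close> the quotient \<open>p'/p\<close> would
  equal the real number \<open>- b / a\<close>, against the strict sign of its imaginary
  part.\<close>

lemma only_real_zeros_add_pderiv:
  assumes p: "only_real_zeros p" and "a \<in> \<real>" "b \<in> \<real>"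
    and nz: "smult a (pderiv p) + smult b p \<noteq> 0"
  shows "only_real_zeros (smult a (pderiv p) + smult b p)"
proof -
  obtain A where A: "p = smult (lead_coeff p) (\<Prod>a\<in>#A. [:-a, 1:])" "size A = degree p"
    "\<And>a. a \<in># A \<Longrightarrow> a \<in> \<real>" using only_real_zeros_factorization[OF p] by blast
  let ?q = "\<Prod>a\<in>#A. [:-a, 1:]" and ?c = "lead_coeff p"
  have c: "?c \<noteq> 0" using only_real_zeros_nonzero[OF p] by simp
  show ?thesis
  proof (cases "a = 0 \<or> A = {#}")
    case True
    then have "smult a (pderiv p) = 0"
    proof
      assume "A = {#}"
      then have "degree p = 0" using A(2) by simp
      then show ?thesis by (simp add: pderiv_eq_0_iff)
    qed simp
    then show ?thesis using p nz by (auto simp: only_real_zeros_def)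
  next
    case False
    show ?thesis unfolding only_real_zeros_def
    proof (intro allI impI, rule ccontr)
      fix z assume z: "poly (smult a (pderiv p) + smult b p) z = 0" "z \<notin> \<real>"
      then have Im: "Im z \<noteq> 0" by (simp add: complex_is_Real_iff)
      note L = Im_mult_logderiv_prod[OF Im, of A, OF A(3)]
      have pz: "poly p z \<noteq> 0" using p z by (auto simp: only_real_zeros_def)
      have ratio: "poly (pderiv p) z / poly p z = poly (pderiv ?q) z / poly ?q z"
        using c by (subst (1 2) A(1)) (simp add: pderiv_smult)
      have "a * poly (pderiv p) z / poly p z + b = 0"
        using z(1) pz by (simp add: field_simps)
      then have *: "a * (poly (pderiv ?q) z / poly ?q z) = - b"
        unfolding ratio[symmetric] by (simp add: eq_neg_iff_add_eq_0)
      obtain a' b' where ab: "a = of_real a'" "b = of_real b'" 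
        using assms(2,3) by (auto elim!: Reals_cases)
      from * have "a' * Im (poly (pderiv ?q) z / poly ?q z) = 0"
        unfolding ab by (simp del: times_divide_eq_right add: complex_eq_iff)
      moreover have "a' \<noteq> 0" using False ab by auto
      ultimately show False using L(3) False by auto
    qed
  qed
qed

lemma only_real_zeros_pderiv:
  assumes "only_real_zeros p" "pderiv p \<noteq> 0"
  shows "only_real_zeros (pderiv p)"
  using only_real_zeros_add_pderiv[OF assms(1), of 1 0] assms(2) by simp

lemma only_real_zeros_higher_pderiv:
  assumes "only_real_zeros p" "(pderiv ^^ n) p \<noteq> 0"
  shows "only_real_zeros ((pderiv ^^ n) p)"
  using assms(2)
proof (induction n)
  case (Suc n)
  then show ?case using only_real_zeros_pderiv[of "(pderiv ^^ n) p"] by fastforce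
qed (use assms(1) in simp)

text \<open>The operator \<open>c(D)\<close> for a formal power series \<open>c\<close>. A bare
  coefficient sequence serves both polynomials (\<open>coeff q\<close>) and Taylor series of entire
  functions; terms beyond \<open>degree P\<close> would vanish.\<close>

definition diff_op :: "(nat \<Rightarrow> complex) \<Rightarrow> complex poly \<Rightarrow> complex poly" where
  "diff_op c P = (\<Sum>j\<le>degree P. smult (c j) ((pderiv ^^ j) P))"

lemma higher_pderiv_eq_0:
  fixes P :: "complex poly"
  shows "degree P < j \<Longrightarrow> (pderiv ^^ j) P = 0"
  by (rule poly_eqI) (simp add: coeff_higher_pderiv coeff_eq_0)

lemma diff_op_eq:
  assumes "degree P \<le> N"
  shows "diff_op c P = (\<Sum>j\<le>N. smult (c j) ((pderiv ^^ j) P))"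
  unfolding diff_op_def
  by (rule sum.mono_neutral_left) (use assms higher_pderiv_eq_0 in auto)

lemma smult_sum_right:
  "smult c (\<Sum>j\<in>J. f j) = (\<Sum>j\<in>J. smult c (f j))"
  by (induction J rule: infinite_finite_induct) (simp_all add: smult_add_right)

lemma pderiv_sum_smult:
  fixes P :: "nat \<Rightarrow> complex poly"
  shows "pderiv (\<Sum>j\<in>J. smult (c j) (P j)) = (\<Sum>j\<in>J. smult (c j) (pderiv (P j)))"
  by (induction J rule: infinite_finite_induct) (simp_all add: pderiv_add pderiv_smult)

text \<open>Products of symbols become compositions of operators, so \<open>(D - a) q(D)\<close>
  acts as \<open>q(D)\<close> followed by \<open>D - a\<close>. This peels one root at a time off
  the symbol.\<close>

lemma diff_op_linear_factor:
  "diff_op (coeff ([:-a, 1:] * q)) P = smult 1 (pderiv (diff_op (coeff q) P))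
    + smult (- a) (diff_op (coeff q) P)"
proof -
  let ?N = "degree P"
  have "diff_op (coeff ([:-a, 1:] * q)) P
    = (\<Sum>j\<le>Suc ?N. smult (coeff ([:-a, 1:] * q) j) ((pderiv ^^ j) P))"
    by (rule diff_op_eq) simp
  also have "\<dots> = (\<Sum>j\<le>Suc ?N. smult (- a) (smult (coeff q j) ((pderiv ^^ j) P))) +
      (\<Sum>j\<le>Suc ?N. smult (coeff (pCons 0 q) j) ((pderiv ^^ j) P))"
    unfolding sum.distrib[symmetric] by (rule sum.cong) (simp_all add: smult_diff_left)
  also have "(\<Sum>j\<le>Suc ?N. smult (coeff (pCons 0 q) j) ((pderiv ^^ j) P)) = 
      (\<Sum>j\<le>?N. smult (coeff q j) (pderiv ((pderiv ^^ j) P)))"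
    by (subst sum.atMost_Suc_shift) simp
  also have "\<dots> = pderiv (diff_op (coeff q) P)"
    by (simp add: diff_op_def pderiv_sum_smult)
  also have "(\<Sum>j\<le>Suc ?N. smult (- a) (smult (coeff q j) ((pderiv ^^ j) P)))
    = smult (-a) (diff_op (coeff q) P)"
    by (subst diff_op_eq[of P "Suc ?N"]) (simp_all only: smult_sum_right le_SucI order_refl)
  finally show ?thesis by (simp only: smult_1_left add.commute)
qed

lemma diff_op_smult: "diff_op (coeff (smult c q)) P = smult c (diff_op (coeff q) P)"
  by (simp add: diff_op_def smult_sum_right)

lemma only_real_zeros_diff_op:
  assumes q: "only_real_zeros q" and P: "only_real_zeros P" and nz: "diff_op (coeff q) P \<noteq> 0"
  shows "only_real_zeros (diff_op (coeff q) P)"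
proof -
  obtain A where A: "q = smult (lead_coeff q) (\<Prod>a\<in>#A. [:-a, 1:])"
    "\<And>a. a \<in># A \<Longrightarrow> a \<in> \<real>" using only_real_zeros_factorization[OF q] by blast
  let ?D = "\<lambda>A. diff_op (coeff (\<Prod>a\<in>#A. [:-a, 1:])) P"
  \<comment> \<open>An intermediate result may be zero, and zero then stays zero, so vanishing is
    part of the induction invariant. The hypothesis \<open>nz\<close> removes it at the end.\<close>
  have "?D A = 0 \<or> only_real_zeros (?D A)"
    using A(2)
  proof (induction A)
    case empty
    have "?D {#} = (\<Sum>j\<le>degree P. if j = 0 then P else 0)"
      unfolding diff_op_def by (rule sum.cong) auto
    then have "?D {#} = P" by simp
    then show ?case using P by metis
  next
    case (add a A)
    have "?D (add_mset a A) = smult 1 (pderiv (?D A)) + smult (- a) (?D A)"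
      using diff_op_linear_factor by simp
    then show ?case
      using add.IH add.prems only_real_zeros_add_pderiv[of "?D A" 1 "-a"]
      by (metis Reals_1 Reals_minus_iff add_mset_eq_singleton_iff insert_iff pderiv_0
        set_mset_add_mset_insert smult_0_right add_0)
  qed
  moreover have "diff_op (coeff q) P = smult (lead_coeff q) (?D A)"
    by (subst A(1)) (rule diff_op_smult)
  ultimately show ?thesis using nz by (auto simp: only_real_zeros_def)
qed

text \<open>Hurwitz's theorem on a half-plane: the \<open>f n\<close> have no zeros there, so
  neither has a non-constant limit. If \<open>g\<close> were constant there, it would be constant on
  the whole plane, against \<open>g z = 0\<close> and \<open>g z1 \<noteq> 0\<close>.\<close>

lemma real_zeros_limit:
  fixes f :: "nat \<Rightarrow> complex \<Rightarrow> complex"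
  assumes f: "\<And>n. f n holomorphic_on UNIV" and g: "g holomorphic_on UNIV"
    and lim: "\<And>R. R > 0 \<Longrightarrow> uniform_limit (cball 0 R) f g sequentially"
    and real: "\<And>n z. f n z = 0 \<Longrightarrow> z \<in> \<real>" and nz: "g z1 \<noteq> 0" and z: "g z = 0"
  shows "z \<in> \<real>"
proof (rule ccontr)
  assume "z \<notin> \<real>"
  then have Im: "Im z \<noteq> 0" by (simp add: complex_is_Real_iff)
  \<comment> \<open>The open half-plane containing \<open>z\<close>, upper or lower according to the
    sign of \<open>Im z\<close>.\<close>
  define S where "S = {w. Im z * Im w > 0}"
  have S: "open S" "connected S"
  proof -
    show "open S" unfolding S_def by (intro open_Collect_less continuous_intros)
    have "convex S"
      unfolding S_def convex_def
    proof safe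
      fix x y :: complex and u v :: real
      assume *: "0 < Im z * Im x" "0 < Im z * Im y" "0 \<le> u" "0 \<le> v" "u + v = 1"
      have "0 < u * (Im z * Im x) + v * (Im z * Im y)"
        using * by (metis add_nonneg_pos add_pos_nonneg less_eq_real_def mult_nonneg_nonneg
          mult_pos_pos zero_less_one add.right_neutral)
      then show "0 < Im z * Im (u *\<^sub>R x + v *\<^sub>R y)" by (simp add: algebra_simps)
    qed
    then show "connected S" by (rule convex_connected)
  qed
  have zS: "z \<in> S" using Im by (auto simp: S_def zero_less_mult_iff)
  have "g z \<noteq> 0"
  proof (rule Hurwitz_no_zeros[OF S, of f g])
    show "f n holomorphic_on S" "g holomorphic_on S" for n
      using f g holomorphic_on_subset by blast+
    show "uniform_limit K f g sequentially" if K: "compact K" "K \<subseteq> S" for K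
    proof -
      obtain R where "R > 0" "K \<subseteq> cball 0 R"
        using compact_imp_bounded[OF K(1)]
          by (metis bounded_subset_ballD ball_subset_cball subset_trans)
      then show ?thesis using lim uniform_limit_on_subset by blast
    qed
    show "\<not> g constant_on S"
    proof
      assume "g constant_on S"
      then have "g constant_on UNIV"
        using analytic_continuation'[OF g open_UNIV connected_UNIV, of S z] zS S(1)
          interior_limit_point[of z S] by (simp add: interior_open)
      then have "g z = g z1" unfolding constant_on_def by auto
      then show False using z nz by simp
    qed
    show "f n w \<noteq> 0" if "w \<in> S" for n w
      using real[of n w] that unfolding S_def by (auto simp: complex_is_Real_iff)
    show "z \<in> S" by fact
  qed
  then show False using z by simp
qed

lemma uniform_limit_sum_finite:
  fixes f :: "'i \<Rightarrow> 'n \<Rightarrow> 'a \<Rightarrow> 'b::real_normed_vector"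
  assumes "finite I" "\<And>i. i \<in> I \<Longrightarrow> uniform_limit S (f i) (g i) F"
  shows "uniform_limit S (\<lambda>n x. \<Sum>i\<in>I. f i n x) (\<lambda>x. \<Sum>i\<in>I. g i x) F"
  using assms by (induction I rule: finite_induct) (auto intro!: uniform_limit_intros)

lemma uniform_limit_poly:
  assumes deg: "\<And>n. degree (p n) \<le> d" "degree q \<le> d"
    and lim: "\<And>k. (\<lambda>n. coeff (p n) k) \<longlonglongrightarrow> (coeff q k :: complex)"
  shows "uniform_limit (cball 0 R) (\<lambda>n z. poly (p n) z) (poly q) sequentially"
proof -
  have eq: "poly p' z = (\<Sum>k\<le>d. coeff p' k * z ^ k)" if "degree p' \<le> d" for p' and z :: complex
    unfolding poly_altdef by (rule sum.mono_neutral_left) (use that in \<open>auto simp: coeff_eq_0\<close>)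
  have "uniform_limit (cball 0 R) (\<lambda>n z. \<Sum>k\<le>d. coeff (p n) k * z ^ k) (\<lambda>z. \<Sum>k\<le>d. coeff q k
    * z ^ k) sequentially"
  proof (intro uniform_limit_sum_finite uniform_lim_mult)
    fix k :: nat
    show "finite {..d}" by simp
    show "uniform_limit (cball 0 R) (\<lambda>n z. coeff (p n) k) (\<lambda>z. coeff q k) sequentially"
      using lim[of k] by (auto simp: uniform_limit_iff tendsto_iff)
    show "uniform_limit (cball 0 R) (\<lambda>n z. z ^ k) (\<lambda>z. z ^ k) sequentially"
      by (rule uniform_limit_const)
    show "bounded ((\<lambda>z::complex. coeff q k) ` cball 0 R)"
      by (auto simp: bounded_iff)
    show "bounded ((\<lambda>z::complex. z ^ k) ` cball 0 R)"
      by (intro compact_imp_bounded compact_continuous_image continuous_intros compact_cball)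
  qed
  then show ?thesis
    by (rule uniform_limit_cong'[THEN iffD1, rotated 2]) (simp_all add: eq deg)
qed

lemma only_real_zeros_limit:
  assumes deg: "\<And>n. degree (p n) \<le> d" "degree q \<le> d"
    and lim: "\<And>k. (\<lambda>n. coeff (p n) k) \<longlonglongrightarrow> coeff q k"
    and p: "\<And>n. only_real_zeros (p n)" and q: "q \<noteq> 0"
  shows "only_real_zeros q"
  unfolding only_real_zeros_def
proof (intro allI impI)
  fix z assume z: "poly q z = 0"
  obtain z1 where z1: "poly q z1 \<noteq> 0" using q poly_all_0_iff_0 by blast
  show "z \<in> \<real>"
    by (rule real_zeros_limit[of "\<lambda>n. poly (p n)" "poly q",
      OF _ _ uniform_limit_poly[OF deg lim] _ z1 z])
      (use p in \<open>auto simp: only_real_zeros_def intro!: holomorphic_intros\<close>)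
qed

section \<open>Laguerre polynomials\<close>

lemma coeff_gen_laguerre:
  "coeff (gen_laguerre \<alpha> d) k
    = (if k \<le> d then ((of_nat d + \<alpha>) gchoose (d - k)) * (- 1) ^ k / fact k else 0)"
  by (simp add: gen_laguerre_def coeff_sum coeff_monom)

lemma degree_gen_laguerre: "degree (gen_laguerre \<alpha> d) = d"
  by (rule antisym[OF degree_le le_degree]) (auto simp: coeff_gen_laguerre)

lemma gbinomial_Suc_factor:
  fixes a :: real
  shows "of_nat (Suc m) * (a gchoose Suc m) = (a - of_nat m) * (a gchoose m)"
  using gbinomial_absorption[of m a] gbinomial_absorb_comp[of a m] by simp

text \<open>Coefficients are compared one by one: \<open>up\<close> changes the degree at a fixed
  power of \<open>x\<close>, \<open>left\<close> the power at a fixed degree. Both come from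
  absorption identities for \<open>gchoose\<close> and hold for every real \<beta>.\<close>

lemma gen_laguerre_three_term:
  "smult (of_nat (Suc (Suc d))) (gen_laguerre \<beta> (Suc (Suc d))) =
     [:2 * of_nat (Suc d) + 1 + \<beta>, -1:] * gen_laguerre \<beta> (Suc d) - smult (of_nat (Suc d)
       + \<beta>) (gen_laguerre \<beta> d)"
proof (rule poly_eqI)
  fix k
  let ?l = "\<lambda>e. coeff (gen_laguerre \<beta> e)"
  have up: "of_nat (Suc e - k) * ?l (Suc e) k = (of_nat (Suc e) + \<beta>) * ?l e k" if "k \<le> e" for e k
    using that gbinomial_absorption'[of "Suc e - k" "of_nat (Suc e) + \<beta>"]
    by (simp add: coeff_gen_laguerre Suc_diff_le field_simps)
  have left: "of_nat (e - k) * ?l e k = - of_nat (Suc k) * (\<beta> + of_nat (Suc k)) * ?l e (Suc k)"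
    if "k < e" for e k
  proof -
    obtain m where m: "e = Suc (k + m)" using \<open>k < e\<close> less_iff_Suc_add by auto
    define A where "A = of_nat e + \<beta>"
    define s where "s = (- 1) ^ k / (fact k :: real)"
    have 1: "?l e k = (A gchoose Suc m) * s"
      by (simp add: coeff_gen_laguerre A_def s_def m Suc_diff_le)
    have 2: "of_nat (Suc k) * ?l e (Suc k) = - ((A gchoose m) * s)"
      by (simp add: coeff_gen_laguerre A_def s_def m)
    have "of_nat (e - k) * ?l e k = (of_nat (Suc m) * (A gchoose Suc m)) * s"
      unfolding 1 by (simp add: m)
    also have "of_nat (Suc m) * (A gchoose Suc m) = (\<beta> + of_nat (Suc k)) * (A gchoose m)"
      unfolding gbinomial_Suc_factor by (simp add: A_def m)
    also have "\<dots> * s = - (\<beta> + of_nat (Suc k)) * (of_nat (Suc k) * ?l e (Suc k))"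
      unfolding 2 by (simp add: algebra_simps)
    finally show ?thesis by (simp add: algebra_simps)
  qed
  have "(of_nat (Suc (Suc d))) * ?l (Suc (Suc d)) k =
      (2 * of_nat (Suc d) + 1 + \<beta>) * ?l (Suc d) k - (case k of 0 \<Rightarrow> 0 | Suc i \<Rightarrow> ?l (Suc d) i)
        - (of_nat (Suc d) + \<beta>) * ?l d k"
  proof (cases "k \<le> Suc d")
    case True
    have down: "(of_nat (Suc d) + \<beta>) * ?l d k = (of_nat (Suc d) - of_nat k) * ?l (Suc d) k"
    proof (cases "k \<le> d")
      case True
      then show ?thesis using up[of k d] by (simp add: of_nat_diff Suc_diff_le algebra_simps)
    next
      case False
      then have "k = Suc d" using True by simp
      then show ?thesis by (simp add: coeff_gen_laguerre)
    qed
    \<comment> \<open>After multiplication by \<open>D = d + 2 - k\<close> every term becomes a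
      multiple of the coefficient of \<open>x^k\<close> in degree \<open>d + 1\<close>. At
      \<open>k = d + 2\<close> the factor vanishes, so the leading coefficient is compared
      separately below.\<close>
    define D where "D = of_nat (Suc (Suc d)) - (of_nat k :: real)"
    have D: "D > 0" using True by (simp add: D_def)
    have u: "D * ?l (Suc (Suc d)) k = (of_nat (Suc (Suc d)) + \<beta>) * ?l (Suc d) k"
      using up[of k "Suc d"] True by (simp add: D_def of_nat_diff Suc_diff_le algebra_simps)
    have l: "D * (case k of 0 \<Rightarrow> 0 | Suc i \<Rightarrow> ?l (Suc d) i)
      = - of_nat k * (\<beta> + of_nat k) * ?l (Suc d) k"
    proof (cases k)
      case (Suc i)
      then show ?thesis using left[of i "Suc d"] True by (simp add: D_def of_nat_diff algebra_simps)
    qed simp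
    have "D * ((2 * of_nat (Suc d) + 1 + \<beta>) * ?l (Suc d) k
      - (case k of 0 \<Rightarrow> 0 | Suc i \<Rightarrow> ?l (Suc d) i) - (of_nat (Suc d) + \<beta>) * ?l d k)
       = D * ((2 * of_nat (Suc d) + 1 + \<beta>) * ?l (Suc d) k)
         + of_nat k * (\<beta> + of_nat k) * ?l (Suc d) k
         - D * ((of_nat (Suc d) - of_nat k) * ?l (Suc d) k)"
      unfolding down right_diff_distrib l by simp
    also have "\<dots> = of_nat (Suc (Suc d)) * ((of_nat (Suc (Suc d)) + \<beta>) * ?l (Suc d) k)"
      by (simp add: D_def algebra_simps)
    also have "\<dots> = D * (of_nat (Suc (Suc d)) * ?l (Suc (Suc d)) k)"
      unfolding u[symmetric] by simp
    finally show ?thesis using D by simp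
  next
    case False
    show ?thesis
    proof (cases "k = Suc (Suc d)")
      case True
      then show ?thesis by (simp add: coeff_gen_laguerre divide_simps)
    next
      case False
      then show ?thesis using \<open>\<not> k \<le> Suc d\<close> by (auto simp: coeff_gen_laguerre split: nat.splits)
    qed
  qed
  then show "coeff (smult (of_nat (Suc (Suc d))) (gen_laguerre \<beta> (Suc (Suc d)))) k =
    coeff ([:2 * of_nat (Suc d) + 1 + \<beta>, -1:] * gen_laguerre \<beta> (Suc d)
      - smult (of_nat (Suc d) + \<beta>) (gen_laguerre \<beta> d)) k"
    by (simp add: coeff_pCons split: nat.splits)
qed

text \<open>Pascal's rule, applied to each coefficient.\<close>

lemma gen_laguerre_diff:
  "gen_laguerre \<alpha> (Suc d) = gen_laguerre (\<alpha> + 1) (Suc d) - gen_laguerre (\<alpha> + 1) d"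
proof (rule poly_eqI)
  fix k
  consider "k \<le> d" | "k = Suc d" | "k > Suc d" by linarith
  then show "coeff (gen_laguerre \<alpha> (Suc d)) k = coeff (gen_laguerre (\<alpha> + 1) (Suc d)
    - gen_laguerre (\<alpha> + 1) d) k"
  proof cases
    case 1
    have "(real (Suc d) + (\<alpha> + 1)) gchoose (Suc (d - k)) = ((real (Suc d) + \<alpha>) gchoose (d - k))
      + ((real (Suc d) + \<alpha>) gchoose (Suc (d - k)))"
      using gbinomial_Suc_Suc[of "real (Suc d) + \<alpha>" "d - k"] by (simp add: add_ac)
    moreover have "real d + (\<alpha> + 1) = real (Suc d) + \<alpha>" by simp
    ultimately show ?thesis using 1 unfolding coeff_gen_laguerre coeff_diff
      by (simp add: Suc_diff_le field_simps)
  qed (simp_all add: coeff_gen_laguerre)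
qed

abbreviation (input) cpoly :: "real poly \<Rightarrow> complex poly" where
  "cpoly \<equiv> map_poly of_real"

lemma cpoly_simps:
  "cpoly (p - q) = cpoly p - cpoly q"
  "cpoly (smult c p) = smult (of_real c) (cpoly p)"
  "cpoly ([:a, b:] * p) = [:of_real a, of_real b:] * cpoly p"
  by (rule poly_eqI; simp add: coeff_map_poly coeff_pCons split: nat.splits)+

lemma Im_inverse_pos: "Im (r::complex) < 0 \<Longrightarrow> Im (inverse r) > 0"
  using sum_power2_gt_zero_iff[of "Re r" "Im r"] by (simp add: divide_neg_pos)

text \<open>The contiguity relation \<open>gen_laguerre_diff\<close> turns this sign into the absence of non-real zeros
  down to \<open>\<alpha> = - 2\<close>: where two consecutive polynomials for the parameter \<open>\<alpha> + 1\<close> have a quotient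
  with negative imaginary part, their difference does not vanish.\<close>

lemma Im_laguerre_ratio:
  assumes \<beta>: "\<beta> \<ge> -1" and x: "Im x > 0"
  shows "poly (cpoly (gen_laguerre \<beta> d)) x \<noteq> 0 \<and> 
    Im (poly (cpoly (gen_laguerre \<beta> (Suc d))) x / poly (cpoly (gen_laguerre \<beta> d)) x) < 0"
proof (induction d)
  case 0
  have "gen_laguerre \<beta> 0 = 1" "gen_laguerre \<beta> (Suc 0) = [:1 + \<beta>, -1:]"
    by (auto intro!: poly_eqI simp: coeff_gen_laguerre coeff_1 coeff_pCons split: nat.splits)
  then show ?case using x by (simp add: map_poly_pCons)
next
  case (Suc d)
  let ?L = "\<lambda>d. poly (cpoly (gen_laguerre \<beta> d)) x"
  define r where "r = ?L (Suc d) / ?L d"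
  have r: "Im r < 0" "r \<noteq> 0" "?L d \<noteq> 0" using Suc by (auto simp: r_def)
  then have Ls: "?L (Suc d) \<noteq> 0" by (auto simp: r_def)
  have "cpoly (smult (of_nat (Suc (Suc d))) (gen_laguerre \<beta> (Suc (Suc d)))) =
     cpoly ([:2 * of_nat (Suc d) + 1 + \<beta>, -1:] * gen_laguerre \<beta> (Suc d)
       - smult (of_nat (Suc d) + \<beta>) (gen_laguerre \<beta> d))"
    by (simp only: gen_laguerre_three_term)
  then have "smult (of_nat (Suc (Suc d))) (cpoly (gen_laguerre \<beta> (Suc (Suc d)))) =
     [:2 * of_nat (Suc d) + 1 + of_real \<beta>, -1:] * cpoly (gen_laguerre \<beta> (Suc d))
       - smult (of_nat (Suc d) + of_real \<beta>) (cpoly (gen_laguerre \<beta> d))"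
    unfolding cpoly_simps by simp
  then have "poly (smult (of_nat (Suc (Suc d))) (cpoly (gen_laguerre \<beta> (Suc (Suc d))))) x =
     poly ([:2 * of_nat (Suc d) + 1 + of_real \<beta>, -1:] * cpoly (gen_laguerre \<beta> (Suc d))
       - smult (of_nat (Suc d) + of_real \<beta>) (cpoly (gen_laguerre \<beta> d))) x"
    by (rule arg_cong)
  then have "of_nat (Suc (Suc d)) * ?L (Suc (Suc d))
    = (2 * of_nat (Suc d) + 1 + of_real \<beta> - x) * ?L (Suc d) - (of_nat (Suc d) + of_real \<beta>) * ?L d"
    by (simp add: algebra_simps)
  \<comment> \<open>Divided by \<open>?L (Suc d)\<close>, the recurrence is one step of a continued
    fraction for the quotient. Inversion maps \<open>Im < 0\<close> to \<open>Im > 0\<close>, so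
    \<open>- x\<close> and the last term both push the new quotient below the real axis; the
    coefficient \<open>d + 1 + \<beta>\<close> is nonnegative for all \<open>d\<close> exactly when
    \<beta> is at least -1.\<close>
  then have "of_nat (Suc (Suc d)) * (?L (Suc (Suc d)) / ?L (Suc d))
    = (2 * of_nat (Suc d) + 1 + of_real \<beta> - x) - (of_nat (Suc d) + of_real \<beta>) * inverse r"
    using Ls r(3) unfolding r_def by (simp add: field_simps)
  also have "\<dots> = of_real (2 * real (Suc d) + 1 + \<beta>) - x - of_real (real (Suc d) + \<beta>) * inverse r"
    by simp
  moreover have IR: "Im (complex_of_real a * w) = a * Im w" for a w by simp
  ultimately have "Im (of_real (real (Suc (Suc d))) * (?L (Suc (Suc d)) / ?L (Suc d)))
    = Im (of_real (2 * real (Suc d) + 1 + \<beta>) - x - of_real (real (Suc d) + \<beta>) * inverse r)" by simp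
  then have "real (Suc (Suc d)) * Im (?L (Suc (Suc d)) / ?L (Suc d))
    = 0 - Im x - (real (Suc d) + \<beta>) * Im (inverse r)"
    by (simp only: minus_complex.simps Im_complex_of_real IR)
  also have "\<dots> < 0"
    using x Im_inverse_pos[OF r(1)] \<beta> mult_nonneg_nonneg[of "real (Suc d) + \<beta>" "Im (inverse r)"]
      by linarith
  finally show ?case using Ls by (metis mult_nonneg_nonneg not_le of_nat_0_le_iff)
qed

lemma poly_map_of_real_cnj: "poly (cpoly p) (cnj z) = cnj (poly (cpoly p) z)"
  by (induction p) (simp_all add: map_poly_pCons)

lemma only_real_zeros_gen_laguerre:
  assumes "\<alpha> \<ge> -2"
  shows "only_real_zeros (cpoly (gen_laguerre \<alpha> d))"
proof (cases d)
  case 0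
  have "gen_laguerre \<alpha> 0 = 1"
    by (auto intro!: poly_eqI simp: coeff_gen_laguerre coeff_1)
  then show ?thesis using 0 by (simp add: only_real_zeros_def)
next
  case (Suc d')
  have UHP: "poly (cpoly (gen_laguerre \<alpha> d)) x \<noteq> 0" if "Im x > 0" for x
  proof
    let ?L = "\<lambda>d. poly (cpoly (gen_laguerre (\<alpha> + 1) d)) x"
    assume "poly (cpoly (gen_laguerre \<alpha> d)) x = 0"
    moreover have "poly (cpoly (gen_laguerre \<alpha> d)) x = ?L d - ?L d'"
      unfolding Suc gen_laguerre_diff[of \<alpha> d'] by (simp add: cpoly_simps)
    \<comment> \<open>The quotient of the two values would be 1, which has imaginary part 0.\<close>
    ultimately have "?L (Suc d') = ?L d'" by (simp add: Suc)
    with Im_laguerre_ratio[of "\<alpha> + 1" x d'] assms that show False by (auto split: if_splits)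
  qed
  show ?thesis unfolding only_real_zeros_def
  proof (intro allI impI, rule ccontr)
    fix z assume z: "poly (cpoly (gen_laguerre \<alpha> d)) z = 0" "z \<notin> \<real>"
    then have "Im z > 0 \<or> Im (cnj z) > 0" by (auto simp: complex_is_Real_iff)
    then show False using UHP z(1) poly_map_of_real_cnj by (metis complex_cnj_zero_iff)
  qed
qed

text \<open>In \<open>Q_poly\<close> the factor \<open>x^j\<close> together with the drop of the
  Laguerre degree to \<open>d - j\<close> corresponds, after reversal, to differentiating
  \<open>j\<close> times.\<close>

definition rev_laguerre :: "real \<Rightarrow> nat \<Rightarrow> complex poly" where
  "rev_laguerre \<alpha> d = reflect_poly (cpoly (gen_laguerre \<alpha> d))"

lemma degree_cpoly [simp]: "degree (cpoly p) = degree p"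
  by (rule degree_map_poly) simp

lemma only_real_zeros_rev_laguerre:
  assumes "\<alpha> \<ge> -2"
  shows "only_real_zeros (rev_laguerre \<alpha> d)"
  unfolding only_real_zeros_def
proof (intro allI impI)
  fix z assume z: "poly (rev_laguerre \<alpha> d) z = 0"
  show "z \<in> \<real>"
  proof (cases "z = 0")
    case False
    then have "poly (cpoly (gen_laguerre \<alpha> d)) (inverse z) = 0"
      using z by (simp add: rev_laguerre_def poly_reflect_poly_nz)
    then have "inverse z \<in> \<real>" using only_real_zeros_gen_laguerre[OF assms]
      unfolding only_real_zeros_def by blast
    then show ?thesis by (metis Reals_inverse inverse_inverse_eq)
  qed simp
qed

lemma higher_pderiv_monom_le:
  assumes "j \<le> m"
  shows "(pderiv ^^ j) (monom c m) = monom (pochhammer (of_nat (m - j) + 1) j * c) (m - j)"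
  using assms by (intro poly_eqI) (auto simp: coeff_higher_pderiv add.commute)

text \<open>Up to reversing the coefficients, the polynomial is \<open>F\<^sup>(\<^sup>n\<^sup>)(D)\<close> applied to the reversed
  Laguerre polynomial, where \<open>F(w) = \<Sum> \<gamma>(m) w\<^sup>m / m!\<close>.\<close>

lemma poly_Q_poly:
  assumes z: "z \<noteq> 0"
  shows "poly (Q_poly d n \<alpha>) z
    = z ^ d * poly (diff_op (\<lambda>j. xi_gamma (n + j) / fact j) (rev_laguerre \<alpha> d)) (inverse z)"
proof -
  let ?c = "\<lambda>j k. complex_of_real (((real d + \<alpha>) gchoose j) * ((real d - real j + \<alpha>) gchoose (d
    - j - k)) * (- 1) ^ k / fact k)"
  have lag: "cpoly (gen_laguerre \<alpha> e)
    = (\<Sum>k\<le>e. monom (of_real (((of_nat e + \<alpha>) gchoose (e - k)) * (- 1) ^ k / fact k)) k)" for e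
    by (rule poly_eqI) (simp add: coeff_map_poly coeff_gen_laguerre coeff_sum coeff_monom)
  have rev: "rev_laguerre \<alpha> d
    = (\<Sum>k\<le>d. monom (of_real (((of_nat d + \<alpha>) gchoose (d - k)) * (- 1) ^ k / fact k)) (d - k))"
  proof (rule poly_eqI)
    fix i
    have "coeff (rev_laguerre \<alpha> d) i
      = (if i \<le> d then of_real (coeff (gen_laguerre \<alpha> d) (d - i)) else 0)"
      by (simp add: rev_laguerre_def coeff_reflect_poly degree_gen_laguerre coeff_map_poly)
    also have "\<dots> = (\<Sum>k\<le>d. if d - k = i \<and> i
      \<le> d then of_real (((of_nat d + \<alpha>) gchoose (d - k)) * (- 1) ^ k / fact k) else 0)"
    proof (cases "i \<le> d")
      case True
      have "(\<Sum>k\<le>d. if d - k = i \<and> i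
        \<le> d then complex_of_real (((of_nat d + \<alpha>) gchoose (d - k)) * (- 1) ^ k / fact k) else 0)
        = (\<Sum>k\<le>d. if d - i = k then complex_of_real (((of_nat d + \<alpha>) gchoose (d - k))
          * (- 1) ^ k / fact k) else 0)"
        by (rule sum.cong) (use True in auto)
      then show ?thesis using True by (simp add: coeff_gen_laguerre)
    qed simp
    also have "\<dots> = coeff (\<Sum>k\<le>d. monom (of_real (((of_nat d + \<alpha>) gchoose (d - k))
      * (- 1) ^ k / fact k)) (d - k)) i"
      unfolding coeff_sum coeff_monom by (rule sum.cong) auto
    finally show "coeff (rev_laguerre \<alpha> d) i = \<dots>" .
  qed
  have "poly (Q_poly d n \<alpha>) z = (\<Sum>j\<le>d. \<Sum>k\<le>d-j. ?c j k * xi_gamma (n + j) * z ^ (j + k))"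
    unfolding Q_poly_def lag poly_sum poly_mult poly_monom sum_distrib_left
    by (intro sum.cong refl) (simp add: of_nat_diff power_add)
  also have "\<dots> = (\<Sum>j\<le>d. \<Sum>k\<le>d. if k \<le> d - j then ?c j k * xi_gamma (n + j) * z ^ (j + k) else 0)"
    by (intro sum.cong refl sum.mono_neutral_cong_left) auto
  also have "\<dots> = (\<Sum>j\<le>d. \<Sum>k\<le>d. z ^ d * (xi_gamma (n + j) / fact j
    * poly ((pderiv ^^ j) (monom (of_real (((of_nat d + \<alpha>) gchoose (d - k)) * (- 1) ^ k / fact k))
    (d - k))) (inverse z)))"
  proof (intro sum.cong refl)
    fix j k assume jk: "j \<in> {..d}" "k \<in> {..d}"
    let ?l = "complex_of_real (((of_nat d + \<alpha>) gchoose (d - k)) * (- 1) ^ k / fact k)"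
    show "(if k \<le> d - j then ?c j k * xi_gamma (n + j) * z ^ (j + k) else 0)
      = z ^ d * (xi_gamma (n + j) / fact j * poly ((pderiv ^^ j) (monom ?l (d - k))) (inverse z))"
    proof (cases "k \<le> d - j")
      case True
      then have jd: "j \<le> d - k" using jk by auto
      define u v s where "u = complex_of_real ((real d + \<alpha>) gchoose (d - k))"
        and "v = complex_of_real (real (d - k) gchoose j)" and "s
          = complex_of_real ((- 1) ^ k / fact k)"
      have "(pderiv ^^ j) (monom ?l (d - k))
        = monom (pochhammer (of_nat (d - k - j) + 1) j * ?l) (d - k - j)"
        by (rule higher_pderiv_monom_le[OF jd])
      \<comment> \<open>The factor produced by the derivative is \<open>fact j\<close> times a
        binomial coefficient; the \<open>fact j\<close> cancels against the denominator in the
        operator.\<close>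
      moreover have "pochhammer (complex_of_nat (d - k - j) + 1) j = v * fact j"
      proof -
        have "pochhammer (complex_of_nat (d - k - j) + 1) j
          = complex_of_real (pochhammer (real (d - k - j) + 1) j)"
          by (simp add: pochhammer_of_real[symmetric])
        also have "pochhammer (real (d - k - j) + 1) j = (real (d - k) gchoose j) * fact j"
          using jd by (simp add: gbinomial_pochhammer' of_nat_diff[of j "d
            - k"] del: diff_diff_left)
        finally show ?thesis by (simp add: v_def)
      qed
      moreover have "?l = u * s" by (simp add: u_def s_def)
      ultimately have rhs: "poly ((pderiv ^^ j) (monom ?l (d - k))) (inverse z)
        = v * fact j * (u * s) * inverse z ^ (d - k - j)"
        by (simp only: poly_monom)
      have zz: "z ^ d * inverse z ^ (d - k - j) = z ^ (j + k)"
      proof -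
        have "d = (j + k) + (d - k - j)" using jd jk by auto
        then have "z ^ d = z ^ (j + k) * z ^ (d - k - j)" by (metis power_add)
        then show ?thesis using z by (simp add: field_simps del: diff_diff_left)
      qed
      \<comment> \<open>Trinomial revision with the real upper index \<open>d + \<alpha>\<close>. It
        fits because \<alpha> stays fixed while the degree drops to \<open>d - j\<close>, so the
        second upper index is \<open>d + \<alpha> - j\<close>.\<close>
      have tri: "((real d + \<alpha>) gchoose j) * ((real d - real j + \<alpha>) gchoose (d - j - k))
        = ((real d + \<alpha>) gchoose (d - k)) * (real (d - k) gchoose j)"
      proof -
        have e: "real d + \<alpha> - real j = real d - real j + \<alpha>" "d - k - j = d - j - k" by simp_all
        show ?thesis using gbinomial_trinomial_revision[OF jd, of "real d + \<alpha>"] unfolding e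
          by (rule sym)
      qed
      have lhs: "?c j k = u * v * s"
        unfolding tri u_def v_def s_def
          by (simp only: of_real_mult[symmetric] times_divide_eq_right mult.assoc)
      have gen: "A * (G / f * (v * f * (u * s) * I)) = u * v * s * G * (A * I)" if "f \<noteq> 0"
        for A G f I :: complex
        using that by simp
      have "z ^ d * (xi_gamma (n + j) / fact j * poly ((pderiv ^^ j) (monom ?l (d - k)))
        (inverse z))
          = u * v * s * xi_gamma (n + j) * (z ^ d * inverse z ^ (d - k - j))"
        unfolding rhs by (rule gen) simp
      then show ?thesis using True unfolding lhs zz by (simp only: if_True)
    next
      case False
      then have "(pderiv ^^ j) (monom ?l (d - k)) = 0"
        using jk by (intro higher_pderiv_eq_0 le_less_trans[OF degree_monom_le]) auto
      then show ?thesis using False by simp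
    qed
  qed
  also have "\<dots> = z ^ d * (\<Sum>j\<le>d. xi_gamma (n + j) / fact j * poly ((pderiv ^^ j) (rev_laguerre \<alpha> d))
    (inverse z))"
    unfolding rev by (simp add: sum_distrib_left higher_pderiv_sum poly_sum)
  also have "\<dots> = z ^ d * poly (diff_op (\<lambda>j. xi_gamma (n + j) / fact j) (rev_laguerre \<alpha> d))
    (inverse z)"
  proof -
    \<comment> \<open>Only an inequality: the constant coefficient of the Laguerre polynomial can
      vanish, for instance at \<alpha> = -1 with \<open>d \<ge> 1\<close>, and reversal then lowers
      the degree.\<close>
    have "degree (rev_laguerre \<alpha> d) \<le> d"
      unfolding rev_laguerre_def
        by (rule order_trans[OF degree_reflect_poly_le]) (simp add: degree_gen_laguerre)
    then show ?thesis by (subst diff_op_eq) (auto simp: poly_sum)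
  qed
  finally show ?thesis .
qed

section \<open>Entire functions of small growth with only real zeros\<close>

text \<open>The Moebius map \<open>u / (2 A - u)\<close> fixes 0 and sends the half-plane
  \<open>Re u < A\<close> into the unit disc, so the Schwarz lemma applies to its composition with
  \<open>f\<close>. Solving for \<open>f\<close> gives the bound.\<close>

lemma borel_caratheodory:
  assumes f: "f holomorphic_on ball 0 R" "f 0 = 0" and R: "R > 0" and A: "A > 0"
    and Re: "\<And>z. norm z < R \<Longrightarrow> Re (f z) < A" and z: "norm z \<le> r" "r < R"
  shows "norm (f z) \<le> 2 * A * r / (R - r)"
proof -
  define \<phi> where "\<phi> w = f (of_real R * w) / (of_real (2 * A) - f (of_real R * w))" for w
  have dom: "norm (of_real R * w) < R" if "norm w < 1" for w :: complex
    using that R by (simp add: norm_mult)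
  have norm_less: "norm u < norm (of_real (2 * A) - u)" if "Re u < A" for u :: complex
  proof -
    have "(2 * A - Re u)\<^sup>2 - (Re u)\<^sup>2 = 4 * A * (A - Re u)"
      by (simp add: power2_eq_square algebra_simps)
    moreover have "4 * A * (A - Re u) > 0" using that A by simp
    ultimately show ?thesis
      by (simp add: cmod_def)
  qed
  have den: "of_real (2 * A) - f (of_real R * w) \<noteq> 0" if "norm w < 1" for w
    using norm_less[OF Re[OF dom[OF that]]] by (metis norm_zero norm_not_less_zero)
  have "\<phi> holomorphic_on ball 0 1"
  proof -
    have "(f \<circ> (\<lambda>w. of_real R * w)) holomorphic_on ball 0 1"
      by (rule holomorphic_on_compose_gen[OF _ f(1)]) (use dom in \<open>auto intro!: holomorphic_intros\<close>)
    then have "(\<lambda>w. f (of_real R * w)) holomorphic_on ball 0 1" by (simp add: o_def)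
    then show ?thesis unfolding \<phi>_def
      by (intro holomorphic_intros) (use den in auto)
  qed
  moreover have "norm (\<phi> w) < 1" if "norm w < 1" for w
    using norm_less[OF Re[OF dom[OF that]]] den[OF that]
      by (simp add: \<phi>_def norm_divide divide_simps)
  moreover have "norm (z / of_real R) < 1" using z R by (simp add: norm_divide)
  ultimately have le: "norm (\<phi> (z / of_real R)) \<le> norm (z / of_real R)"
    using Schwarz_Lemma(1)[of \<phi> "z / of_real R"] f(2) by (simp add: \<phi>_def)
  let ?n = "norm (f z)"
  have "f z = \<phi> (z / of_real R) * (of_real (2 * A) - f z)"
    using den[of "z / of_real R"] z R by (simp add: \<phi>_def norm_divide)
  then have "?n = norm (\<phi> (z / of_real R)) * norm (of_real (2 * A) - f z)"
    by (metis norm_mult)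
  also have "\<dots> \<le> norm (z / of_real R) * (2 * A + ?n)"
    using le A norm_triangle_ineq4[of "of_real (2 * A)" "f z"] by (intro mult_mono) auto
  also have "\<dots> \<le> r / R * (2 * A + ?n)"
    using z R A by (intro mult_right_mono) (auto simp: norm_divide divide_right_mono)
  finally have "?n * (R - r) \<le> 2 * A * r" using R by (simp add: field_simps)
  then show ?thesis using z by (simp add: pos_le_divide_eq)
qed

text \<open>The polynomial takes the zeros in the disc with multiplicity, and \<open>g\<close> keeps
  the others. It has to be entire, not only holomorphic on the disc, because it is later estimated
  on the circle of radius \<open>2 * R\<close>.\<close>

lemma entire_finite_zeros_factorization:
  assumes F: "F holomorphic_on UNIV" and F0: "F (0::complex) \<noteq> 0"
  obtains q g where "\<And>b. poly q b = 0 \<longleftrightarrow> F b = 0 \<and> norm b < R" "g holomorphic_on UNIV"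
    "\<And>z. norm z < R \<Longrightarrow> g z \<noteq> 0" "\<And>z. F z = poly q z * g z"
proof -
  define Z where "Z = {b. F b = 0 \<and> norm b < R}"
  have finZ: "finite Z"
  proof (cases "F constant_on UNIV")
    case True
    then have "Z = {}" using F0 unfolding Z_def constant_on_def by auto
    then show ?thesis by simp
  next
    case False
    have "finite {z\<in>cball 0 R. F z = 0}"
      by (rule holomorphic_compact_finite_zeros[OF F _ _ _ _ False]) auto
    then show ?thesis by (rule finite_subset[rotated]) (auto simp: Z_def)
  qed
  define m where "m b = nat (zorder F b)" for b
  have zo: "(if F b = 0 then zorder F b > 0 else zorder F b = 0)" for b
    using zorder_exist_zero[OF F open_UNIV connected_UNIV UNIV_I, of b] F0 by (metis UNIV_I)
  define q where "q = (\<Prod>b\<in>Z. [:-b, 1:] ^ m b)"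
  have q: "poly q w = (\<Prod>b\<in>Z. (w - b) ^ m b)" for w
    by (simp add: q_def poly_prod)
  have m: "m b > 0" if "b \<in> Z" for b
    using zo[of b] that by (auto simp: m_def Z_def)
  have zq: "poly q b = 0 \<longleftrightarrow> b \<in> Z" for b
    using finZ m by (auto simp: q)
  have "\<exists>h. h holomorphic_on ball 0 R \<and> (\<forall>z\<in>ball 0 R. h z \<noteq> 0) \<and> (\<forall>z\<in>ball 0 R. F z
    = h z * poly q z)"
  proof (rule holomorphic_zorder_factorization[of F "ball 0 R" "poly q"])
    show "F holomorphic_on ball 0 R" using F holomorphic_on_subset by blast
    show "poly q holomorphic_on ball 0 R" by (intro holomorphic_intros)
    show "poly q z = 0 \<longleftrightarrow> F z = 0" if "z \<in> ball 0 R" for z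
      using that zq by (auto simp: Z_def)
    show "zorder (poly q) z = zorder F z" if z: "z \<in> ball 0 R" for z
    proof (cases "z \<in> Z")
      case True
      show ?thesis
      proof (rule zorder_eqI[of UNIV z "\<lambda>w. \<Prod>b\<in>Z-{z}. (w - b) ^ m b"])
        show "(\<lambda>w. \<Prod>b\<in>Z-{z}. (w - b) ^ m b) holomorphic_on UNIV" by (intro holomorphic_intros)
        show "(\<Prod>b\<in>Z-{z}. (z - b) ^ m b) \<noteq> 0" using finZ by auto
        fix w
        have "poly q w = (w - z) ^ m z * (\<Prod>b\<in>Z-{z}. (w - b) ^ m b)"
          unfolding q using finZ True by (rule prod.remove)
        moreover have "int (m z) = zorder F z" using zo[of z] by (auto simp: m_def split: if_splits)
        ultimately show "poly q w = (\<Prod>b\<in>Z-{z}. (w - b) ^ m b) * (w - z) powi zorder F z"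
          by (metis mult.commute power_int_of_nat)
      qed auto
    next
      case False
      then have "F z \<noteq> 0" using z by (auto simp: Z_def)
      moreover have "poly q analytic_on {z}"
        by (auto simp: analytic_at intro!: exI[of _ UNIV] holomorphic_intros)
      ultimately show ?thesis using zo[of z] zorder_eq_0I[of "poly q" z] False zq by auto
    qed
  qed (auto intro!: exI)
  then obtain h where h: "h holomorphic_on ball 0 R" "\<And>z. z \<in> ball 0 R \<Longrightarrow> h z \<noteq> 0"
    "\<And>z. z \<in> ball 0 R \<Longrightarrow> F z = h z * poly q z" by blast
  \<comment> \<open>The disc and the complement of the finitely many removed zeros are open and
    cover the plane, and the two formulas agree on the overlap.\<close>
  define g where "g z = (if z \<in> ball 0 R then h z else F z / poly q z)" for z
  have "g holomorphic_on (ball 0 R \<union> - Z)"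
    unfolding g_def
  proof (rule holomorphic_on_If_Un)
    show "open (- Z)" using finZ by (simp add: finite_imp_closed open_Compl)
    show "(\<lambda>z. F z / poly q z) holomorphic_on - Z"
      using F zq by (intro holomorphic_intros) (auto intro: holomorphic_on_subset)
  qed (use h zq in auto)
  moreover have "ball 0 R \<union> - Z = UNIV" by (auto simp: Z_def)
  ultimately have "g holomorphic_on UNIV" by simp
  moreover have "F z = poly q z * g z" for z
    using h(3)[of z] zq[of z] by (auto simp: g_def Z_def)
  moreover have "g z \<noteq> 0" if "norm z < R" for z
    using h(2)[of z] that by (simp add: g_def)
  moreover have "poly q b = 0 \<longleftrightarrow> F b = 0 \<and> norm b < R" for b
    unfolding zq by (simp add: Z_def)
  ultimately show ?thesis by (intro that[of q g])
qed

text \<open>Factor by factor: a root with \<open>norm a < R\<close> satisfies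
  \<open>norm (z - a) > R > norm a\<close> on the circle of radius \<open>2 * R\<close>. Dividing by
  \<open>q\<close> there is thus no worse than dividing by \<open>poly q 0\<close>.\<close>

lemma norm_poly_ge_norm_poly_0:
  fixes q :: "complex poly"
  assumes "\<And>b. poly q b = 0 \<Longrightarrow> norm b < R" and "norm z = 2 * R"
  shows "norm (poly q 0) \<le> norm (poly q z)"
proof (cases "q = 0")
  case False
  obtain A where A: "q = smult (lead_coeff q) (\<Prod>a\<in>#A. [:-a, 1:])"
    using alg_closed_imp_factorization[OF False] by metis
  have rt: "norm b < R" if "b \<in># A" for b
  proof (rule assms(1))
    have "poly (\<Prod>a\<in>#A. [:-a, 1:]) b = 0"
      using that by (simp add: poly_prod_mset prod_mset_zero_iff image_iff) 
    then show "poly q b = 0" by (subst A) simp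
  qed
  have "norm (poly (\<Prod>a\<in>#A. [:-a, 1:]) 0) \<le> norm (poly (\<Prod>a\<in>#A. [:-a, 1:]) z)"
    using rt
  proof (induction A)
    case (add a A)
    have "norm a \<le> norm (z - a)"
      using add.prems[of a] assms(2) norm_triangle_ineq2[of z a] by simp
    then have "norm a * norm (poly (\<Prod>a\<in>#A. [:-a, 1:]) 0)
      \<le> norm (z - a) * norm (poly (\<Prod>a\<in>#A. [:-a, 1:]) z)"
      using add by (intro mult_mono) auto
    then show ?case by (simp add: norm_mult[symmetric] algebra_simps)
  qed simp
  then have "norm (poly (smult (lead_coeff q) (\<Prod>a\<in>#A. [:-a, 1:])) 0)
    \<le> norm (poly (smult (lead_coeff q) (\<Prod>a\<in>#A. [:-a, 1:])) z)"
    by (simp add: norm_mult mult_left_mono)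
  then show ?thesis using A by metis
qed simp

text \<open>The genus-zero case of Hadamard's theorem, without infinite products: dividing out the zeros in
  a large disc leaves a zero-free quotient, whose logarithm is small on a fixed disc.\<close>

lemma entire_real_zeros_approx:
  assumes F: "F holomorphic_on UNIV" and F0: "F 0 \<noteq> 0"
    and real: "\<And>z. F z = 0 \<Longrightarrow> z \<in> \<real>"
    and growth: "\<And>\<epsilon>. \<epsilon> > 0 \<Longrightarrow> \<exists>C. \<forall>z. norm (F z) \<le> C * exp (\<epsilon> * norm z)"
    and r: "r > 0" and \<delta>: "\<delta> > 0"
  shows "\<exists>p. only_real_zeros p \<and> (\<forall>z. norm z \<le> r \<longrightarrow> norm (poly p z - F z) \<le> \<delta>)"
proof -
  have "bounded (F ` cball 0 r)"
    using F by (intro compact_imp_bounded compact_continuous_image holomorphic_on_imp_continuous_on)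
      (auto intro: holomorphic_on_subset)
  then obtain M where M: "M > 0" "\<And>z. norm z \<le> r \<Longrightarrow> norm (F z) \<le> M"
    by (auto simp: bounded_pos)
  define \<eta> where "\<eta> = min (1/2) (\<delta> / (2 * M))"
  have \<eta>: "\<eta> > 0" "\<eta> \<le> 1/2" "M * (3/2 * \<eta>) \<le> \<delta>"
  proof -
    show "\<eta> > 0" "\<eta> \<le> 1/2" using \<delta> M by (auto simp: \<eta>_def)
    have "\<eta> \<le> \<delta> / (2 * M)" by (simp add: \<eta>_def)
    then have "M * \<eta> \<le> \<delta> / 2" using M by (simp add: field_simps)
    then show "M * (3/2 * \<eta>) \<le> \<delta>" using \<delta> by simp
  qed
  \<comment> \<open>The constants are chosen backwards from the estimate
    \<open>2 A r / (R - r) \<le> 4 A r / R = 8 r \<epsilon> + 4 r K / R\<close>: \<epsilon> makes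
    the first summand \<open>\<eta> / 2\<close>, and \<open>R\<close> makes the second at most
    \<open>\<eta> / 2\<close>.\<close>
  define \<epsilon> where "\<epsilon> = \<eta> / (16 * r)"
  have \<epsilon>: "\<epsilon> > 0" using \<eta> r by (simp add: \<epsilon>_def)
  obtain C where C: "\<And>z. norm (F z) \<le> C * exp (\<epsilon> * norm z)" using growth[OF \<epsilon>] by blast
  have "norm (F 0) \<le> C" using C[of 0] by simp
  then have Cpos: "C > 0" using F0 by (metis less_le_trans zero_less_norm_iff)
  define K where "K = \<bar>ln (C / norm (F 0))\<bar> + 1"
  define R where "R = max (2 * r) (8 * r * K / \<eta>)"
  have R: "R > 0" "R \<ge> 2 * r" "r < R" using r by (auto simp: R_def)
  define A where "A = 2 * \<epsilon> * R + K"
  have A: "A > 0" using \<epsilon> R by (simp add: A_def K_def add_pos_pos add_nonneg_pos)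
  obtain q g where q: "\<And>b. poly q b = 0 \<longleftrightarrow> F b = 0 \<and> norm b < R" and g: "g holomorphic_on UNIV"
    "\<And>z. norm z < R \<Longrightarrow> g z \<noteq> 0" "\<And>z. F z = poly q z * g z"
    using entire_finite_zeros_factorization[OF F F0, of R] by metis
  have q0: "poly q 0 \<noteq> 0" and g0: "g 0 \<noteq> 0" using g(3)[of 0] F0 by auto
  define p where "p = smult (g 0) q"
  have p: "only_real_zeros p" using q real g0 by (auto simp: only_real_zeros_def p_def)
  \<comment> \<open>The maximum modulus principle moves the estimate to the circle of radius
    \<open>2 * R\<close>, where the polynomial factor is at least as large as at 0.\<close>
  have bound: "norm (g z / g 0) \<le> C * exp (2 * \<epsilon> * R) / norm (F 0)" if "norm z \<le> 2 * R" for z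
  proof (rule maximum_modulus_frontier[of "\<lambda>z. g z / g 0" "cball 0 (2 * R)"])
    show "(\<lambda>z. g z / g 0) holomorphic_on interior (cball 0 (2 * R))"
      using g(1) g0 by (intro holomorphic_intros) (auto intro: holomorphic_on_subset)
    have "(\<lambda>z. g z / g 0) holomorphic_on closure (cball 0 (2 * R))"
      using g(1) g0 by (intro holomorphic_intros) (auto intro: holomorphic_on_subset)
    then show "continuous_on (closure (cball 0 (2 * R))) (\<lambda>z. g z / g 0)"
      by (rule holomorphic_on_imp_continuous_on)
    fix w :: complex assume "w \<in> frontier (cball 0 (2 * R))"
    then have w: "norm w = 2 * R" using R by simp
    have le: "norm (poly q 0) \<le> norm (poly q w)"
      by (rule norm_poly_ge_norm_poly_0[OF _ w]) (use q in auto)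
    have "norm (F 0) * norm (g w) = norm (poly q 0) * norm (g 0) * norm (g w)"
      unfolding g(3)[of 0] norm_mult ..
    also have "\<dots> \<le> norm (poly q w) * norm (g 0) * norm (g w)"
      using le by (intro mult_right_mono) auto
    also have "\<dots> = norm (F w) * norm (g 0)" unfolding g(3)[of w] norm_mult by simp
    also have "\<dots> \<le> C * exp (2 * \<epsilon> * R) * norm (g 0)"
      using C[of w] by (intro mult_right_mono) (auto simp: w mult_ac)
    finally show "norm (g w / g 0) \<le> C * exp (2 * \<epsilon> * R) / norm (F 0)"
      using F0 g0 by (simp add: norm_divide field_simps)
  qed (use that in auto)
  have "C * exp (2 * \<epsilon> * R) / norm (F 0) = exp (ln (C / norm (F 0)) + 2 * \<epsilon> * R)"
    using Cpos F0 by (simp add: exp_add)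
  also have "\<dots> < exp A" by (simp add: A_def K_def)
  finally have ltA: "C * exp (2 * \<epsilon> * R) / norm (F 0) < exp A" .
  have "(\<lambda>z. g z / g 0) holomorphic_on ball 0 R"
    using g(1) g0 by (intro holomorphic_intros) (auto intro: holomorphic_on_subset)
  then obtain h0 where h0: "h0 holomorphic_on ball 0 R" "\<And>z. z \<in> ball 0 R \<Longrightarrow> g z / g 0 = exp (h0 z)"
    by (rule contractible_imp_holomorphic_log[of _ "ball 0 R"])
      (use g(2) g0 in \<open>auto intro: convex_imp_contractible\<close>)
  \<comment> \<open>The shift gives \<open>h 0 = 0\<close>, as the Borel-Caratheodory bound
    requires; since \<open>exp (h0 0) = 1\<close>, it leaves the exponential unchanged.\<close>
  define h where "h z = h0 z - h0 0" for z
  have "exp (h0 0) = 1" using h0(2)[of 0] g0 R by simp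
  then have h: "g z / g 0 = exp (h z)" if "norm z < R" for z
    using h0(2)[of z] that by (simp add: h_def exp_diff)
  have hb: "norm (h z) \<le> \<eta>" if z: "norm z \<le> r" for z
  proof -
    have "norm (h z) \<le> 2 * A * r / (R - r)"
    proof (rule borel_caratheodory[OF _ _ R(1) A _ z R(3)])
      show "h holomorphic_on ball 0 R" unfolding h_def by (intro holomorphic_intros h0)
      show "Re (h w) < A" if "norm w < R" for w
      proof -
        have "exp (Re (h w)) = norm (g w / g 0)" using h[OF that] by (simp add: norm_exp_eq_Re)
        also have "\<dots> < exp A" using bound[of w] ltA that R(1) by linarith
        finally show ?thesis by simp
      qed
    qed (simp add: h_def)
    also have "\<dots> \<le> 2 * A * r / (R / 2)"
      using A r R by (intro divide_left_mono) auto
    also have "\<dots> = 8 * r * \<epsilon> + 4 * r * K / R" using R(1) by (simp add: A_def field_simps)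
    also have "8 * r * \<epsilon> = \<eta> / 2" using r by (simp add: \<epsilon>_def)
    also have "4 * r * K / R \<le> \<eta> / 2"
    proof -
      have "8 * r * K / \<eta> \<le> R" by (simp add: R_def)
      then have "8 * r * K \<le> R * \<eta>" using \<eta>(1) by (simp add: field_simps)
      then show ?thesis using R(1) by (simp add: field_simps)
    qed
    finally show ?thesis by simp
  qed
  have "norm (poly p z - F z) \<le> \<delta>" if z: "norm z \<le> r" for z
  proof -
    have "g z = g 0 * exp (h z)" using h[of z] z R g0 by (simp add: field_simps)
    then have "poly p z = F z * exp (- h z)"
      unfolding g(3)[of z] by (simp add: p_def exp_minus)
    then have "poly p z - F z = F z * (exp (- h z) - 1)" by (simp add: algebra_simps)
    then have "norm (poly p z - F z) = norm (F z) * norm (exp (- h z) - 1)" by (simp add: norm_mult)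
    also have "\<dots> \<le> M * (3/2 * \<eta>)"
    proof (intro mult_mono M(2) z)
      have "norm (exp (- h z) - 1) \<le> 3/2 * norm (- h z)"
        by (rule norm_exp_bounds) (use hb[OF z] \<eta> in auto)
      then show "norm (exp (- h z) - 1) \<le> 3/2 * \<eta>" using hb[OF z] by simp
    qed (use M in auto)
    finally show ?thesis using \<eta>(3) by linarith
  qed
  then show ?thesis using p by blast
qed

section \<open>Differential operators of infinite order\<close>

lemma higher_deriv_poly: "(deriv ^^ m) (poly p) = poly ((pderiv ^^ m) p)"
  for p :: "complex poly"
proof (induction m arbitrary: p)
  case (Suc m)
  have "deriv (poly p) = poly (pderiv p)" by (rule ext) (rule DERIV_imp_deriv[OF poly_DERIV])
  then show ?case using Suc[of "pderiv p"] by (simp add: funpow_Suc_right del: funpow.simps)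
qed simp

lemma coeff_higher_pderiv_eq_deriv:
  "coeff ((pderiv ^^ n) p) j = (deriv ^^ (n + j)) (poly p) 0 / fact j" for p :: "complex poly"
proof -
  have "coeff ((pderiv ^^ j) ((pderiv ^^ n) p)) 0 = (deriv ^^ (n + j)) (poly p) 0"
    unfolding higher_deriv_poly by (simp add: poly_0_coeff_0 funpow_add add.commute[of n j])
  moreover have "coeff ((pderiv ^^ j) ((pderiv ^^ n) p)) 0 = fact j * coeff ((pderiv ^^ n) p) j"
    by (subst coeff_higher_pderiv) (simp add: pochhammer_fact)
  ultimately show ?thesis by (simp add: field_simps)
qed

text \<open>Only finitely many Taylor coefficients act on \<open>P\<close>, and these are limits of
  coefficients of real-rooted polynomials that converge uniformly on the unit disc. The
  \<open>n\<close>-th derivative is taken of the approximants, where it preserves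
  real-rootedness.\<close>

lemma only_real_zeros_diff_op_entire:
  assumes F: "F holomorphic_on UNIV" and F0: "F 0 \<noteq> 0"
    and real: "\<And>z. F z = 0 \<Longrightarrow> z \<in> \<real>"
    and growth: "\<And>\<epsilon>. \<epsilon> > 0 \<Longrightarrow> \<exists>C. \<forall>z. norm (F z) \<le> C * exp (\<epsilon> * norm z)"
    and P: "only_real_zeros P"
    and nz: "diff_op (\<lambda>j. (deriv ^^ (n + j)) F 0 / fact j) P \<noteq> 0" (is "?D \<noteq> 0")
  shows "only_real_zeros (diff_op (\<lambda>j. (deriv ^^ (n + j)) F 0 / fact j) P)"
proof -
  have "\<exists>p. only_real_zeros p \<and> (\<forall>z. norm z \<le> 1 \<longrightarrow> norm (poly p z - F z) \<le> inverse (real (Suc k)))"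
    for k
    by (rule entire_real_zeros_approx[OF F F0 real growth]) auto
  then obtain p where p: "\<And>k. only_real_zeros (p k)"
    "\<And>k z. norm z \<le> 1 \<Longrightarrow> norm (poly (p k) z - F z) \<le> inverse (real (Suc k))" by metis
  have lim: "uniform_limit (ball 0 1) (\<lambda>k. poly (p k)) F sequentially"
    unfolding uniform_limit_iff
  proof (intro allI impI)
    fix e :: real assume "e > 0"
    then have "\<forall>\<^sub>F k in sequentially. inverse (real (Suc k)) < e"
      using LIMSEQ_inverse_real_of_nat order_tendstoD(2) by blast
    then show "\<forall>\<^sub>F k in sequentially. \<forall>x\<in>ball 0 1. dist (poly (p k) x) (F x) < e"
    proof eventually_elim
      case (elim k)
      show ?case
      proof
        fix x :: complex assume "x \<in> ball 0 1"
        then have "norm (poly (p k) x - F x) \<le> inverse (real (Suc k))" by (intro p(2)) simp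
        then show "dist (poly (p k) x) (F x) < e" using elim by (simp add: dist_norm)
      qed
    qed
  qed
  have c: "(\<lambda>k. coeff ((pderiv ^^ n) (p k)) j) \<longlonglongrightarrow> (deriv ^^ (n + j)) F 0 / fact j" for j
    unfolding coeff_higher_pderiv_eq_deriv
    by (intro tendsto_divide tendsto_const higher_deriv_complex_uniform_limit[OF lim])
      (auto intro!: always_eventually holomorphic_intros)
  define D where "D k = diff_op (coeff ((pderiv ^^ n) (p k))) P" for k
  have Dlim: "(\<lambda>k. coeff (D k) i) \<longlonglongrightarrow> coeff ?D i" for i
    unfolding D_def diff_op_def coeff_sum coeff_smult by (intro tendsto_intros c)
  \<comment> \<open>A nonzero coefficient of the limit stays nonzero along a tail. So
    \<open>D k\<close> is nonzero there, as the polynomial version of the statement requires; hence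
    the shift by \<open>N\<close> below.\<close>
  obtain i where "coeff ?D i \<noteq> 0" using nz by (auto simp: poly_eq_iff)
  then have "\<forall>\<^sub>F k in sequentially. coeff (D k) i \<noteq> 0"
    using Dlim[of i] tendsto_imp_eventually_ne by blast
  then obtain N where N: "\<And>k. k \<ge> N \<Longrightarrow> D k \<noteq> 0" 
    unfolding eventually_sequentially by (metis coeff_0)
  have Dreal: "only_real_zeros (D k)" if "k \<ge> N" for k
  proof -
    have "(pderiv ^^ n) (p k) \<noteq> 0"
      using N[OF that] by (auto simp: D_def diff_op_def)
    then show ?thesis unfolding D_def
      using N[OF that] p(1) by (intro only_real_zeros_diff_op P only_real_zeros_higher_pderiv)
        (auto simp: D_def)
  qed
  have deg: "degree (diff_op c' P) \<le> degree P" for c'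
    unfolding diff_op_def
    by (intro degree_sum_le order_trans[OF degree_smult_le])
      (auto simp: degree_le coeff_higher_pderiv coeff_eq_0 intro!: degree_le)
  show ?thesis
  proof (rule only_real_zeros_limit[of "\<lambda>k. D (k + N)" "degree P"])
    show "(\<lambda>k. coeff (D (k + N)) i) \<longlonglongrightarrow> coeff ?D i" for i
      using LIMSEQ_ignore_initial_segment[OF Dlim] .
  qed (use Dreal nz deg in \<open>auto simp: D_def\<close>)
qed

section \<open>Jacobi's theta function\<close>

text \<open>The real part of the characteristic function of the standard normal distribution
  supplies the Fourier transform of the Gaussian.\<close>

lemma LBINT_std_normal_cos: "(LBINT x. std_normal_density x * cos (s * x)) = exp (- s\<^sup>2 / 2)"
proof -
  interpret prob_space std_normal_distribution by (rule prob_space_normal_density) simp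
  have int: "integrable std_normal_distribution (\<lambda>x. iexp (s * x))"
    using integrable_iexp[of "\<lambda>x. complex_of_real (s * x)"] by simp
  have "(LINT x|std_normal_distribution. Re (iexp (s * x))) = Re (char std_normal_distribution s)"
    unfolding char_def by (rule integral_Re[OF int])
  also have "\<dots> = exp (- s\<^sup>2 / 2)" by (simp add: char_std_normal_distribution)
  finally show ?thesis
    by (subst (asm) integral_density) (auto simp: normal_density_nonneg Re_exp)
qed

lemma integrable_std_normal_cos: "integrable lborel (\<lambda>x. std_normal_density x * cos (s * x))"
proof (rule Bochner_Integration.integrable_bound)
  show "integrable lborel std_normal_density" by (rule integrable_normal_density) simp
  show "AE x in lborel. norm (std_normal_density x * cos (s * x)) \<le> norm (std_normal_density x)"
    by (intro AE_I2) (simp add: abs_mult mult_left_le)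
qed simp

lemma gaussian_cos_integral:
  assumes t: "t > 0"
  shows "has_bochner_integral lborel (\<lambda>x. exp (- pi * t * x\<^sup>2) * cos (2 * pi * k * x))
    (exp (- pi * k\<^sup>2 / t) / sqrt t)"
proof -
  \<comment> \<open>The scaling that turns \<open>exp (- x^2 / 2)\<close> into
    \<open>exp (- pi t x^2)\<close>.\<close>
  define a where "a = sqrt (2 * pi * t)"
  define s where "s = 2 * pi * k / a"
  have a: "a > 0" "a\<^sup>2 = 2 * pi * t" using t by (simp_all add: a_def)
  have "has_bochner_integral lborel (\<lambda>x. std_normal_density x * cos (s * x)) (exp (- s\<^sup>2 / 2))"
    using integrable_std_normal_cos LBINT_std_normal_cos by (simp add: has_bochner_integral_iff)
  then have "has_bochner_integral lborel (\<lambda>x. std_normal_density (0 + a * x) * cos (s * (0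
    + a * x))) (exp (- s\<^sup>2 / 2) /\<^sub>R \<bar>a\<bar>)"
    using lborel_has_bochner_integral_real_affine_iff[of a "\<lambda>x. std_normal_density x
      * cos (s * x)" _ 0] a by simp
  then have "has_bochner_integral lborel (\<lambda>x. sqrt (2 * pi) * (std_normal_density (0
    + a * x) * cos (s * (0 + a * x)))) (sqrt (2 * pi) * (exp (- s\<^sup>2 / 2) /\<^sub>R \<bar>a\<bar>))"
    by (intro has_bochner_integral_mult_right)
  moreover have "sqrt (2 * pi) * (std_normal_density (0 + a * x) * cos (s * (0 + a * x)))
    = exp (- pi * t * x\<^sup>2) * cos (2 * pi * k * x)" for x
    using a(1) by (simp add: std_normal_density_def power_mult_distrib a(2) s_def algebra_simps)
  moreover have ss: "s\<^sup>2 / 2 = pi * k\<^sup>2 / t"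
  proof -
    have "s\<^sup>2 = (2 * pi * k)\<^sup>2 / (2 * pi * t)" unfolding s_def power_divide a(2) ..
    then show ?thesis using t by (simp add: power2_eq_square field_simps)
  qed
  moreover have "sqrt (2 * pi) * (exp (- s\<^sup>2 / 2) /\<^sub>R \<bar>a\<bar>) = exp (- pi * k\<^sup>2 / t) / sqrt t"
  proof -
    have q: "sqrt (2 * pi) / \<bar>a\<bar> = 1 / sqrt t" using t by (simp add: a_def real_sqrt_mult)
    have g: "sqrt (2 * pi) * (E /\<^sub>R \<bar>a\<bar>) = E * (sqrt (2 * pi) / \<bar>a\<bar>)" for E
      by (simp add: divide_inverse)
    have e: "- s\<^sup>2 / 2 = - pi * k\<^sup>2 / t" using ss by simp
    show ?thesis unfolding g q e by simp
  qed
  ultimately show ?thesis by (simp only:)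
qed

text \<open>Vanishing cosine coefficients make \<open>h\<close> orthogonal to all polynomials in
  \<open>cos (2 pi x)\<close>, and evenness makes \<open>h\<close> a continuous function of that
  cosine. By Weierstrass approximation \<open>h\<close> is then orthogonal to itself.\<close>

lemma even_eq_0_if_cos_coeffs_0:
  fixes h :: "real \<Rightarrow> real"
  assumes cont: "continuous_on {-1/2..1/2} h" and even: "\<And>x. h (- x) = h x"
    and coef: "\<And>k::nat. integral {-1/2..1/2} (\<lambda>x. h x * cos (2 * pi * real k * x)) = 0"
    and x: "x \<in> {-1/2..1/2}"
  shows "h x = 0"
proof -
  let ?I = "{-1/2..1/2::real}"
  define c where "c x = cos (2 * pi * x)" for x :: real
  have cont': "continuous_on {-(1/2)..1/2} h" using cont by simp
  have cont_c: "continuous_on A c" for A unfolding c_def by (intro continuous_intros)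
  have pow: "integral ?I (\<lambda>x. h x * c x ^ i * cos (2 * pi * real k * x)) = 0" for i k
  proof (induction i arbitrary: k)
    case 0
    then show ?case using coef by simp
  next
    case (Suc i)
    \<comment> \<open>The product formula yields the frequencies \<open>k + 1\<close> and
      \<open>k - 1\<close>; for \<open>k = 0\<close> the latter is -1, replaced by 1 since the
      cosine is even.\<close>
    define k' where "k' = (if k = 0 then 1 else k - 1)"
    have prod: "c x * cos (2 * pi * real k * x)
      = (cos (2 * pi * real (Suc k) * x) + cos (2 * pi * real k' * x)) / 2" for x
    proof -
      have "cos (2 * pi * real k' * x) = cos (2 * pi * real k * x - 2 * pi * x)"
        by (cases "k = 0") (auto simp: k'_def of_nat_diff algebra_simps)
      moreover have "cos (2 * pi * real (Suc k) * x) = cos (2 * pi * real k * x + 2 * pi * x)"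
        by (simp add: algebra_simps)
      ultimately show ?thesis by (simp add: c_def cos_add cos_diff)
    qed
    have "integral ?I (\<lambda>x. h x * c x ^ Suc i * cos (2 * pi * real k * x)) =
      integral ?I (\<lambda>x. (1/2) * (h x * c x ^ i * cos (2 * pi * real (Suc k) * x))
        + (1/2) * (h x * c x ^ i * cos (2 * pi * real k' * x)))"
    proof (rule integral_cong)
      fix x
      have "h x * c x ^ Suc i * cos (2 * pi * real k * x)
        = h x * c x ^ i * (c x * cos (2 * pi * real k * x))" by simp
      then show "h x * c x ^ Suc i * cos (2 * pi * real k * x)
        = (1/2) * (h x * c x ^ i * cos (2 * pi * real (Suc k) * x))
        + (1/2) * (h x * c x ^ i * cos (2 * pi * real k' * x))"
        unfolding prod by (simp add: field_simps)
    qed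
    also have "\<dots> = (1/2) * integral ?I (\<lambda>x. h x * c x ^ i * cos (2 * pi * real (Suc k) * x))
      + (1/2) * integral ?I (\<lambda>x. h x * c x ^ i * cos (2 * pi * real k' * x))"
      by (subst integral_add) (auto intro!: integrable_continuous_interval continuous_intros
        cont cont' cont_c)
    also have "\<dots> = 0" unfolding Suc.IH by simp
    finally show ?case .
  qed
  have poly: "integral ?I (\<lambda>x. h x * p (c x)) = 0" if rp: "real_polynomial_function p" for p
  proof -
    obtain a n where p: "p = (\<lambda>x. \<Sum>i\<le>n. a i * x ^ i)" using rp
      unfolding real_polynomial_function_iff_sum by blast
    have "integral ?I (\<lambda>x. h x * p (c x)) = integral ?I (\<lambda>x. \<Sum>i\<le>n. a i * (h x * c x ^ i))"
      unfolding p by (intro integral_cong) (simp add: sum_distrib_left mult_ac)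
    also have "\<dots> = (\<Sum>i\<le>n. a i * integral ?I (\<lambda>x. h x * c x ^ i))"
      by (subst integral_sum) (auto intro!: integrable_continuous_interval continuous_intros
        cont cont' cont_c)
    also have "\<dots> = 0" using pow[of _ 0] by simp
    finally show ?thesis .
  qed
  \<comment> \<open>On the period interval \<open>arccos\<close> inverts \<open>c\<close> up to
    sign, and evenness of \<open>h\<close> removes the sign.\<close>
  define H where "H y = h (arccos y / (2 * pi))" for y
  have Hc: "H (c x) = h x" if "x \<in> ?I" for x
  proof -
    have "pi * (-1) \<le> pi * (2 * x)" "pi * (2 * x) \<le> pi * 1"
      using that by (intro mult_left_mono; simp)+
    then have "arccos (cos (2 * pi * x)) = \<bar>2 * pi * x\<bar>"
      by (cases "x \<ge> 0") (auto simp: arccos_cos arccos_cos2 abs_mult mult_le_0_iff)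
    then have "H (c x) = h \<bar>x\<bar>" by (simp add: H_def c_def abs_mult)
    then show ?thesis using even[of x] by (auto simp: abs_if)
  qed
  have contH: "continuous_on {-1..1} H"
    unfolding H_def
  proof (rule continuous_on_compose2[OF cont])
    show "continuous_on {-1..1} (\<lambda>y. arccos y / (2 * pi))"
      by (intro continuous_intros continuous_on_arccos') auto
    show "(\<lambda>y. arccos y / (2 * pi)) ` {-1..1} \<subseteq> ?I"
    proof safe
      fix y :: real assume "y \<in> {-1..1}"
      then have "0 \<le> arccos y" "arccos y \<le> pi" by (auto intro: arccos_lbound arccos_ubound)
      then show "arccos y / (2 * pi) \<in> ?I" by (auto simp: field_simps intro: order_trans[of _ 0])
    qed
  qed
  have cI: "c x \<in> {-1..1}" for x by (simp add: c_def)
  let ?S = "integral ?I (\<lambda>x. h x * h x)" and ?B = "integral ?I (\<lambda>x. \<bar>h x\<bar>)"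
  have "?S \<le> e * ?B" if e: "e > 0" for e
  proof -
    obtain p where p: "real_polynomial_function p" "\<And>y. y \<in> {-1..1} \<Longrightarrow> \<bar>H y - p y\<bar> < e"
      using Stone_Weierstrass_real_polynomial_function[OF compact_Icc contH e] by blast
    have contp: "continuous_on A p" for A
      using p(1) by (simp add: continuous_on_polymonial_function real_polynomial_function_eq)
    have contpc: "continuous_on A (\<lambda>x. p (c x))" for A
      by (rule continuous_on_compose2[OF contp[of UNIV] cont_c]) auto
    have "?S = ?S - integral ?I (\<lambda>x. h x * p (c x))" using poly[OF p(1)] by simp
    also have "\<dots> = integral ?I (\<lambda>x. h x * h x - h x * p (c x))"
      by (rule integral_diff[symmetric])
        (auto intro!: integrable_continuous_interval continuous_intros cont cont' contpc)
    also have "\<dots> \<le> integral ?I (\<lambda>x. e * \<bar>h x\<bar>)"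
    proof (rule integral_le)
      fix x assume x: "x \<in> ?I"
      have "h x * h x - h x * p (c x) = h x * (H (c x) - p (c x))" using Hc[OF x]
        by (simp add: algebra_simps)
      also have "\<dots> \<le> \<bar>h x\<bar> * \<bar>H (c x) - p (c x)\<bar>" by (simp add: abs_mult[symmetric])
      also have "\<dots> \<le> \<bar>h x\<bar> * e" using p(2)[OF cI[of x]] by (intro mult_left_mono) auto
      finally show "h x * h x - h x * p (c x) \<le> e * \<bar>h x\<bar>" by (simp add: mult.commute)
    qed (auto intro!: integrable_continuous_interval continuous_intros cont cont' contpc)
    finally show ?thesis by simp
  qed
  then have "?S \<le> 0" 
  proof -
    have B: "?B \<ge> 0" by (rule integral_nonneg)
      (auto intro!: integrable_continuous_interval continuous_intros cont cont')
    show ?thesis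
    proof (rule field_le_epsilon)
      fix e :: real assume "e > 0"
      have "?S \<le> (e / (?B + 1)) * ?B" by (rule \<open>\<And>e. e > 0 \<Longrightarrow> ?S \<le> e * ?B\<close>) (use B \<open>e > 0\<close> in simp)
      also have "\<dots> \<le> e" using B \<open>e > 0\<close> by (simp add: field_simps)
      finally show "?S \<le> 0 + e" by simp
    qed
  qed
  moreover have "?S \<ge> 0" by (rule integral_nonneg)
    (auto intro!: integrable_continuous_interval continuous_intros cont cont')
  ultimately have "?S = 0" by simp
  moreover have "(\<lambda>x. h x * h x) integrable_on ?I"
    by (auto intro!: integrable_continuous_interval continuous_intros cont cont')
  ultimately have "((\<lambda>x. h x * h x) has_integral 0) ?I" by (metis integrable_integral)
  then have "h x * h x = 0"
    using has_integral_0_cbox_imp_0[of "-1/2" "1/2" "\<lambda>x. h x * h x" x] x cont cont'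
    by (auto intro!: continuous_intros)
  then show ?thesis by simp
qed

lemma cos_orthogonal:
  fixes n k :: nat
  shows "((\<lambda>x. cos (2 * pi * real n * x) * cos (2 * pi * real k * x)) has_integral
     (if n = k then if k = 0 then 1 else 1/2 else 0)) {-1/2..1/2}"
proof -
  have J: "((\<lambda>x. cos (2 * pi * of_int m * x)) has_integral (if m = 0 then 1 else 0)) {-1/2..1/2}"
    for m :: int
  proof (cases "m = 0")
    case True
    then show ?thesis using has_integral_const_real[of "1::real" "-1/2" "1/2"] by simp
  next
    case False
    have "((\<lambda>x. cos (2 * pi * of_int m * x)) has_integral
        (sin (2 * pi * of_int m * (1/2)) / (2 * pi * of_int m)
          - sin (2 * pi * of_int m * (-1/2)) / (2 * pi * of_int m))) {-1/2..1/2}"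
      by (rule fundamental_theorem_of_calculus)
        (use False in \<open>auto intro!: derivative_eq_intros
          simp: has_real_derivative_iff_has_vector_derivative[symmetric]\<close>)
    moreover have "sin (2 * pi * of_int m * (1/2)) = 0"
      using sin_integer_2pi[of "of_int m"] by simp
    ultimately show ?thesis using False by simp
  qed
  have "((\<lambda>x. (1/2) * cos (2 * pi * of_int (int n + int k) * x)
    + (1/2) * cos (2 * pi * of_int (int n - int k) * x)) has_integral
     ((1/2) * (if int n + int k = 0 then 1 else 0) + (1/2) * (if int n - int k
       = 0 then 1 else 0))) {-1/2..1/2}"
    by (intro has_integral_add has_integral_mult_right J)
  moreover have "(1/2) * cos (2 * pi * of_int (int n + int k) * x)
    + (1/2) * cos (2 * pi * of_int (int n - int k) * x)
    = cos (2 * pi * real n * x) * cos (2 * pi * real k * x)" for x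
  proof -
    have "2 * pi * of_int (int n + int k) * x = 2 * pi * real n * x + 2 * pi * real k * x"
      "2 * pi * of_int (int n - int k) * x = 2 * pi * real n * x - 2 * pi * real k * x"
      by (simp_all add: algebra_simps)
    then show ?thesis by (simp only: cos_add cos_diff) (simp add: field_simps)
  qed
  ultimately show ?thesis by (auto split: if_splits)
qed

text \<open>The sum of \<open>exp (- pi n^2 t)\<close> over all integers \<open>n\<close>, with
  \<open>n\<close> and \<open>- n\<close> paired.\<close>

definition jacobi_theta :: "real \<Rightarrow> real" where
  "jacobi_theta t = 1 + 2 * (\<Sum>n. exp (- pi * (real (Suc n))\<^sup>2 * t))"

lemma summable_exp_neg: "a > 0 \<Longrightarrow> summable (\<lambda>n. exp (- a * real n))"
proof -
  assume "a > 0"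
  then have "summable (\<lambda>n. exp (- a) ^ n)" by (intro summable_geometric) simp
  then show ?thesis by (simp add: exp_of_nat_mult[symmetric] mult.commute)
qed

text \<open>Both sides are the values at 0 of even continuous functions of period 1 with the same Fourier
  coefficients: the periodised Gaussian and its Fourier series.\<close>

theorem jacobi_theta_inversion:
  assumes t: "t > 0"
  shows "jacobi_theta t = jacobi_theta (1 / t) / sqrt t"
proof -
  let ?I = "{-1/2..1/2::real}"
  define f where "f x = exp (- pi * t * x\<^sup>2)" for x
  \<comment> \<open>\<open>G n\<close> pairs the translates by \<open>n + 1\<close> and
    \<open>- (n + 1)\<close>; \<open>T n\<close> is the Fourier term of frequency
    \<open>n + 1\<close>, with its coefficient from \<open>gaussian_cos_integral\<close>. So
    \<open>h\<close> is the periodised Gaussian minus its Fourier series.\<close>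
  define G where "G n x = f (x + real (Suc n)) + f (x - real (Suc n))" for n x
  define T where "T n x = (2 * exp (- pi * (real (Suc n))\<^sup>2 / t) / sqrt t)
    * cos (2 * pi * real (Suc n) * x)" for n x
  define h where "h x = f x - 1 / sqrt t + (\<Sum>n. G n x - T n x)" for x
  define hN where "hN N x = f x - 1 / sqrt t + (\<Sum>n<N. G n x - T n x)" for N x
  have f_even: "f (- x) = f x" for x by (simp add: f_def)
  have cont_f: "continuous_on A (\<lambda>x. f (x + b))" for A b unfolding f_def
    by (intro continuous_intros)
  \<comment> \<open>On the period interval both translated arguments have absolute value at least
    \<open>n + 1/2\<close>, and \<open>(n + 1/2)^2 \<ge> n\<close> trades the Gaussian for a
    geometric series.\<close>
  have G_bound: "\<bar>G n x\<bar> \<le> 2 * exp (- (pi * t) * real n)" if "x \<in> ?I" for n x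
  proof -
    have *: "f y \<le> exp (- (pi * t) * real n)" if "\<bar>y\<bar> \<ge> real n + 1/2" for y
    proof -
      have "real n \<le> (real n + 1/2)\<^sup>2" by (simp add: power2_eq_square algebra_simps)
      also have "\<dots> \<le> \<bar>y\<bar>\<^sup>2" using that by (intro power_mono) auto
      finally show ?thesis using t by (simp add: f_def mult_left_mono)
    qed
    have "f (x + real (Suc n)) \<le> exp (- (pi * t) * real n)" "f (x - real (Suc n))
      \<le> exp (- (pi * t) * real n)"
      by (rule *; use that in auto)+
    moreover have "f y \<ge> 0" for y by (simp add: f_def)
    ultimately show ?thesis by (simp add: G_def)
  qed
  have T_bound: "\<bar>T n x\<bar> \<le> 2 / sqrt t * exp (- (pi / t) * real n)" for n x
  proof -
    let ?C = "2 * exp (- pi * (real (Suc n))\<^sup>2 / t) / sqrt t"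
    have C: "?C \<ge> 0" using t by simp
    then have "\<bar>T n x\<bar> = ?C * \<bar>cos (2 * pi * real (Suc n) * x)\<bar>"
      unfolding T_def abs_mult using t by simp
    also have "\<dots> \<le> ?C * 1" by (rule mult_left_mono[OF abs_cos_le_one C])
    also have "\<dots> = ?C" by simp
    also have "\<dots> \<le> 2 * exp (- (pi / t) * real n) / sqrt t"
    proof -
      have "real n \<le> (real (Suc n))\<^sup>2" by (simp add: power2_eq_square algebra_simps)
      then show ?thesis using t by (auto intro!: divide_right_mono simp: field_simps)
    qed
    finally show ?thesis by simp
  qed
  have summ: "summable (\<lambda>n. 2 * exp (- (pi * t) * real n) + 2 / sqrt t * exp (- (pi / t) * real n))"
    using t by (intro summable_add summable_mult summable_exp_neg) auto
  have "uniform_limit ?I (\<lambda>N x. \<Sum>n<N. G n x - T n x) (\<lambda>x. \<Sum>n. G n x - T n x) sequentially"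
  proof (rule Weierstrass_m_test[OF _ summ])
    show "norm (G n x - T n x) \<le> 2 * exp (- (pi * t) * real n)
      + 2 / sqrt t * exp (- (pi / t) * real n)" if "x \<in> ?I" for n x
      using G_bound[OF that, of n] T_bound[of n x] by simp
  qed
  then have unif: "uniform_limit ?I hN h sequentially"
    unfolding hN_def h_def by (intro uniform_limit_intros)
  have cont_T: "continuous_on A (T n)" for A n unfolding T_def by (intro continuous_intros)
  have cont_G: "continuous_on A (G n)" for A n
    unfolding G_def f_def by (intro continuous_intros)
  have cont_hN: "continuous_on ?I (hN N)" for N
    unfolding hN_def using cont_f[of ?I 0] by (intro continuous_intros cont_T cont_G) auto
  have cont_h: "continuous_on ?I h"
    by (rule uniform_limit_theorem[OF _ unif]) (use cont_hN in auto)
  have h_even: "h (- x) = h x" for x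
  proof -
    have sq: "(- x + a)\<^sup>2 = (x - a)\<^sup>2" "(- x - a)\<^sup>2 = (x + a)\<^sup>2" for a :: real
      by (simp_all add: power2_eq_square algebra_simps)
    have "G n (- x) = G n x" for n unfolding G_def f_def sq by (rule add.commute)
    moreover have "T n (- x) = T n x" for n by (simp add: T_def)
    ultimately show ?thesis by (simp add: h_def f_even)
  qed
  have coef: "integral ?I (\<lambda>x. h x * cos (2 * pi * real k * x)) = 0" for k :: nat
  proof -
    let ?c = "\<lambda>x. cos (2 * pi * real k * x)"
    define F where "F x = f x * ?c x" for x
    have cF: "continuous_on A F" for A unfolding F_def f_def by (intro continuous_intros)
    have c_shift: "?c (x + real n) = ?c x" "?c (x - real n) = ?c x" for x n
    proof -
      have "2 * pi * real k * (x + real n) = 2 * pi * real k * x + 2 * pi * of_int (int (k * n))"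
        "2 * pi * real k * (x - real n) = 2 * pi * real k * x + 2 * pi * of_int (- int (k * n))"
          by (simp_all add: algebra_simps)
      then show "?c (x + real n) = ?c x" "?c (x - real n) = ?c x" 
        by (simp_all only: cos_add cos_int_2pin sin_int_2pin)
    qed
    \<comment> \<open>Unfolding: since \<open>?c\<close> has period 1, integrating the translates
      over one period is integrating \<open>F\<close> over a growing symmetric interval.\<close>
    have S: "((\<lambda>x. (f x + (\<Sum>n<N. G n x)) * ?c x) has_integral integral {-(real N + 1/2)..real N
      + 1/2} F) ?I" for N
    proof (induction N)
      case 0
      have "(F has_integral integral ?I F) ?I"
        by (intro integrable_integral integrable_continuous_interval cF)
      then show ?case by (simp add: F_def[abs_def])
    next
      case (Suc N)
      have int: "F integrable_on {a..b}" for a b by (intro integrable_continuous_interval cF)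
      have sh: "((\<lambda>x. F (x + b)) has_integral integral {-1/2+b..1/2+b} F) ?I" for b
      proof -
        have "integral {-1/2+b..1/2+b} F = integral ?I (\<lambda>x. F (x + b))"
          using integral_shift_real_ivl[of "-1/2+b" b "1/2+b" F] by simp
        moreover have "(\<lambda>x. F (x + b)) integrable_on ?I"
          by (intro integrable_continuous_interval continuous_on_compose2[OF cF[of UNIV]]
            continuous_intros) auto
        ultimately show ?thesis by (simp add: integrable_integral)
      qed
      have sum: "((\<lambda>x. (f x + (\<Sum>n<N. G n x)) * ?c x + (F (x + real (Suc N))
        + F (x + - real (Suc N)))) has_integral
         integral {-(real N + 1/2)..real N + 1/2} F
           + (integral {-1/2+real (Suc N)..1/2+real (Suc N)} F
           + integral {-1/2+(-real (Suc N))..1/2+(-real (Suc N))} F)) ?I"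
        by (intro has_integral_add Suc.IH sh)
      have fn: "(f x + (\<Sum>n<N. G n x)) * ?c x + (F (x + real (Suc N)) + F (x + - real (Suc N)))
        = (f x + (\<Sum>n<Suc N. G n x)) * ?c x" for x
        using c_shift[of x "Suc N"] unfolding F_def
          by (simp add: G_def algebra_simps del: of_nat_Suc)
      have "integral {-(real (Suc N) + 1/2)..real (Suc N) + 1/2} F = 
        integral {-(real (Suc N) + 1/2)..-(real N+1/2)} F + (integral {-(real N + 1/2)..real N
          + 1/2} F + integral {real N + 1/2..real (Suc N) + 1/2} F)"
        using Henstock_Kurzweil_Integration.integral_combine[where a = "-(real N + 1/2)" and c
          = "real N + 1/2" and b = "real (Suc N) + 1/2" and f = F]
          Henstock_Kurzweil_Integration.integral_combine[where a = "-(real (Suc N) + 1/2)" and c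
            = "-(real N + 1/2)" and b = "real (Suc N) + 1/2" and f = F] int by simp
      moreover have "-1/2 + real (Suc N) = real N + 1/2" "1/2 + real (Suc N) = real (Suc N) + 1/2"
        "-1/2 + (- real (Suc N)) = - (real (Suc N) + 1/2)" "1/2 + (- real (Suc N))
          = -(real N + 1/2)" by auto
      ultimately have "integral {-(real N + 1/2)..real N + 1/2} F
        + (integral {-1/2+real (Suc N)..1/2+real (Suc N)} F
        + integral {-1/2+(-real (Suc N))..1/2+(-real (Suc N))} F)
        = integral {-(real (Suc N) + 1/2)..real (Suc N) + 1/2} F" by (simp only:)
      then show ?case using sum unfolding fn by (simp only:)
    qed
    define g where "g = exp (- pi * (real k)\<^sup>2 / t) / sqrt t"
    have Flim: "(\<lambda>N. integral {-(real N + 1/2)..real N + 1/2} F) \<longlonglongrightarrow> g"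
    proof -
      have hb: "has_bochner_integral lborel F g"
        using gaussian_cos_integral[OF t, of "real k"] by (simp add: F_def[abs_def] f_def g_def)
      then have int: "integrable lborel F" and g: "g = (LBINT x. F x)"
        by (auto simp: has_bochner_integral_iff)
      have "(\<lambda>N. LBINT x. indicator {-(real N + 1/2)..real N + 1/2} x *\<^sub>R F x) \<longlonglongrightarrow> (LBINT x. F x)"
      proof (rule integral_dominated_convergence[where w = "\<lambda>x. norm (F x)"])
        show "AE x in lborel. (\<lambda>N. indicator {-(real N + 1/2)..real N + 1/2} x *\<^sub>R F x) \<longlonglongrightarrow> F x"
        proof (intro AE_I2 tendsto_eventually)
          fix x :: real
          obtain N0 where "\<bar>x\<bar> \<le> real N0" using real_arch_simple by blast
          then show "\<forall>\<^sub>F N in sequentially. indicator {-(real N + 1/2)..real N + 1/2} x *\<^sub>R F x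
            = F x"
            by (intro eventually_sequentiallyI[of N0]) (auto simp: indicator_def)
        qed
      qed (use int in \<open>auto simp: indicator_def intro!: borel_measurable_integrable\<close>)
      moreover have "(LBINT x. indicator {-(real N + 1/2)..real N + 1/2} x *\<^sub>R F x)
        = integral {-(real N + 1/2)..real N + 1/2} F" for N
      proof -
        have "set_integrable lborel {-(real N + 1/2)..real N + 1/2} F"
          unfolding set_integrable_def by (rule integrable_mult_indicator[OF _ int]) simp
        from set_borel_integral_eq_integral(2)[OF this] show ?thesis
          by (simp add: set_lebesgue_integral_def)
      qed
      ultimately show ?thesis by (simp add: g)
    qed
    \<comment> \<open>For \<open>N \<ge> k\<close> the partial sum contains the frequency
      \<open>k\<close>, at index \<open>k - 1\<close> or as the constant term, so orthogonality
      gives the full coefficient \<open>g\<close>.\<close>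
    have Tsum: "((\<lambda>x. (1 / sqrt t + (\<Sum>n<N. T n x)) * ?c x) has_integral g) ?I" if "N \<ge> k" for N
    proof -
      let ?J = "\<lambda>n. (if n = k then if k = 0 then 1 else 1/2 else 0 :: real)"
      have "((\<lambda>x. (1 / sqrt t) * (cos (2 * pi * real 0 * x) * ?c x)
        + (\<Sum>n<N. (2 * exp (- pi * (real (Suc n))\<^sup>2 / t) / sqrt t)
        * (cos (2 * pi * real (Suc n) * x) * ?c x)))
        has_integral (1 / sqrt t) * ?J 0
          + (\<Sum>n<N. (2 * exp (- pi * (real (Suc n))\<^sup>2 / t) / sqrt t) * ?J (Suc n))) ?I"
        by (intro has_integral_add has_integral_sum has_integral_mult_right cos_orthogonal
          finite_lessThan)
      moreover have "(1 / sqrt t) * (cos (2 * pi * real 0 * x) * ?c x)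
        + (\<Sum>n<N. (2 * exp (- pi * (real (Suc n))\<^sup>2 / t) / sqrt t)
        * (cos (2 * pi * real (Suc n) * x) * ?c x))
        = (1 / sqrt t + (\<Sum>n<N. T n x)) * ?c x" for x
        by (simp add: T_def distrib_right sum_distrib_right mult.assoc)
      moreover have "(1 / sqrt t) * ?J 0
        + (\<Sum>n<N. (2 * exp (- pi * (real (Suc n))\<^sup>2 / t) / sqrt t) * ?J (Suc n)) = g"
      proof (cases k)
        case 0
        then show ?thesis by (simp add: g_def)
      next
        case (Suc m)
        have "(\<Sum>n<N. (2 * exp (- pi * (real (Suc n))\<^sup>2 / t) / sqrt t) * ?J (Suc n))
          = (\<Sum>n<N. if n = m then exp (- pi * (real (Suc n))\<^sup>2 / t) / sqrt t else 0)"
          by (rule sum.cong) (auto simp: Suc)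
        also have "\<dots> = g" using that Suc by (simp add: g_def)
        finally show ?thesis using Suc by simp
      qed
      ultimately show ?thesis by simp
    qed
    have hNk: "((\<lambda>x. hN N x * ?c x) has_integral (integral {-(real N + 1/2)..real N + 1/2} F
      - g)) ?I" if "N \<ge> k" for N
    proof -
      have "((\<lambda>x. (f x + (\<Sum>n<N. G n x)) * ?c x - (1 / sqrt t + (\<Sum>n<N. T n x)) * ?c x)
        has_integral (integral {-(real N + 1/2)..real N + 1/2} F - g)) ?I"
        by (rule has_integral_diff[OF S Tsum[OF that]])
      moreover have "(f x + (\<Sum>n<N. G n x)) * ?c x - (1 / sqrt t + (\<Sum>n<N. T n x)) * ?c x
        = hN N x * ?c x" for x
        by (simp add: hN_def sum_subtractf algebra_simps)
      ultimately show ?thesis by (simp only:)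
    qed
    \<comment> \<open>Uniform convergence transfers the coefficients of \<open>hN N\<close> to
      \<open>h\<close>, and they tend to \<open>g - g\<close>.\<close>
    have "uniform_limit ?I (\<lambda>N x. hN N x * ?c x) (\<lambda>x. h x * ?c x) sequentially"
    proof (rule uniform_lim_mult[OF unif uniform_limit_const])
      show "bounded (h ` ?I)" by
        (intro compact_imp_bounded compact_continuous_image cont_h compact_Icc)
      show "bounded (?c ` ?I)" by (intro boundedI[of _ 1]) auto
    qed
    then obtain I J where IJ: "\<And>N. ((\<lambda>x. hN N x * ?c x) has_integral I N) ?I" "((\<lambda>x. h x * ?c x)
      has_integral J) ?I" "I \<longlonglongrightarrow> J"
      by (rule uniform_limit_integral) (auto intro!: continuous_intros cont_hN[simplified])
    have "\<forall>\<^sub>F N in sequentially. I N = integral {-(real N + 1/2)..real N + 1/2} F - g"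
      by (rule eventually_sequentiallyI[of k]) (rule has_integral_unique[OF IJ(1) hNk])
    moreover have "(\<lambda>N. integral {-(real N + 1/2)..real N + 1/2} F - g) \<longlonglongrightarrow> g - g"
      by (intro tendsto_intros Flim)
    ultimately have "I \<longlonglongrightarrow> 0" by (simp add: tendsto_cong)
    then have "J = 0" using IJ(3) LIMSEQ_unique by blast
    then show ?thesis using IJ(2) integral_unique by blast
  qed
  have "h 0 = 0" by (rule even_eq_0_if_cos_coeffs_0[OF cont_h h_even coef]) auto
  moreover have "h 0 = jacobi_theta t - jacobi_theta (1 / t) / sqrt t"
  proof -
    have G0: "G n 0 = 2 * exp (- pi * (real (Suc n))\<^sup>2 * t)" for n
      using f_even[of "real (Suc n)"] by (simp add: G_def f_def mult_ac)
    have T0: "T n 0 = 2 / sqrt t * exp (- pi * (real (Suc n))\<^sup>2 * (1 / t))" for n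
      by (simp add: T_def)
    have sG: "summable (\<lambda>n. G n 0)"
      by (rule summable_comparison_test'[OF summable_mult[OF summable_exp_neg[of "pi * t"], of 2]])
        (use t G_bound[of 0] in auto)
    have sT: "summable (\<lambda>n. T n 0)"
      by (rule summable_comparison_test'[OF summable_mult[OF summable_exp_neg[of "pi / t"],
        of "2 / sqrt t"]]) (use t T_bound[of _ 0] in auto)
    have "(\<Sum>n. G n 0) = 2 * (\<Sum>n. exp (- pi * (real (Suc n))\<^sup>2 * t))"
      using sG unfolding G0 by (intro suminf_mult) (simp only: summable_cmult_iff, simp)
    moreover have "(\<Sum>n. T n 0) = 2 / sqrt t * (\<Sum>n. exp (- pi * (real (Suc n))\<^sup>2 * (1 / t)))"
      using sT t unfolding T0 by (intro suminf_mult) (simp only: summable_cmult_iff, simp)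
    ultimately show ?thesis
      using t suminf_diff[OF sG sT] by (simp add: h_def jacobi_theta_def f_def field_simps)
  qed
  ultimately show ?thesis by simp
qed

section \<open>The kernel of the xi function\<close>

definition theta_exponent :: "nat \<Rightarrow> real \<Rightarrow> real" where "theta_exponent n u
  = pi * (real (Suc n))\<^sup>2 * exp (2 * u)"

text \<open>With \<open>A u = exp (u / 2) * jacobi_theta (exp (2 * u))\<close>, which is even by the inversion formula,
  the kernel is \<open>A'' / 2 - A / 8\<close>.\<close>

definition xi_kernel :: "real \<Rightarrow> real" where
  "xi_kernel u = (\<Sum>n. (4 * (theta_exponent n u)\<^sup>2 - 6 * theta_exponent n u) * exp (u / 2
    - theta_exponent n u))"

section \<open>Termwise bounds and differentiation of theta series\<close>

lemma theta_exponent_pos: "theta_exponent n u > 0" by (simp add: theta_exponent_def)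

text \<open>Half of the decay is spent on absorbing the quadratic; the 8 comes from the term
  \<open>X^2 / 8\<close> of \<open>exp (X / 2)\<close>.\<close>

lemma quadratic_exp_bound:
  fixes X :: real assumes "X \<ge> 0"
  shows "(1 + X + X\<^sup>2) * exp (- X) \<le> 8 * exp (- X / 2)"
proof -
  have "1 + X/2 + (X/2)\<^sup>2 / 2 \<le> exp (X / 2)"
    by (rule exp_lower_Taylor_quadratic) (use assms in simp)
  then have "1 + X + X\<^sup>2 \<le> 8 * exp (X / 2)" using assms by (simp add: power2_eq_square)
  then have "(1 + X + X\<^sup>2) * exp (- X) \<le> 8 * exp (X / 2) * exp (- X)"
    by (intro mult_right_mono) auto
  also have "\<dots> = 8 * exp (- X / 2)" by (simp add: exp_add[symmetric])
  finally show ?thesis .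
qed

lemma theta_term_pointwise_bound:
  assumes "\<bar>p\<bar> \<le> 6 * (1 + theta_exponent n u + (theta_exponent n u)\<^sup>2)"
  shows "\<bar>p * exp (u / 2 - theta_exponent n u)\<bar> \<le> 48 * exp (u / 2) * exp (- theta_exponent n u / 2)"
proof -
  have "\<bar>p * exp (u / 2 - theta_exponent n u)\<bar> = \<bar>p\<bar> * exp (- theta_exponent n u) * exp (u / 2)"
  proof -
    have "exp (u / 2 - theta_exponent n u) = exp (- theta_exponent n u) * exp (u / 2)"
      by (simp add: exp_add[symmetric])
    then show ?thesis by (simp add: abs_mult)
  qed
  also have "\<dots> \<le> 6 * (1 + theta_exponent n u + (theta_exponent n u)\<^sup>2) * exp (- theta_exponent n u)
    * exp (u / 2)"
    using assms by (intro mult_right_mono) auto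
  also have "\<dots> = 6 * ((1 + theta_exponent n u + (theta_exponent n u)\<^sup>2)
    * exp (- theta_exponent n u)) * exp (u / 2)" by simp
  also have "\<dots> \<le> 6 * (8 * exp (- theta_exponent n u / 2)) * exp (u / 2)"
    using quadratic_exp_bound[of "theta_exponent n u"] theta_exponent_pos[of n u]
      by (intro mult_right_mono mult_left_mono) auto
  finally show ?thesis by (simp add: mult_ac)
qed

lemma theta_term_bound:
  assumes "\<bar>p\<bar> \<le> 6 * (1 + theta_exponent n u + (theta_exponent n u)\<^sup>2)" "u \<in> {-b..b}"
  shows "norm (p * exp (u / 2 - theta_exponent n u))
    \<le> 48 * exp (b / 2) * exp (- (pi / 2 * exp (-2 * b)) * real n)"
proof -
  have "real n * exp (- 2 * b) \<le> (real (Suc n))\<^sup>2 * exp (2 * u)"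
    using assms(2) by (intro mult_mono) (auto simp: power2_eq_square algebra_simps)
  then have "pi / 2 * (real n * exp (- 2 * b)) \<le> pi / 2 * ((real (Suc n))\<^sup>2 * exp (2 * u))"
    by (intro mult_left_mono) auto
  then have "(pi / 2 * exp (-2 * b)) * real n \<le> theta_exponent n u / 2"
    by (simp add: theta_exponent_def mult_ac)
  then have "exp (- theta_exponent n u / 2) \<le> exp (- (pi / 2 * exp (-2 * b)) * real n)" by simp
  moreover have "exp (u / 2) \<le> exp (b / 2)" using assms(2) by simp
  ultimately have "48 * exp (u / 2) * exp (- theta_exponent n u / 2)
    \<le> 48 * exp (b / 2) * exp (- (pi / 2 * exp (-2 * b)) * real n)"
    by (intro mult_mono) auto
  then show ?thesis using theta_term_pointwise_bound[OF assms(1)] by simp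
qed

lemma summable_theta_bound: "summable (\<lambda>n. C * exp (- (pi / 2 * exp (-2 * b)) * real n))"
  by (intro summable_mult summable_exp_neg) simp

text \<open>With \<open>X = theta_exponent n u\<close>, whose derivative is \<open>2 X\<close>, the
  first three are the prefactors in the series for \<open>A\<close>, \<open>A'\<close> and
  \<open>A''\<close>, and the last is that of \<open>xi_kernel\<close>. One majorant
  \<open>6 (1 + X + X^2)\<close> lets the same estimate serve all of them.\<close>

lemma theta_coefficient_bounds:
  "\<bar>1\<bar> \<le> 6 * (1 + theta_exponent n u + (theta_exponent n u)\<^sup>2)"
  "\<bar>1/2 - 2 * theta_exponent n u\<bar> \<le> 6 * (1 + theta_exponent n u + (theta_exponent n u)\<^sup>2)"
  "\<bar>1/4 - 6 * theta_exponent n u + 4 * (theta_exponent n u)\<^sup>2\<bar>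
    \<le> 6 * (1 + theta_exponent n u + (theta_exponent n u)\<^sup>2)"
  "\<bar>4 * (theta_exponent n u)\<^sup>2 - 6 * theta_exponent n u\<bar>
    \<le> 6 * (1 + theta_exponent n u + (theta_exponent n u)\<^sup>2)"
proof -
  define X S where "X = theta_exponent n u" and "S = (theta_exponent n u)\<^sup>2"
  have "X > 0" "S \<ge> 0" using theta_exponent_pos by (auto simp: X_def S_def)
  then have "\<bar>1\<bar> \<le> 6 * (1 + X + S)" "\<bar>1/2 - 2 * X\<bar> \<le> 6 * (1 + X + S)"
    "\<bar>1/4 - 6 * X + 4 * S\<bar> \<le> 6 * (1 + X + S)" "\<bar>4 * S - 6 * X\<bar> \<le> 6 * (1 + X + S)"
    by (auto simp: abs_le_iff)
  then show "\<bar>1\<bar> \<le> 6 * (1 + theta_exponent n u + (theta_exponent n u)\<^sup>2)"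
    "\<bar>1/2 - 2 * theta_exponent n u\<bar> \<le> 6 * (1 + theta_exponent n u + (theta_exponent n u)\<^sup>2)"
    "\<bar>1/4 - 6 * theta_exponent n u + 4 * (theta_exponent n u)\<^sup>2\<bar>
      \<le> 6 * (1 + theta_exponent n u + (theta_exponent n u)\<^sup>2)"
    "\<bar>4 * (theta_exponent n u)\<^sup>2 - 6 * theta_exponent n u\<bar>
      \<le> 6 * (1 + theta_exponent n u + (theta_exponent n u)\<^sup>2)"
    unfolding X_def S_def by simp_all
qed

lemma summable_theta_terms:
  assumes "\<And>n. \<bar>p n\<bar> \<le> 6 * (1 + theta_exponent n u + (theta_exponent n u)\<^sup>2)"
  shows "summable (\<lambda>n. p n * exp (u / 2 - theta_exponent n u))"
proof (rule summable_comparison_test'[OF summable_theta_bound[of "48 * exp (\<bar>u\<bar> / 2)" "\<bar>u\<bar>"]])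
  show "norm (p n * exp (u / 2 - theta_exponent n u))
    \<le> 48 * exp (\<bar>u\<bar> / 2) * exp (- (pi / 2 * exp (- 2 * \<bar>u\<bar>)) * real n)" for n
    by (rule theta_term_bound[OF assms]) auto
qed

lemma theta_series_has_derivative:
  assumes bnd: "\<And>n u. \<bar>p n u\<bar> \<le> 6 * (1 + theta_exponent n u + (theta_exponent n u)\<^sup>2)"
    "\<And>n u. \<bar>q n u\<bar> \<le> 6 * (1 + theta_exponent n u + (theta_exponent n u)\<^sup>2)"
    and der: "\<And>n u. ((\<lambda>u. p n u * exp (u / 2 - theta_exponent n u)) has_real_derivative q n u
      * exp (u / 2 - theta_exponent n u)) (at u)"
  shows "((\<lambda>u. \<Sum>n. p n u * exp (u / 2 - theta_exponent n u)) has_real_derivative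
    (\<Sum>n. q n u * exp (u / 2 - theta_exponent n u))) (at u)"
proof -
  define b where "b = \<bar>u\<bar> + 1"
  show ?thesis
  proof (rule has_field_derivative_series'(2)[where S = "{-b..b}" and ?x0.0 = u])
    show "uniformly_convergent_on {-b..b} (\<lambda>n x. \<Sum>i<n. q i x * exp (x / 2 - theta_exponent i x))"
      by (rule Weierstrass_m_test'[OF theta_term_bound[OF bnd(2)] summable_theta_bound])
    show "summable (\<lambda>n. p n u * exp (u / 2 - theta_exponent n u))"
      by (rule summable_theta_terms[OF bnd(1)])
  qed (use der in \<open>auto simp: b_def intro: has_field_derivative_at_within\<close>)
qed

lemma even_function_derivative:
  fixes f :: "real \<Rightarrow> real"
  assumes "\<And>u. (f has_real_derivative f' u) (at u)" "\<And>u. f (- u) = s * f u"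
  shows "f' (- u) = - s * f' u"
proof -
  have "((\<lambda>u. f (- u)) has_real_derivative f' (- u) * (-1)) (at u)"
    by (rule DERIV_chain2[OF assms(1)]) (auto intro!: derivative_eq_intros)
  moreover have "((\<lambda>u. f (- u)) has_real_derivative s * f' u) (at u)"
    unfolding assms(2) by (rule DERIV_cmult[OF assms(1)])
  ultimately have "f' (- u) * (-1) = s * f' u" by (rule DERIV_unique)
  then show ?thesis by simp
qed

lemma xi_kernel_even: "xi_kernel (- u) = xi_kernel u"
proof -
  let ?E = "\<lambda>n u. exp (u / 2 - theta_exponent n u)"
  \<comment> \<open>\<open>A1\<close> and \<open>A2\<close> are the first two derivatives of
    \<open>A\<close>.\<close>
  define A where "A u = exp (u / 2) + 2 * (\<Sum>n. 1 * ?E n u)" for u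
  define A1 where "A1 u = exp (u / 2) / 2 + 2 * (\<Sum>n. (1/2 - 2 * theta_exponent n u) * ?E n u)" for u
  define A2 where "A2 u = exp (u / 2) / 4 + 2 * (\<Sum>n. (1/4 - 6 * theta_exponent n u
    + 4 * (theta_exponent n u)\<^sup>2) * ?E n u)" for u
  have dX: "(theta_exponent n has_real_derivative 2 * theta_exponent n u) (at u)" for n u
    unfolding theta_exponent_def[abs_def] by (auto intro!: derivative_eq_intros)
  have dA: "(A has_real_derivative A1 u) (at u)" for u
  proof -
    have "((\<lambda>u. \<Sum>n. 1 * ?E n u) has_real_derivative (\<Sum>n. (1/2 - 2 * theta_exponent n u) * ?E n u))
      (at u)"
      by (rule theta_series_has_derivative[OF theta_coefficient_bounds(1,2)])
        (auto intro!: derivative_eq_intros dX)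
    then show ?thesis unfolding A_def A1_def
      by (intro DERIV_add DERIV_cmult) (auto intro!: derivative_eq_intros)
  qed
  have dA1: "(A1 has_real_derivative A2 u) (at u)" for u
  proof -
    have "((\<lambda>u. \<Sum>n. (1/2 - 2 * theta_exponent n u) * ?E n u) has_real_derivative (\<Sum>n. (1/4
      - 6 * theta_exponent n u + 4 * (theta_exponent n u)\<^sup>2) * ?E n u)) (at u)"
      by (rule theta_series_has_derivative[OF theta_coefficient_bounds(2,3)])
        (auto intro!: derivative_eq_intros dX simp: field_simps power2_eq_square)
    then show ?thesis unfolding A1_def A2_def
      by (intro DERIV_add DERIV_cmult) (auto intro!: derivative_eq_intros)
  qed
  have A_theta: "A u = exp (u / 2) * jacobi_theta (exp (2 * u))" for u
  proof -
    have s: "summable (\<lambda>n. exp (- pi * (real (Suc n))\<^sup>2 * exp (2 * u)))"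
    proof (rule summable_comparison_test'[OF summable_exp_neg[of "pi * exp (2 * u)"]])
      show "norm (exp (- pi * (real (Suc n))\<^sup>2 * exp (2 * u)))
        \<le> exp (- (pi * exp (2 * u)) * real n)" for n
      proof -
        have "real n \<le> (real (Suc n))\<^sup>2" by (simp add: power2_eq_square algebra_simps)
        then have "pi * exp (2 * u) * real n \<le> pi * exp (2 * u) * (real (Suc n))\<^sup>2"
          by (intro mult_left_mono) auto
        then show ?thesis by (simp add: mult_ac)
      qed
    qed simp
    have "(\<Sum>n. 1 * ?E n u) = (\<Sum>n. exp (u / 2) * exp (- pi * (real (Suc n))\<^sup>2 * exp (2 * u)))"
      unfolding exp_add[symmetric] theta_exponent_def by (intro suminf_cong) simp
    also have "\<dots> = exp (u / 2) * (\<Sum>n. exp (- pi * (real (Suc n))\<^sup>2 * exp (2 * u)))"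
      by (rule suminf_mult[OF s])
    finally show ?thesis by (simp add: A_def jacobi_theta_def algebra_simps)
  qed
  \<comment> \<open>The weight \<open>exp (u / 2)\<close> makes \<open>A\<close> even: inversion
    contributes \<open>1 / sqrt (exp (2 u)) = exp (- u)\<close>, which leaves
    \<open>exp (- u / 2)\<close>.\<close>
  have "A (- u) = 1 * A u" for u
  proof -
    have inv: "jacobi_theta (exp (2 * u)) = jacobi_theta (1 / exp (2 * u)) / sqrt (exp (2 * u))"
      by (rule jacobi_theta_inversion) simp
    have e: "1 / exp (2 * u) = exp (2 * (- u))" by (simp add: exp_minus divide_inverse)
    have sq: "sqrt (exp (2 * u)) = exp u"
      by (rule real_sqrt_unique) (simp_all add: exp_double)
    have q: "exp (u / 2) / exp u = exp (- u / 2)" by (simp add: exp_diff[symmetric])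
    have "A u = exp (u / 2) / exp u * jacobi_theta (exp (2 * (- u)))"
      unfolding A_theta inv e sq by simp
    then show ?thesis unfolding q by (simp only: A_theta mult_1)
  qed
  from even_function_derivative[OF dA this] have "A1 (- u) = (-1) * A1 u" for u by simp
  from even_function_derivative[OF dA1 this] have A2: "A2 (- u) = A2 u" by simp
  \<comment> \<open>This combination cancels the isolated term \<open>exp (u / 2)\<close>, which
    comes from the 1 in \<open>jacobi_theta\<close>; only terms that decay as \<open>u\<close> grows
    remain.\<close>
  have "xi_kernel u = A2 u / 2 - A u / 8" for u
  proof -
    have "A2 u / 2 - A u / 8 = (\<Sum>n. (1/4 - 6 * theta_exponent n u + 4 * (theta_exponent n u)\<^sup>2)
      * ?E n u) - (\<Sum>n. 1 * ?E n u) / 4"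
      by (simp add: A_def A2_def field_simps)
    also have "(\<Sum>n. 1 * ?E n u) / 4 = (\<Sum>n. 1 * ?E n u / 4)"
      by (rule suminf_divide[symmetric, OF summable_theta_terms]) (rule theta_coefficient_bounds)
    also have "(\<Sum>n. (1/4 - 6 * theta_exponent n u + 4 * (theta_exponent n u)\<^sup>2) * ?E n u) - \<dots> = 
      (\<Sum>n. (1/4 - 6 * theta_exponent n u + 4 * (theta_exponent n u)\<^sup>2) * ?E n u - 1 * ?E n u / 4)"
      by (intro suminf_diff summable_divide summable_theta_terms theta_coefficient_bounds)
    also have "\<dots> = xi_kernel u" unfolding xi_kernel_def
      by (rule suminf_cong) (simp add: algebra_simps)
    finally show ?thesis ..
  qed
  then show ?thesis using A2 \<open>\<And>u. A (- u) = 1 * A u\<close> by simp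
qed

text \<open>For \<open>u \<ge> 0\<close> every \<open>theta_exponent n u\<close> exceeds 2, so each
  term of the series is positive. For negative \<open>u\<close> single terms can be negative, and
  evenness takes over.\<close>

lemma xi_kernel_pos: "xi_kernel u > 0"
proof -
  have "xi_kernel u > 0" if "u \<ge> 0" for u
  proof -
    have "(4 * (theta_exponent n u)\<^sup>2 - 6 * theta_exponent n u) * exp (u / 2
      - theta_exponent n u) > 0" for n
    proof -
      have "2 * 1 * 1 < pi * (real (Suc n))\<^sup>2 * exp (2 * u)"
        using that pi_gt3 by (intro mult_less_le_imp_less mult_le_less_imp_less) auto
      then have "theta_exponent n u > 2" by (simp add: theta_exponent_def)
      then have "theta_exponent n u * (4 * theta_exponent n u - 6) > 0" by (intro mult_pos_pos) auto
      then have "theta_exponent n u * (4 * theta_exponent n u - 6) * exp (u / 2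
        - theta_exponent n u) > 0" by (rule mult_pos_pos) simp
      moreover have "theta_exponent n u * (4 * theta_exponent n u - 6)
        = 4 * (theta_exponent n u)\<^sup>2
        - 6 * theta_exponent n u" by (simp add: power2_eq_square algebra_simps)
      ultimately show ?thesis by simp
    qed
    then show ?thesis unfolding xi_kernel_def
      by (intro suminf_pos summable_theta_terms theta_coefficient_bounds)
  qed
  then show ?thesis using xi_kernel_even[of u]
    by (cases "u \<ge> 0") (metis, metis neg_0_le_iff_le nle_le)
qed

lemma xi_kernel_measurable [measurable]: "xi_kernel \<in> borel_measurable borel"
  unfolding xi_kernel_def[abs_def] theta_exponent_def by measurable

text \<open>For \<open>u \<ge> 0\<close>, half of \<open>theta_exponent n u\<close> is at least
  \<open>exp (2 u) / 2 + n / 2\<close>: the first part beats \<open>u / 2 + A u^2\<close> for any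
  \<open>A\<close>, the second keeps the series summable. Evenness does the rest.\<close>

lemma xi_kernel_decay: "\<exists>C>0. \<forall>u. xi_kernel u \<le> C * exp (- A * u\<^sup>2)"
proof -
  define S where "S = (\<Sum>n. exp (- (1/2) * real n))"
  have "\<exists>B. \<forall>u\<ge>0. u / 2 - exp (2 * u) / 2 + A * u\<^sup>2 \<le> B"
  proof -
    define g where "g u = u / 2 - exp (2 * u) / 2 + A * u\<^sup>2" for u :: real
    have "filterlim g at_bot at_top" unfolding g_def by real_asymp
    then have "eventually (\<lambda>u. g u \<le> 0) at_top" unfolding filterlim_at_bot by blast
    then obtain u0 where u0: "\<And>u. u \<ge> u0 \<Longrightarrow> g u \<le> 0" by (auto simp: eventually_at_top_linorder)
    have "continuous_on {0..u0} g" unfolding g_def by (intro continuous_intros) auto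
    then have "bounded (g ` {0..u0})"
      by (intro compact_imp_bounded compact_continuous_image compact_Icc)
    then obtain B where B: "\<forall>u\<in>{0..u0}. \<bar>g u\<bar> \<le> B" unfolding bounded_iff by auto
    have "g u \<le> max B 0" if "u \<ge> 0" for u using u0[of u] B that by (cases "u \<ge> u0") force+
    then show ?thesis unfolding g_def by blast
  qed
  then obtain B where B: "\<And>u. u \<ge> 0 \<Longrightarrow> u / 2 - exp (2 * u) / 2 + A * u\<^sup>2 \<le> B" by blast
  have Spos: "S > 0" unfolding S_def by (intro suminf_pos summable_exp_neg) auto
  have pos: "xi_kernel u \<le> 48 * S * exp B * exp (- A * u\<^sup>2)" if u: "u \<ge> 0" for u
  proof -
    have summand: "(4 * (theta_exponent n u)\<^sup>2 - 6 * theta_exponent n u) * exp (u / 2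
      - theta_exponent n u) \<le> 48 * exp (u / 2 - exp (2 * u) / 2) * exp (- (1/2) * real n)" for n
    proof -
      have "theta_exponent n u / 2 \<ge> exp (2 * u) / 2 + real n / 2"
      proof -
        have e: "exp (2 * u) \<ge> 1" using u by simp
        have "real n + exp (2 * u) \<le> real n * exp (2 * u) + exp (2 * u)" using e
          by (simp add: mult_left_le mult_le_cancel_left1)
        also have "\<dots> = real (Suc n) * exp (2 * u)" by (simp add: algebra_simps)
        also have "\<dots> \<le> (real (Suc n))\<^sup>2 * exp (2 * u)"
          by (intro mult_right_mono) (auto simp: power2_eq_square)
        also have "\<dots> \<le> pi * ((real (Suc n))\<^sup>2 * exp (2 * u))"
          using pi_gt3 mult_right_mono[of 1 pi "(real (Suc n))\<^sup>2 * exp (2 * u)"] by simp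
        finally show ?thesis by (simp add: theta_exponent_def)
      qed
      then have "exp (- theta_exponent n u / 2) \<le> exp (- exp (2 * u) / 2 + - (1/2) * real n)"
        by simp
      then have "48 * exp (u / 2) * exp (- theta_exponent n u / 2)
        \<le> 48 * exp (u / 2) * exp (- exp (2 * u) / 2 + - (1/2) * real n)"
        by (intro mult_left_mono) auto
      also have "\<dots> = 48 * exp (u / 2 - exp (2 * u) / 2) * exp (- (1/2) * real n)"
        by (simp add: exp_add[symmetric] mult.assoc)
      finally show ?thesis using theta_term_pointwise_bound[OF theta_coefficient_bounds(4), of n u]
        by linarith
    qed
    have "xi_kernel u \<le> (\<Sum>n. 48 * exp (u / 2 - exp (2 * u) / 2) * exp (- (1/2) * real n))"
      unfolding xi_kernel_def
      by (intro suminf_le summand summable_theta_terms theta_coefficient_bounds summable_mult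
        summable_exp_neg) auto
    also have "\<dots> = 48 * exp (u / 2 - exp (2 * u) / 2) * S"
      unfolding S_def by (intro suminf_mult summable_exp_neg) auto
    also have "\<dots> \<le> 48 * exp (B - A * u\<^sup>2) * S"
      using B[OF u] Spos by (intro mult_right_mono mult_left_mono) auto
    also have "\<dots> = 48 * S * exp B * exp (- A * u\<^sup>2)"
      by (simp add: exp_diff exp_minus divide_inverse)
    finally show ?thesis .
  qed
  have "xi_kernel u \<le> 48 * S * exp B * exp (- A * u\<^sup>2)" for u
    using pos[of u] pos[of "-u"] xi_kernel_even[of u] by (cases "u \<ge> 0") auto
  then show ?thesis using Spos by (intro exI[of _ "48 * S * exp B"]) auto
qed

section \<open>Moments and the Laplace transform of the kernel\<close>

lemma integrable_exp_neg_square: "integrable lborel (\<lambda>u::real. exp (- u\<^sup>2))"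
  using gaussian_cos_integral[of "1 / pi" 0] by (simp add: has_bochner_integral_iff)

lemma integrable_xi_kernel_dominated:
  assumes "g \<in> borel_measurable lborel" "\<And>u. 0 \<le> g u" "\<And>u. g u \<le> K * exp (B * u\<^sup>2)"
  shows "integrable lborel (\<lambda>u. xi_kernel u * g u)"
proof -
  obtain C where C: "C > 0" "\<And>u. xi_kernel u \<le> C * exp (- (B + 1) * u\<^sup>2)"
    using xi_kernel_decay[of "B + 1"] by blast
  have K: "K \<ge> 0" using assms(2)[of 0] assms(3)[of 0] by simp
  show ?thesis
  proof (rule Bochner_Integration.integrable_bound)
    show "integrable lborel (\<lambda>u. (C * K) * exp (- u\<^sup>2))"
      by (intro integrable_mult_right integrable_exp_neg_square)
    show "AE u in lborel. norm (xi_kernel u * g u) \<le> norm ((C * K) * exp (- u\<^sup>2))"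
    proof (rule AE_I2)
      fix u
      have "norm (xi_kernel u * g u) = xi_kernel u * g u"
        using xi_kernel_pos[of u] assms(2)[of u] by simp
      also have "\<dots> \<le> (C * exp (- (B + 1) * u\<^sup>2)) * (K * exp (B * u\<^sup>2))"
        using C xi_kernel_pos[of u] assms(2,3)[of u] by (intro mult_mono) auto
      also have "\<dots> = (C * K) * (exp (- (B + 1) * u\<^sup>2) * exp (B * u\<^sup>2))" by (simp only: mult_ac)
      also have "exp (- (B + 1) * u\<^sup>2) * exp (B * u\<^sup>2) = exp (- u\<^sup>2)"
        by (simp add: exp_add[symmetric] algebra_simps)
      finally show "norm (xi_kernel u * g u) \<le> norm ((C * K) * exp (- u\<^sup>2))" using C K by simp
    qed
    show "(\<lambda>u. xi_kernel u * g u) \<in> borel_measurable lborel" using assms(1) by measurable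
  qed
qed

text \<open>Completing the square. The free weight \<open>e\<close> becomes the \<epsilon> in the
  growth bound for \<open>xi_sqrt\<close>.\<close>

lemma abs_mult_le_square: "e > 0 \<Longrightarrow> c * \<bar>u\<bar> \<le> e * c\<^sup>2 + u\<^sup>2 / (4 * e)" for u :: real
proof -
  assume e: "e > 0"
  have "0 \<le> (2 * e * c - \<bar>u\<bar>)\<^sup>2 / (4 * e)" using e by simp
  also have "\<dots> = e * c\<^sup>2 + u\<^sup>2 / (4 * e) - c * \<bar>u\<bar>"
    using e by (simp add: power2_eq_square field_simps)
  finally show ?thesis by simp
qed

lemma integrable_xi_kernel_exp_abs: "integrable lborel (\<lambda>u. xi_kernel u * exp (c * \<bar>u\<bar>))"
proof (rule integrable_xi_kernel_dominated)
  show "exp (c * \<bar>u\<bar>) \<le> exp (1 * c\<^sup>2) * exp (1 / 4 * u\<^sup>2)" for u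
    using abs_mult_le_square[of 1 c u] by (simp add: exp_add[symmetric])
qed auto

lemma norm_exp_mult_le: "norm (exp (z * of_real u)) \<le> exp (norm z * \<bar>u\<bar>)" for z :: complex
proof -
  have "Re (z * of_real u) \<le> norm (z * of_real u)" by (rule complex_Re_le_cmod)
  then show ?thesis by (simp add: norm_mult norm_exp_eq_Re)
qed

text \<open>This is \<open>\<xi>(1/2 + z)\<close>, see \<open>riemann_xi_eq\<close>.\<close>

definition xi_centered :: "complex \<Rightarrow> complex" where
  "xi_centered z = (LBINT u. of_real (xi_kernel u) * exp (z * of_real u))"

definition xi_moment :: "nat \<Rightarrow> real" where
  "xi_moment k = (LBINT u. xi_kernel u * u ^ k)"

lemma xi_kernel_integral_pos:
  assumes "integrable lborel (\<lambda>u. xi_kernel u * g u)" "\<And>u. g u \<ge> 0" "\<And>u. u \<noteq> 0 \<Longrightarrow> g u \<noteq> 0"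
  shows "(LBINT u. xi_kernel u * g u) > 0"
proof -
  have nn: "xi_kernel u * g u \<ge> 0" for u using xi_kernel_pos[of u] assms(2)[of u] by simp
  have "(LBINT u. xi_kernel u * g u) \<noteq> 0"
  proof
    assume "(LBINT u. xi_kernel u * g u) = 0"
    then have "AE u in lborel. xi_kernel u * g u = 0"
      using integral_nonneg_eq_0_iff_AE[OF assms(1)] nn by simp
    moreover have "AE u in lborel. u \<noteq> (0::real)" by (rule AE_lborel_singleton)
    ultimately have "AE u in (lborel :: real measure). \<not> True"
    proof eventually_elim
      case (elim u)
      then show ?case using assms(3)[of u] xi_kernel_pos[of u] by simp
    qed
    then have "emeasure (lborel :: real measure) {u \<in> space lborel. True} = 0"
      by (rule emeasure_eq_0_AE)
    then show False by simp
  qed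
  moreover have "(LBINT u. xi_kernel u * g u) \<ge> 0" using nn by (intro integral_nonneg_AE) auto
  ultimately show ?thesis by simp
qed

lemma power_le_exp_abs: "\<bar>u :: real\<bar> ^ k \<le> fact k * exp \<bar>u\<bar>"
proof -
  have "\<bar>u\<bar> ^ k / fact k \<le> (\<Sum>n. \<bar>u\<bar> ^ n / fact n)"
  proof -
    have "(\<Sum>n\<in>{k}. \<bar>u\<bar> ^ n / fact n) \<le> (\<Sum>n. \<bar>u\<bar> ^ n / fact n)"
      using summable_exp[of "\<bar>u\<bar>"] by (intro sum_le_suminf) (auto simp: divide_inverse mult.commute)
    then show ?thesis by simp
  qed
  also have "\<dots> = exp \<bar>u\<bar>" by (simp add: exp_def divide_inverse mult.commute)
  finally show ?thesis by (simp add: field_simps)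
qed

lemma integrable_xi_kernel_power: "integrable lborel (\<lambda>u. xi_kernel u * u ^ k)"
proof (rule Bochner_Integration.integrable_bound)
  show "integrable lborel (\<lambda>u. fact k * (xi_kernel u * exp (1 * \<bar>u\<bar>)))"
    by (intro integrable_mult_right integrable_xi_kernel_exp_abs)
  show "AE u in lborel. norm (xi_kernel u * u ^ k) \<le> norm (fact k * (xi_kernel u * exp (1 * \<bar>u\<bar>)))"
  proof (rule AE_I2)
    fix u
    have "xi_kernel u * \<bar>u\<bar> ^ k \<le> xi_kernel u * (fact k * exp \<bar>u\<bar>)"
      using xi_kernel_pos[of u] power_le_exp_abs[of u k] by (intro mult_left_mono) auto
    then show "norm (xi_kernel u * u ^ k) \<le> norm (fact k * (xi_kernel u * exp (1 * \<bar>u\<bar>)))"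
      using xi_kernel_pos[of u] by (simp add: abs_mult power_abs mult_ac)
  qed
qed auto

lemma xi_moment_even_pos: "xi_moment (2 * m) > 0"
  unfolding xi_moment_def
  by (rule xi_kernel_integral_pos[OF integrable_xi_kernel_power]) (auto simp: power_mult)

lemma xi_moment_odd: "odd k \<Longrightarrow> xi_moment k = 0"
proof -
  assume "odd k"
  have "xi_moment k = \<bar>-1\<bar> *\<^sub>R (LBINT u. xi_kernel (0 + (-1) * u) * (0 + (-1) * u) ^ k)"
    unfolding xi_moment_def by (rule lborel_integral_real_affine) simp
  also have "\<dots> = (LBINT u. - (xi_kernel u * u ^ k))"
    using \<open>odd k\<close> by (simp add: xi_kernel_even power_minus_odd)
  also have "\<dots> = - xi_moment k" by (simp add: xi_moment_def)
  finally show ?thesis by simp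
qed

text \<open>Termwise integration of the exponential series;
  \<open>xi_kernel u * exp (norm z * |u|)\<close> dominates all partial sums.\<close>

lemma xi_centered_sums_moments: "(\<lambda>k. of_real (xi_moment k) / fact k * z ^ k) sums xi_centered z"
proof -
  define s where "s N u = (\<Sum>k<N. of_real (xi_kernel u) * ((z * of_real u) ^ k / fact k))"
    for N and u :: real
  have bound: "norm (of_real (xi_kernel u) * ((z * of_real u) ^ k / fact k))
    = xi_kernel u * (norm (z * of_real u) ^ k / fact k)" for k u
    using xi_kernel_pos[of u] by (simp add: norm_mult norm_divide norm_power)
  have dom: "norm (s N u) \<le> xi_kernel u * exp (norm z * \<bar>u\<bar>)" for N u
  proof -
    have "norm (s N u) \<le> (\<Sum>k<N. xi_kernel u * (norm (z * of_real u) ^ k / fact k))"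
      unfolding s_def by (rule order_trans[OF norm_sum]) (simp only: bound order_refl)
    also have "\<dots> = xi_kernel u * (\<Sum>k<N. norm (z * of_real u) ^ k / fact k)"
      by (simp add: sum_distrib_left)
    also have "(\<Sum>k<N. norm (z * of_real u) ^ k / fact k) \<le> (\<Sum>k. norm (z * of_real u) ^ k / fact k)"
      using summable_exp[of "norm (z * of_real u)"]
        by (intro sum_le_suminf) (auto simp: divide_inverse mult.commute)
    also have "\<dots> = exp (norm z * \<bar>u\<bar>)" by (simp add: exp_def divide_inverse mult.commute norm_mult)
    finally show ?thesis using xi_kernel_pos[of u] by (simp add: mult_left_mono)
  qed
  have lim: "(\<lambda>N. integral\<^sup>L lborel (s N)) \<longlonglongrightarrow> (LBINT u. of_real (xi_kernel u) * exp (z * of_real u))"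
  proof (rule integral_dominated_convergence[where w = "\<lambda>u. xi_kernel u * exp (norm z * \<bar>u\<bar>)"])
    show "integrable lborel (\<lambda>u. xi_kernel u * exp (norm z * \<bar>u\<bar>))"
      by (rule integrable_xi_kernel_exp_abs)
    show "AE u in lborel. (\<lambda>N. s N u) \<longlonglongrightarrow> of_real (xi_kernel u) * exp (z * of_real u)"
    proof (rule AE_I2)
      fix u
      have "(\<lambda>k. (z * of_real u) ^ k / fact k) sums exp (z * of_real u)"
        using exp_converges[of "z * of_real u"]
          by (simp add: scaleR_conv_of_real divide_inverse mult.commute)
      then show "(\<lambda>N. s N u) \<longlonglongrightarrow> of_real (xi_kernel u) * exp (z * of_real u)"
        unfolding s_def sums_def[symmetric] by (rule sums_mult)
    qed
    show "s N \<in> borel_measurable lborel" for N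
      unfolding s_def[abs_def] by measurable
  qed (use dom in auto)
  have int: "integrable lborel (\<lambda>u. complex_of_real (xi_kernel u) * ((z * of_real u) ^ k / fact k))"
    for k
  proof -
    have "integrable lborel (\<lambda>u. (z ^ k / fact k) * complex_of_real (xi_kernel u * u ^ k))"
      by (intro integrable_mult_right integrable_of_real integrable_xi_kernel_power)
    then show ?thesis by (simp add: power_mult_distrib mult_ac)
  qed
  have "integral\<^sup>L lborel (s N) = (\<Sum>k<N. of_real (xi_moment k) / fact k * z ^ k)" for N
  proof -
    have "integral\<^sup>L lborel (s N)
      = (\<Sum>k<N. LBINT u. complex_of_real (xi_kernel u) * ((z * of_real u) ^ k / fact k))"
      unfolding s_def by (rule Bochner_Integration.integral_sum) (rule int)
    also have "\<dots> = (\<Sum>k<N. (z ^ k / fact k) * of_real (xi_moment k))"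
    proof (rule sum.cong[OF refl])
      fix k
      have "(LBINT u. complex_of_real (xi_kernel u) * ((z * of_real u) ^ k / fact k))
        = (LBINT u. (z ^ k / fact k) * complex_of_real (xi_kernel u * u ^ k))"
        by (simp add: power_mult_distrib mult_ac)
      also have "\<dots> = (z ^ k / fact k) * (LBINT u. complex_of_real (xi_kernel u * u ^ k))"
        by (rule integral_mult_right_zero)
      also have "(LBINT u. complex_of_real (xi_kernel u * u ^ k)) = of_real (xi_moment k)"
        unfolding xi_moment_def by (rule integral_complex_of_real)
      finally show "(LBINT u. complex_of_real (xi_kernel u) * ((z * of_real u) ^ k / fact k))
        = (z ^ k / fact k) * of_real (xi_moment k)" .
    qed
    finally show ?thesis by (simp add: mult.commute)
  qed
  with lim show ?thesis by (simp add: sums_def xi_centered_def)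
qed

text \<open>The entire function \<open>F\<close> with \<open>F(z\<^sup>2) = \<xi>(1/2 + z)\<close>.\<close>

definition xi_sqrt_fps :: "complex fps" where
  "xi_sqrt_fps = Abs_fps (\<lambda>m. of_real (xi_moment (2 * m)) / fact (2 * m))"

definition xi_sqrt :: "complex \<Rightarrow> complex" where
  "xi_sqrt = eval_fps xi_sqrt_fps"

lemma xi_sqrt_sums_xi_centered: "(\<lambda>m. of_real (xi_moment (2 * m)) / fact (2 * m) * (z\<^sup>2) ^ m)
  sums xi_centered z"
proof -
  have "(\<lambda>m. of_real (xi_moment (2 * m)) / fact (2 * m) * z ^ (2 * m)) sums xi_centered z"
  proof (subst sums_mono_reindex[of "\<lambda>m. 2 * m" "\<lambda>k. of_real (xi_moment k) / fact k * z ^ k"])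
    show "strict_mono (\<lambda>m::nat. 2 * m)" by (simp add: strict_mono_def)
    show "of_real (xi_moment k) / fact k * z ^ k = 0" if "k \<notin> range (\<lambda>m. 2 * m)" for k
    proof -
      have "odd k" using that by (auto elim!: evenE)
      then show ?thesis by (simp add: xi_moment_odd)
    qed
    show "(\<lambda>k. of_real (xi_moment k) / fact k * z ^ k) sums xi_centered z"
      by (rule xi_centered_sums_moments)
  qed
  then show ?thesis by (simp add: power_mult)
qed

lemma xi_sqrt_square: "xi_sqrt (z\<^sup>2) = xi_centered z"
  using xi_sqrt_sums_xi_centered[of z]
    by (simp add: xi_sqrt_def eval_fps_def xi_sqrt_fps_def sums_iff)

lemma xi_sqrt_sums: "(\<lambda>m. of_real (xi_moment (2 * m)) / fact (2 * m) * w ^ m) sums xi_sqrt w"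
  using xi_sqrt_sums_xi_centered[of "csqrt w"] xi_sqrt_square[of "csqrt w"] by simp

lemma fps_conv_radius_xi_sqrt: "fps_conv_radius xi_sqrt_fps = \<infinity>"
  unfolding fps_conv_radius_def
proof (rule conv_radius_inftyI'')
  show "summable (\<lambda>n. fps_nth xi_sqrt_fps n * z ^ n)" for z
    using xi_sqrt_sums[of z] by (simp add: xi_sqrt_fps_def sums_iff)
qed

lemma xi_sqrt_holomorphic: "xi_sqrt holomorphic_on UNIV"
  unfolding xi_sqrt_def by (rule holomorphic_on_eval_fps) (simp add: fps_conv_radius_xi_sqrt)

lemma higher_deriv_xi_sqrt: "(deriv ^^ m) xi_sqrt 0
  = fact m / fact (2 * m) * of_real (xi_moment (2 * m))"
proof -
  have "xi_sqrt has_fps_expansion xi_sqrt_fps"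
    unfolding has_fps_expansion_def by (simp add: fps_conv_radius_xi_sqrt xi_sqrt_def)
  then have "fps_nth xi_sqrt_fps m = (deriv ^^ m) xi_sqrt 0 / fact m"
    by (rule fps_nth_fps_expansion)
  then show ?thesis by (simp add: xi_sqrt_fps_def field_simps)
qed

lemma xi_centered_holomorphic: "xi_centered holomorphic_on UNIV"
proof -
  have "(xi_sqrt \<circ> (\<lambda>z. z\<^sup>2)) holomorphic_on UNIV"
    by (rule holomorphic_on_compose_gen[OF _ xi_sqrt_holomorphic]) (auto intro!: holomorphic_intros)
  then show ?thesis by (simp add: o_def xi_sqrt_square)
qed

lemma higher_deriv_xi_centered: "(deriv ^^ k) xi_centered 0 = of_real (xi_moment k)"
proof -
  have "xi_centered has_fps_expansion Abs_fps (\<lambda>k. of_real (xi_moment k) / fact k)"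
    by (rule has_fps_expansionI, rule always_eventually) (use xi_centered_sums_moments in simp)
  then have "fps_nth (Abs_fps (\<lambda>k. of_real (xi_moment k) / fact k)) k
    = (deriv ^^ k) xi_centered 0 / fact k" by (rule fps_nth_fps_expansion)
  then show ?thesis by (simp add: field_simps)
qed

text \<open>A positive kernel has a positive transform at real arguments. This decides between
  \<open>z\<close> real and \<open>z\<close> imaginary at a zero where \<open>z^2\<close> is
  real.\<close>

lemma xi_centered_real_pos: "\<exists>r>0. xi_centered (of_real x) = of_real r"
proof (intro exI conjI)
  have "integrable lborel (\<lambda>u. xi_kernel u * exp (x * u))"
  proof (rule Bochner_Integration.integrable_bound[OF integrable_xi_kernel_exp_abs[of "\<bar>x\<bar>"]])
    show "AE u in lborel. norm (xi_kernel u * exp (x * u)) \<le> norm (xi_kernel u * exp (\<bar>x\<bar> * \<bar>u\<bar>))"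
    proof (rule AE_I2)
      fix u
      have "x * u \<le> \<bar>x\<bar> * \<bar>u\<bar>" by (simp add: abs_mult[symmetric])
      then show "norm (xi_kernel u * exp (x * u)) \<le> norm (xi_kernel u * exp (\<bar>x\<bar> * \<bar>u\<bar>))"
        using xi_kernel_pos[of u] by (simp add: mult_left_mono)
    qed
  qed auto
  then show "(LBINT u. xi_kernel u * exp (x * u)) > 0"
    by (rule xi_kernel_integral_pos) auto
  have "xi_centered (of_real x) = (LBINT u. complex_of_real (xi_kernel u * exp (x * u)))"
    unfolding xi_centered_def by (simp add: exp_of_real[symmetric])
  then show "xi_centered (of_real x) = of_real (LBINT u. xi_kernel u * exp (x * u))"
    by (simp only: integral_complex_of_real)
qed

lemma xi_sqrt_0: "xi_sqrt 0 \<noteq> 0"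
  using xi_sqrt_square[of 0] xi_centered_real_pos[of 0] by auto

text \<open>For \<open>z^2 = w\<close> the exponent \<open>norm z * |u|\<close> is at most
  \<open>\<epsilon> * norm w + u^2 / (4 * \<epsilon>)\<close>, and
  \<open>exp (u^2 / (4 * \<epsilon>))\<close> is integrable against the kernel for every
  \<epsilon>.\<close>

lemma xi_sqrt_growth:
  assumes "\<epsilon> > 0"
  shows "\<exists>C. \<forall>w. norm (xi_sqrt w) \<le> C * exp (\<epsilon> * norm w)"
proof (intro exI allI)
  fix w
  define z where "z = csqrt w"
  have w: "w = z\<^sup>2" "norm w = (norm z)\<^sup>2" by (simp_all add: z_def norm_power[symmetric])
  have int: "integrable lborel (\<lambda>u. xi_kernel u * exp (1 / (4 * \<epsilon>) * u\<^sup>2))"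
    by (rule integrable_xi_kernel_dominated[where K = 1 and B = "1 / (4 * \<epsilon>)"]) auto
  have "norm (xi_sqrt w) \<le> (LBINT u. exp (\<epsilon> * norm w) * (xi_kernel u * exp (1 / (4 * \<epsilon>) * u\<^sup>2)))"
    unfolding w(1) xi_sqrt_square xi_centered_def
  proof (rule order_trans[OF integral_norm_bound], rule integral_mono)
    show "integrable lborel (\<lambda>u. norm (complex_of_real (xi_kernel u) * exp (z * of_real u)))"
    proof (rule Bochner_Integration.integrable_bound[OF integrable_xi_kernel_exp_abs[of "norm z"]])
      show "AE u in lborel. norm (norm (complex_of_real (xi_kernel u) * exp (z * of_real u)))
        \<le> norm (xi_kernel u * exp (norm z * \<bar>u\<bar>))"
        using xi_kernel_pos norm_exp_mult_le
          by (intro AE_I2) (simp add: norm_mult mult_left_mono less_imp_le)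
    qed auto
    show "integrable lborel (\<lambda>u. exp (\<epsilon> * norm (z\<^sup>2)) * (xi_kernel u * exp (1 / (4 * \<epsilon>) * u\<^sup>2)))"
      using int by (rule integrable_mult_right)
    fix u
    have "norm (complex_of_real (xi_kernel u) * exp (z * of_real u))
      \<le> xi_kernel u * exp (norm z * \<bar>u\<bar>)"
      using xi_kernel_pos[of u] norm_exp_mult_le[of z u] by (simp add: norm_mult mult_left_mono)
    also have "\<dots> \<le> xi_kernel u * exp (\<epsilon> * (norm z)\<^sup>2 + u\<^sup>2 / (4 * \<epsilon>))"
      using xi_kernel_pos[of u] abs_mult_le_square[OF assms, of "norm z" u]
        by (intro mult_left_mono) auto
    finally show "norm (complex_of_real (xi_kernel u) * exp (z * of_real u))
      \<le> exp (\<epsilon> * norm (z\<^sup>2)) * (xi_kernel u * exp (1 / (4 * \<epsilon>) * u\<^sup>2))"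
      by (simp add: exp_add norm_power mult_ac)
  qed
  also have "\<dots> = (LBINT u. xi_kernel u * exp (1 / (4 * \<epsilon>) * u\<^sup>2)) * exp (\<epsilon> * norm w)"
    by (simp add: mult.commute)
  finally show "norm (xi_sqrt w) \<le> (LBINT u. xi_kernel u * exp (1 / (4 * \<epsilon>) * u\<^sup>2))
    * exp (\<epsilon> * norm w)" .
qed

section \<open>The zeta and xi functions\<close>

text \<open>Euler's integral after \<open>t = exp v\<close>. In this variable the scaling of
  \<open>t\<close> that each term of the zeta series needs becomes a translation.\<close>

lemma Gamma_exp_integral:
  assumes "Re s > 0"
  shows "has_bochner_integral lborel (\<lambda>v. exp (s * of_real v) * of_real (exp (- exp v))) (Gamma s)"
proof -
  define f where "f t = complex_of_real t powr (s - 1) / of_real (exp t)" for t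
  have range: "exp ` (UNIV :: real set) = {0<..}"
  proof safe
    fix x :: real assume "x > 0"
    then show "x \<in> range exp" by (intro image_eqI[of _ _ "ln x"]) auto
  qed simp
  have f: "f absolutely_integrable_on {0<..}" "integral {0<..} f = Gamma s"
    unfolding f_def using absolutely_integrable_Gamma_integral'[OF assms]
      Gamma_integral_complex'[OF assms]
    by (auto intro: integral_unique)
  have "(\<lambda>v. \<bar>exp v\<bar> *\<^sub>R f (exp v)) absolutely_integrable_on UNIV \<and> integral UNIV
    (\<lambda>v. \<bar>exp v\<bar> *\<^sub>R f (exp v)) = Gamma s"
    by (subst has_absolute_integral_change_of_variables_real[where g = exp])
      (auto simp: range f inj_on_def intro!: derivative_eq_intros)
  moreover have eq: "\<bar>exp v\<bar> *\<^sub>R f (exp v) = exp (s * of_real v) * of_real (exp (- exp v))"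
    for v :: real
  proof -
    have "complex_of_real (exp v) powr (s - 1) = exp ((s - 1) * of_real v)"
      by (simp add: powr_def Ln_of_real del: of_real_exp)
    then have "\<bar>exp v\<bar> *\<^sub>R f (exp v)
      = of_real (exp v) * exp ((s - 1) * of_real v) * of_real (exp (- exp v))"
      by (simp add: f_def scaleR_conv_of_real exp_minus divide_inverse)
    also have "of_real (exp v) * exp ((s - 1) * of_real v) = exp (s * of_real v)"
      by (simp add: exp_of_real[symmetric] exp_add[symmetric] algebra_simps)
    finally show ?thesis .
  qed
  ultimately have *: "(\<lambda>v. exp (s * of_real v) * of_real
    (exp (- exp v))) absolutely_integrable_on UNIV"
    "integral UNIV (\<lambda>v. exp (s * of_real v) * of_real (exp (- exp v))) = Gamma s" by simp_all
  have int: "integrable lborel (\<lambda>v. exp (s * of_real v) * of_real (exp (- exp v)))"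
    using *(1) by (simp add: set_integrable_def integrable_completion)
  then show ?thesis
    using *(2) integral_lborel[OF int] by (simp add: has_bochner_integral_iff)
qed

lemma summable_abs_theta_terms:
  assumes "\<And>n. \<bar>p n\<bar> \<le> 6 * (1 + theta_exponent n u + (theta_exponent n u)\<^sup>2)"
  shows "summable (\<lambda>n. \<bar>p n * exp (u / 2 - theta_exponent n u)\<bar>)"
proof (rule summable_comparison_test'[OF summable_theta_bound[of "48 * exp (\<bar>u\<bar> / 2)" "\<bar>u\<bar>"]])
  show "norm \<bar>p n * exp (u / 2 - theta_exponent n u)\<bar>
    \<le> 48 * exp (\<bar>u\<bar> / 2) * exp (- (pi / 2 * exp (- 2 * \<bar>u\<bar>)) * real n)" for n
  proof -
    have "u \<in> {-\<bar>u\<bar>..\<bar>u\<bar>}" by auto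
    from theta_term_bound[OF assms[of n] this] show ?thesis by simp
  qed
qed

text \<open>Every term of the kernel series integrates to one fixed Gamma integral times a power of
  \<open>n + 1\<close>. The quadratic \<open>4 X^2 - 6 X\<close> yields
  \<open>2 Gamma (s/2 + 2) - 3 Gamma (s/2 + 1)\<close>, which is
  \<open>s (s - 1) / 2 * Gamma (s/2)\<close>: the polynomial factor of xi.\<close>

theorem xi_centered_eq_zeta_series:
  assumes s: "Re s > 1"
  shows "xi_centered (s - 1/2) = 1/2 * s * (s - 1) * of_real pi powr (- s / 2) * Gamma (s / 2)
    * (\<Sum>n. 1 / of_nat (Suc n) powr s)"
proof -
  define \<phi> where "\<phi> v = 2 * (exp ((s / 2 + 2) * of_real v) * of_real (exp (- exp v)))
    - 3 * (exp ((s / 2 + 1) * of_real v) * of_real (exp (- exp v)))" for v :: real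
  define L where "L n = ln (pi * (real (Suc n))\<^sup>2)" for n
  define T where "T n u = complex_of_real ((4 * (theta_exponent n u)\<^sup>2
    - 6 * theta_exponent n u) * exp (u / 2 - theta_exponent n u)) * exp ((s
    - 1/2) * of_real u)" for n u
  define I where "I = 1/2 * s * (s - 1) * Gamma (s / 2)"
  have \<phi>: "has_bochner_integral lborel \<phi> I"
  proof -
    have "has_bochner_integral lborel \<phi> (2 * Gamma (s / 2 + 2) - 3 * Gamma (s / 2 + 1))"
      unfolding \<phi>_def using s by
        (intro has_bochner_integral_diff has_bochner_integral_mult_right Gamma_exp_integral) auto
    moreover have "2 * Gamma (s / 2 + 2) - 3 * Gamma (s / 2 + 1) = I"
    proof -
      have nz: "s / 2 \<notin> \<int>\<^sub>\<le>\<^sub>0" "s / 2 + 1 \<notin> \<int>\<^sub>\<le>\<^sub>0"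
        using s by (auto elim!: nonpos_Ints_cases simp: complex_eq_iff)
      have "Gamma (s / 2 + 1) = s / 2 * Gamma (s / 2)" using nz by (intro Gamma_plus1)
      moreover have "Gamma (s / 2 + 2) = (s / 2 + 1) * Gamma (s / 2 + 1)"
        using Gamma_plus1[OF nz(2)] by (simp add: add.assoc)
      ultimately show ?thesis by (simp add: I_def field_simps)
    qed
    ultimately show ?thesis by simp
  qed
  have X: "theta_exponent n u = exp (L n + 2 * u)" for n u
    by (simp add: L_def theta_exponent_def exp_add)
  \<comment> \<open>Substituting \<open>v = L n + 2 u\<close> makes every term a multiple of one integral.\<close>
  have T: "T n u = (2 * exp (- s * of_real (L n) / 2)) * \<phi> (L n + 2 * u)" for n u
  proof -
    let ?v = "L n + 2 * u" and ?e = "complex_of_real (exp (- exp (L n + 2 * u)))"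
    have 1: "exp ((s / 2 + 2) * of_real ?v)
      = (of_real (theta_exponent n u))\<^sup>2 * exp (s / 2 * of_real ?v)"
      unfolding X by (simp add: exp_of_real[symmetric] exp_add[symmetric] exp_double[symmetric]
        algebra_simps)
    have 2: "exp ((s / 2 + 1) * of_real ?v)
      = of_real (theta_exponent n u) * exp (s / 2 * of_real ?v)"
      unfolding X by (simp add: exp_of_real[symmetric] exp_add[symmetric] algebra_simps)
    have 3: "exp (- s * of_real (L n) / 2) * exp (s / 2 * of_real ?v) = exp (s * of_real u)"
      by (simp add: exp_add[symmetric] field_simps)
    have 4: "complex_of_real (exp (u / 2 - theta_exponent n u)) * exp ((s - 1/2) * of_real u)
      = of_real (exp (- theta_exponent n u)) * exp (s * of_real u)"
      by (simp add: exp_of_real[symmetric] exp_add[symmetric] algebra_simps)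
    have ph: "\<phi> ?v = 2 * ((of_real (theta_exponent n u))\<^sup>2 * exp (s / 2 * of_real ?v)
      * of_real (exp (- theta_exponent n u)))
        - 3 * (of_real (theta_exponent n u) * exp (s / 2 * of_real ?v) * of_real
          (exp (- theta_exponent n u)))"
      unfolding \<phi>_def 1 2 X ..
    have gen: "2 * k * (2 * (x\<^sup>2 * E * e) - 3 * (x * E * e)) = (4 * x\<^sup>2 - 6 * x) * e * (k * E)"
      for x E e k :: complex
      by (simp add: algebra_simps)
    have "(2 * exp (- s * of_real (L n) / 2)) * \<phi> ?v
      = (4 * (of_real (theta_exponent n u))\<^sup>2 - 6 * of_real (theta_exponent n u))
      * of_real (exp (- theta_exponent n u)) * (exp (- s * of_real (L n) / 2)
      * exp (s / 2 * of_real ?v))"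
      unfolding ph by (rule gen)
    also have "\<dots> = T n u"
      unfolding 3 T_def using 4 by (simp add: mult.assoc del: of_real_exp)
    finally show ?thesis ..
  qed
  \<comment> \<open>The factor 2 in \<open>T\<close> cancels against the Jacobian 1/2 of the
    substitution.\<close>
  have hbT: "has_bochner_integral lborel (T n) (exp (- s * of_real (L n) / 2) * I)" for n
  proof -
    have "has_bochner_integral lborel (\<lambda>u. \<phi> (L n + 2 * u)) (I /\<^sub>R \<bar>2\<bar>)"
      using \<phi> lborel_has_bochner_integral_real_affine_iff[of 2 \<phi> I "L n"] by simp
    then have "has_bochner_integral lborel (\<lambda>u. (2 * exp (- s * of_real (L n) / 2)) * \<phi> (L n
      + 2 * u)) ((2 * exp (- s * of_real (L n) / 2)) * (I /\<^sub>R \<bar>2\<bar>))"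
      by (rule has_bochner_integral_mult_right)
    moreover have "T n = (\<lambda>u. (2 * exp (- s * of_real (L n) / 2)) * \<phi> (L n + 2 * u))"
      by (rule ext) (rule T)
    ultimately show ?thesis by (simp add: scaleR_conv_of_real)
  qed
  have L: "exp (c * of_real (L n) / 2)
    = exp (c / 2 * of_real (ln pi)) * exp (c * of_real (ln (real (Suc n))))" for n and c :: complex
  proof -
    have "L n = ln pi + 2 * ln (real (Suc n))" by (simp add: L_def ln_mult ln_realpow)
    then show ?thesis by (simp add: exp_add[symmetric] field_simps del: of_nat_Suc)
  qed
  have "norm (T n u) = (2 * norm (exp (- s * of_real (L n) / 2))) * norm (\<phi> (L n + 2 * u))" for n u
    unfolding T by (simp add: norm_mult)
  then have normT: "(LBINT u. norm (T n u))
    = norm (exp (- s * of_real (L n) / 2)) * (LBINT v. norm (\<phi> v))" for n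
    using lborel_integral_real_affine[of 2 "\<lambda>v. norm (\<phi> v)" "L n"] by simp
  \<comment> \<open>The integrals of the norms decay like \<open>n + 1\<close> to the power
    \<open>- Re s\<close>; here \<open>Re s > 1\<close> permits exchanging sum and integral.\<close>
  have "norm (exp (- s * of_real (L n) / 2))
    = exp (- (Re s / 2) * ln pi) * real (Suc n) powr (- Re s)" for n
    unfolding L norm_mult norm_exp_eq_Re by (simp add: powr_def)
  then have summT: "summable (\<lambda>n. LBINT u. norm (T n u))"
    unfolding normT using s
    by (simp only:) (intro summable_mult summable_mult2, subst summable_Suc_iff, simp
      add: summable_real_powr_iff)
  have sumT: "(\<Sum>n. T n u) = of_real (xi_kernel u) * exp ((s - 1/2) * of_real u)" for u
  proof -
    have s1: "summable (\<lambda>n. (4 * (theta_exponent n u)\<^sup>2 - 6 * theta_exponent n u) * exp (u / 2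
      - theta_exponent n u))"
      by (rule summable_theta_terms[OF theta_coefficient_bounds(4)])
    have "(\<Sum>n. T n u) = (\<Sum>n. complex_of_real ((4 * (theta_exponent n u)\<^sup>2
      - 6 * theta_exponent n u) * exp (u / 2 - theta_exponent n u))) * exp ((s - 1/2) * of_real u)"
      unfolding T_def by (rule suminf_mult2[OF summable_of_real[OF s1], symmetric])
    then show ?thesis unfolding xi_kernel_def suminf_of_real[OF s1] .
  qed
  have "xi_centered (s - 1/2) = (LBINT u. (\<Sum>n. T n u))" unfolding xi_centered_def sumT ..
  also have "\<dots> = (\<Sum>n. integral\<^sup>L lborel (T n))"
  proof (rule integral_suminf)
    show "integrable lborel (T n)" for n using hbT by (rule integrable.intros)
    show "AE u in lborel. summable (\<lambda>n. norm (T n u))"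
    proof (rule AE_I2)
      fix u
      have "norm (T n u) = \<bar>(4 * (theta_exponent n u)\<^sup>2 - 6 * theta_exponent n u) * exp (u / 2
        - theta_exponent n u)\<bar> * norm (exp ((s - 1/2) * of_real u))" for n
        unfolding T_def norm_mult norm_of_real ..
      then show "summable (\<lambda>n. norm (T n u))"
        using summable_mult2[OF summable_abs_theta_terms[OF theta_coefficient_bounds(4)]] by simp
    qed
  qed (rule summT)
  also have "\<dots> = (\<Sum>n. I * of_real pi powr (- s / 2) * (1 / of_nat (Suc n) powr s))"
  proof (rule suminf_cong)
    fix n
    have "integral\<^sup>L lborel (T n) = exp (- s * of_real (L n) / 2) * I"
      using hbT by (rule has_bochner_integral_integral_eq)
    also have "exp (- s * of_real (L n) / 2)
      = of_real pi powr (- s / 2) * (1 / of_nat (Suc n) powr s)"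
    proof -
      have p1: "complex_of_real pi powr (- s / 2) = exp (- s / 2 * of_real (ln pi))"
        by (simp add: powr_def Ln_of_real)
      have p2: "complex_of_nat (Suc n) powr s = exp (s * of_real (ln (real (Suc n))))"
        using Ln_of_real[of "real (Suc n)"] by (simp add: powr_def del: of_nat_Suc)
      have "exp (- s * x) = 1 / exp (s * x)" for x by (simp add: exp_minus divide_inverse)
      then show ?thesis unfolding L p1 p2 by (simp only:)
    qed
    finally show "integral\<^sup>L lborel (T n)
      = I * of_real pi powr (- s / 2) * (1 / of_nat (Suc n) powr s)"
      by (simp only: mult_ac)
  qed
  also have "\<dots> = I * of_real pi powr (- s / 2) * (\<Sum>n. 1 / of_nat (Suc n) powr s)"
  proof (rule suminf_mult)
    have "norm (1 / complex_of_nat (Suc n) powr s) = real (Suc n) powr (- Re s)" for n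
      using norm_powr_real_powr[of "complex_of_nat (Suc n)" s]
      by (simp add: norm_divide norm_inverse powr_minus divide_inverse del: of_nat_Suc)
    moreover have "summable (\<lambda>n. real (Suc n) powr (- Re s))"
      using s by (subst summable_Suc_iff) (simp add: summable_real_powr_iff)
    ultimately show "summable (\<lambda>n. 1 / complex_of_nat (Suc n) powr s)"
      by (intro summable_norm_cancel[of "\<lambda>n. 1 / complex_of_nat (Suc n) powr s"]) simp
  qed
  finally show ?thesis by (simp add: I_def mult_ac)
qed

section \<open>Closed forms of zeta and xi\<close>

lemma Gamma_half_shift:
  fixes s :: complex
  assumes "s / 2 \<notin> \<int>\<^sub>\<le>\<^sub>0"
  shows "s * Gamma (s / 2) * rGamma (s / 2 + 1) = 2"
proof -
  have "s \<noteq> 0" using assms by auto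
  have "Gamma (s / 2 + 1) = s / 2 * Gamma (s / 2)" using assms by (rule Gamma_plus1)
  moreover have "Gamma (s / 2) \<noteq> 0" using assms by (simp add: Gamma_eq_zero_iff)
  moreover have "s * g * inverse (s / 2 * g) = 2" if "g \<noteq> 0" for g using that \<open>s \<noteq> 0\<close>
    by (simp add: field_simps)
  ultimately show ?thesis by (simp only: rGamma_inverse_Gamma not_False_eq_True)
qed

lemma pi_powr_cancel: "complex_of_real pi powr (- s / 2) * of_real pi powr (s / 2) = 1"
  by (simp add: powr_add[symmetric])

text \<open>Writing \<open>rGamma (s / 2 + 1)\<close> for \<open>2 / (s * Gamma (s / 2))\<close>
  makes the formula holomorphic off 1, so it is a witness for the description defining
  \<open>riemann_zeta\<close>; the identity theorem on the connected punctured plane gives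
  uniqueness. The zeros of this factor are the trivial zeros.\<close>

lemma riemann_zeta_eq:
  "riemann_zeta s = (if s = 1 then 0 else xi_centered (s - 1/2) * of_real pi powr (s / 2)
    * rGamma (s / 2 + 1) / (s - 1))"
proof -
  define Z where "Z s = (if s = 1 then 0 else xi_centered (s - 1/2) * of_real pi powr (s / 2)
    * rGamma (s / 2 + 1) / (s - 1))" for s
  have Z_hol: "Z holomorphic_on - {1}"
  proof -
    have "(xi_centered \<circ> (\<lambda>s. s - 1/2)) holomorphic_on - {1}"
      by (rule holomorphic_on_compose_gen[OF _ xi_centered_holomorphic])
        (auto intro!: holomorphic_intros)
    then have "(\<lambda>s. xi_centered (s - 1/2)) holomorphic_on - {1}" by (simp add: o_def)
    then have "(\<lambda>s. xi_centered (s - 1/2) * of_real pi powr (s / 2) * rGamma (s / 2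
      + 1) / (s - 1)) holomorphic_on - {1}"
      by (intro holomorphic_intros) auto
    then show ?thesis by (rule holomorphic_transform) (simp add: Z_def)
  qed
  have Z_series: "Z s = (\<Sum>n. 1 / of_nat (Suc n) powr s)" if s: "Re s > 1" for s
  proof -
    let ?S = "\<Sum>n. 1 / of_nat (Suc n) powr s"
    have "s / 2 \<notin> \<int>\<^sub>\<le>\<^sub>0" using s by (auto elim!: nonpos_Ints_cases simp: complex_eq_iff)
    note G = Gamma_half_shift[OF this]
    have "s \<noteq> 1" using s by auto
    have "Z s = 1/2 * (s * Gamma (s / 2) * rGamma (s / 2 + 1)) * (of_real pi powr (- s / 2)
      * of_real pi powr (s / 2)) * ?S"
    proof -
      have "(1/2 * s * k * p * g * S) * q * r / k = 1/2 * (s * g * r) * (p * q) * S"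
        if "k \<noteq> 0" for k p g q r S :: complex
        using that by simp
      then show ?thesis using \<open>s \<noteq> 1\<close> unfolding Z_def xi_centered_eq_zeta_series[OF s]
        by (simp only: if_False right_minus_eq not_False_eq_True)
    qed
    then show ?thesis unfolding G pi_powr_cancel by simp
  qed
  have "riemann_zeta = Z"
    unfolding riemann_zeta_def
  proof (rule the_equality)
    show "Z holomorphic_on - {1} \<and> Z 1 = 0 \<and> (\<forall>s. 1 < Re s \<longrightarrow> Z s = (\<Sum>n. 1 / of_nat (Suc n) powr s))"
      using Z_hol Z_series by (simp add: Z_def)
    fix f assume f: "f holomorphic_on - {1} \<and> f 1 = 0 \<and> (\<forall>s. 1 < Re s \<longrightarrow> f s
      = (\<Sum>n. 1 / of_nat (Suc n) powr s))"
    show "f = Z"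
    proof
      fix s
      show "f s = Z s"
      proof (cases "s = 1")
        case False
        show ?thesis
        proof (rule analytic_continuation_open[of "{s. Re s > 1}" "- {1}" f Z])
          show "open {s. Re s > 1}" by (rule open_halfspace_Re_gt)
          have "2 \<in> {s. Re s > 1}" by simp
          then show "{s. Re s > 1} \<noteq> {}" by blast
          show "connected (- {1 :: complex})" by (rule connected_punctured_universe) simp
        qed (use f Z_hol Z_series False in auto)
      qed (use f in \<open>simp add: Z_def\<close>)
    qed
  qed
  then have "riemann_zeta s = Z s" by simp
  then show ?thesis unfolding Z_def .
qed

lemma riemann_xi_eq: "riemann_xi = (\<lambda>s. xi_centered (s - 1/2))"
proof
  fix s :: complex
  let ?g = "\<lambda>s. 1/2 * s * (s - 1) * of_real pi powr (- s / 2) * Gamma (s / 2) * riemann_zeta s"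
  \<comment> \<open>Poles of \<open>Gamma (t / 2)\<close> are zeros of a non-constant entire
    function, hence isolated: close to \<open>s\<close>, dummy values can occur only at
    \<open>s\<close> itself, which \<open>remove_sings\<close> ignores.\<close>
  have "\<forall>\<^sub>F t in at s. rGamma (t / 2) \<noteq> 0 \<and> t \<in> UNIV"
    by (rule non_zero_neighbour_alt[of _ _ _ 2]) (auto intro!: holomorphic_intros)
  moreover have "\<forall>\<^sub>F t in at s. t \<noteq> 1"
    by (cases "s = 1") (auto simp: eventually_at_filter intro: eventually_mono[OF t1_space_nhds])
  ultimately have "\<forall>\<^sub>F t in at s. ?g t = xi_centered (t - 1/2)"
  proof eventually_elim
    case (elim t)
    then have "t / 2 \<notin> \<int>\<^sub>\<le>\<^sub>0" by (simp add: rGamma_eq_zero_iff)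
    note G = Gamma_half_shift[OF this]
    have "?g t = 1/2 * (t * Gamma (t / 2) * rGamma (t / 2 + 1)) * (of_real pi powr (- t / 2)
      * of_real pi powr (t / 2)) * xi_centered (t - 1/2)"
    proof -
      have "(1/2 * t * k * p * g) * (X * q * r / k) = 1/2 * (t * g * r) * (p * q) * X"
        if "k \<noteq> 0" for k p g q r X :: complex
        using that by simp
      then show ?thesis using elim unfolding riemann_zeta_eq
        by (simp only: if_False right_minus_eq not_False_eq_True)
    qed
    then show ?case unfolding G pi_powr_cancel by simp
  qed
  then have "riemann_xi s = remove_sings (\<lambda>t. xi_centered (t - 1/2)) s"
    unfolding riemann_xi_def by (rule remove_sings_cong) simp
  also have "(\<lambda>t. xi_centered (t - 1/2)) analytic_on {s}"
  proof -
    have "(xi_centered \<circ> (\<lambda>s. s - 1/2)) holomorphic_on UNIV"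
      by (rule holomorphic_on_compose_gen[OF _ xi_centered_holomorphic])
        (auto intro!: holomorphic_intros)
    then show ?thesis by (auto simp: o_def analytic_at)
  qed
  then have "remove_sings (\<lambda>t. xi_centered (t - 1/2)) s = xi_centered (s - 1/2)"
    by (rule remove_sings_at_analytic)
  finally show "riemann_xi s = xi_centered (s - 1/2)" .
qed

text \<open>The factor \<open>m! / (2 m)!\<close> in the definition turns the even derivatives of
  \<open>xi_centered\<close> at 0 into derivatives of \<open>xi_sqrt\<close>.\<close>

lemma xi_gamma_eq: "xi_gamma m = (deriv ^^ m) xi_sqrt 0"
proof -
  have "(deriv ^^ k) (\<lambda>s. xi_centered (1 * s + - (1/2))) (1/2)
    = 1 ^ k * (deriv ^^ k) xi_centered (1 * (1/2) + - (1/2))" for k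
    by (rule higher_deriv_compose_linear'[OF xi_centered_holomorphic, of UNIV]) auto
  then have "(deriv ^^ (2 * m)) riemann_xi (1/2) = of_real (xi_moment (2 * m))"
    unfolding riemann_xi_eq by (simp add: higher_deriv_xi_centered)
  then show ?thesis by (simp add: xi_gamma_def higher_deriv_xi_sqrt)
qed

lemma xi_gamma_nonzero: "xi_gamma m \<noteq> 0"
  using xi_moment_even_pos[of m] by (simp add: xi_gamma_eq higher_deriv_xi_sqrt)

text \<open>With \<open>w = z^2\<close> and \<open>s = z + 1/2\<close>, the critical line
  corresponds to imaginary \<open>z\<close>. A real \<open>w\<close> also allows real
  \<open>z\<close>, which \<open>xi_centered_real_pos\<close> rules out.\<close>

lemma riemann_hypothesis_iff: "riemann_hypothesis \<longleftrightarrow> (\<forall>w. xi_sqrt w = 0 \<longrightarrow> w \<in> \<real>)"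
proof
  assume RH: riemann_hypothesis
  show "\<forall>w. xi_sqrt w = 0 \<longrightarrow> w \<in> \<real>"
  proof (intro allI impI)
    fix w assume w: "xi_sqrt w = 0"
    define z where "z = csqrt w"
    have Xi0: "xi_centered z = 0" using w xi_sqrt_square[of z] by (simp add: z_def)
    have nonreal: "z \<notin> \<real>"
    proof
      assume "z \<in> \<real>"
      then obtain x where "z = of_real x" by (rule Reals_cases)
      then show False using xi_centered_real_pos[of x] Xi0 by auto
    qed
    define s where "s = z + 1/2"
    have "s \<notin> \<real>" 
    proof
      assume "s \<in> \<real>"
      then have "s - 1/2 \<in> \<real>" by (intro Reals_diff) auto
      then show False using nonreal by (simp add: s_def)
    qed
    moreover have "(1::complex) \<in> \<real>" "- 2 * of_nat k \<in> (\<real> :: complex set)" for k :: nat by auto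
    ultimately have "s \<noteq> 1" "\<not> (\<exists>k::nat. k \<ge> 1 \<and> s = - 2 * of_nat k)" by metis+
    moreover have "riemann_zeta s = 0" by (simp add: riemann_zeta_eq s_def Xi0)
    ultimately have "Re s = 1/2" using RH unfolding riemann_hypothesis_def by blast
    then have "Re z = 0" by (simp add: s_def)
    moreover have "w = z\<^sup>2" by (simp add: z_def)
    ultimately show "w \<in> \<real>" by (simp add: complex_is_Real_iff power2_eq_square)
  qed
next
  assume real: "\<forall>w. xi_sqrt w = 0 \<longrightarrow> w \<in> \<real>"
  show riemann_hypothesis unfolding riemann_hypothesis_def
  proof (intro allI impI, elim conjE)
    fix s assume s: "s \<noteq> 1" "riemann_zeta s = 0" "\<not> (\<exists>k::nat. k \<ge> 1 \<and> s = - 2 * of_nat k)"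
    \<comment> \<open>A zero of this factor satisfies \<open>s / 2 + 1 = - n\<close>, that is
      \<open>s = - 2 (n + 1)\<close>: a trivial zero with \<open>k = n + 1\<close>.\<close>
    have "rGamma (s / 2 + 1) \<noteq> 0"
    proof
      assume "rGamma (s / 2 + 1) = 0"
      then have "s / 2 + 1 \<in> \<int>\<^sub>\<le>\<^sub>0" by (simp add: rGamma_eq_zero_iff)
      then obtain n where "s / 2 + 1 = - of_nat n" by (rule nonpos_Ints_cases')
      moreover have "s = 2 * (s / 2 + 1) - 2" by simp
      ultimately have "s = - 2 * of_nat (n + 1)" by simp
      then show False using s(3) by (metis le_add2)
    qed
    moreover have "complex_of_real pi powr (s / 2) \<noteq> 0" by simp
    ultimately have Xi0: "xi_centered (s - 1/2) = 0" using s(1,2) by (simp add: riemann_zeta_eq)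
    define z where "z = s - 1/2"
    have "z\<^sup>2 \<in> \<real>" using real xi_sqrt_square[of z] Xi0 by (simp add: z_def)
    then have "Re z = 0 \<or> Im z = 0" by (auto simp: complex_is_Real_iff power2_eq_square)
    moreover have "Im z \<noteq> 0"
    proof
      assume "Im z = 0"
      then have "z = of_real (Re z)" by (simp add: complex_eq_iff)
      then show False using xi_centered_real_pos[of "Re z"] Xi0 by (auto simp: z_def)
    qed
    ultimately show "Re s = 1/2" by (simp add: z_def)
  qed
qed

section \<open>The equivalence\<close>

lemma only_real_zeros_Q_poly:
  assumes real: "\<And>w. xi_sqrt w = 0 \<Longrightarrow> w \<in> \<real>" and \<alpha>: "\<alpha> \<ge> -2"
  shows "only_real_zeros (Q_poly d n \<alpha>)"
proof -
  let ?P = "rev_laguerre \<alpha> d"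
  let ?D = "diff_op (\<lambda>j. xi_gamma (n + j) / fact j) ?P"
  have P: "only_real_zeros ?P" by (rule only_real_zeros_rev_laguerre[OF \<alpha>])
  \<comment> \<open>Only \<open>j = 0\<close> reaches the top degree, so
    \<open>xi_gamma n \<noteq> 0\<close> keeps the result from being the zero polynomial.\<close>
  have "coeff ?D (degree ?P) = (\<Sum>j\<le>degree ?P. if j = 0 then xi_gamma n * lead_coeff ?P else 0)"
    unfolding diff_op_def coeff_sum by (rule sum.cong) (auto simp: coeff_higher_pderiv coeff_eq_0)
  also have "\<dots> = xi_gamma n * lead_coeff ?P" by simp
  finally have "?D \<noteq> 0"
    using xi_gamma_nonzero[of n] only_real_zeros_nonzero[OF P] by auto
  then have D: "only_real_zeros ?D"
    unfolding xi_gamma_eq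
    by (intro only_real_zeros_diff_op_entire xi_sqrt_holomorphic xi_sqrt_0 real xi_sqrt_growth P)
  show ?thesis unfolding only_real_zeros_def
  proof (intro allI impI)
    fix z assume z: "poly (Q_poly d n \<alpha>) z = 0"
    show "z \<in> \<real>"
    proof (cases "z = 0")
      case False
      then have "poly ?D (inverse z) = 0" using z by (simp add: poly_Q_poly)
      then have "inverse z \<in> \<real>" using D unfolding only_real_zeros_def by blast
      then show ?thesis by (metis Reals_inverse inverse_inverse_eq)
    qed simp
  qed
qed

text \<open>The power series of \<open>J_0 (2 sqrt w)\<close>, the limit of the Laguerre polynomials
  \<open>L_d (w / d)\<close> with parameter 0.\<close>

definition bessel_fps :: "complex fps" where
  "bessel_fps = Abs_fps (\<lambda>k. (- 1) ^ k / (fact k)\<^sup>2)"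

lemma fps_conv_radius_bessel: "fps_conv_radius bessel_fps = \<infinity>"
  unfolding fps_conv_radius_def
proof (rule conv_radius_inftyI'')
  fix z :: complex
  show "summable (\<lambda>n. fps_nth bessel_fps n * z ^ n)"
  proof (rule summable_comparison_test'[of "\<lambda>n. norm z ^ n / fact n" 0])
    show "summable (\<lambda>n. norm z ^ n / fact n)"
      using summable_exp[of "norm z"] by (simp add: divide_inverse mult.commute)
    fix n
    have "norm (fps_nth bessel_fps n * z ^ n) = norm z ^ n / (fact n)\<^sup>2"
      by (simp add: bessel_fps_def norm_mult norm_divide norm_power)
    also have "\<dots> \<le> norm z ^ n / fact n"
      by (intro divide_left_mono) (auto simp: power2_eq_square)
    finally show "norm (fps_nth bessel_fps n * z ^ n) \<le> norm z ^ n / fact n" .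
  qed
qed

text \<open>For \<open>\<alpha> = 0\<close> and \<open>n = 0\<close> the polynomials are the Jensen polynomials of the product of \<open>F\<close> and the
  Bessel-type function \<open>\<Sum> (- w)\<^sup>k / (k!)\<^sup>2\<close>, so after rescaling they converge to this product.\<close>

lemma coeff_Q_poly_0_0:
  "coeff (Q_poly d 0 0) m = (if m
    \<le> d then fact d / fact (d - m) * fps_nth (xi_sqrt_fps * bessel_fps) m else 0)"
proof -
  have c: "coeff (Q_poly d 0 0) m
    = (\<Sum>j\<le>d. if m < j then 0 else of_real (real d gchoose j) * xi_gamma j * of_real
    (coeff (gen_laguerre 0 (d - j)) (m - j)))"
    unfolding Q_poly_def coeff_sum by (rule sum.cong) (auto simp: coeff_monom_mult coeff_map_poly)
  show ?thesis
  proof (cases "m \<le> d")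
    case True
    \<comment> \<open>The factorials \<open>(d - j)!\<close> cancel, so \<open>d\<close> survives
      only in a factor independent of \<open>j\<close>, and the sum over \<open>j\<close> becomes a
      Cauchy product.\<close>
    have term_eq: "of_real (real d gchoose j) * xi_gamma j * of_real (coeff (gen_laguerre 0 (d
      - j)) (m - j))
      = fact d / fact (d - m) * (fps_nth xi_sqrt_fps j * fps_nth bessel_fps (m - j))" if j: "j
        \<le> m" for j
    proof -
      have "real (d - j) gchoose (d - j - (m - j)) = fact (d - j) / (fact (d - m) * fact (m - j))"
        using j True binomial_fact[of "d - m" "d - j", where 'a = real]
          by (simp add: binomial_gbinomial)
      then have 1: "coeff (gen_laguerre 0 (d - j)) (m - j)
        = fact (d - j) / (fact (d - m) * fact (m - j)) * (-1) ^ (m - j) / fact (m - j)"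
        using j True by (simp add: coeff_gen_laguerre)
      have 2: "real d gchoose j = fact d / (fact j * fact (d - j))"
        using j True binomial_fact[of j d, where 'a = real] by (simp add: binomial_gbinomial)
      have 3: "xi_gamma j = fact j * fps_nth xi_sqrt_fps j"
        by (simp add: xi_gamma_eq higher_deriv_xi_sqrt xi_sqrt_fps_def)
      show ?thesis unfolding 1 2 3 by (simp add: bessel_fps_def power2_eq_square)
    qed
    have "coeff (Q_poly d 0 0) m
      = (\<Sum>j\<le>m. of_real (real d gchoose j) * xi_gamma j * of_real (coeff (gen_laguerre 0 (d - j)) (m
      - j)))"
      unfolding c by (rule sum.mono_neutral_cong_right) (use True in auto)
    also have "\<dots> = (\<Sum>j\<le>m. fact d / fact (d - m) * (fps_nth xi_sqrt_fps j * fps_nth bessel_fps (m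
      - j)))"
      by (rule sum.cong) (auto simp: term_eq)
    also have "\<dots> = fact d / fact (d - m) * fps_nth (xi_sqrt_fps * bessel_fps) m"
      by (simp add: fps_mult_nth sum_distrib_left atLeast0AtMost)
    finally show ?thesis using True by simp
  next
    case False
    then have "coeff (Q_poly d 0 0) m = 0"
      unfolding c by (intro sum.neutral) (auto simp: coeff_gen_laguerre)
    then show ?thesis using False by simp
  qed
qed

lemma fact_le_fact_diff_mult_power: "m \<le> d \<Longrightarrow> fact d \<le> fact (d - m) * real d ^ m"
proof (induction m)
  case (Suc m)
  obtain e where e: "d = Suc (m + e)" using Suc.prems le_Suc_ex by (metis add_Suc)
  have "fact (d - m) = real (Suc e) * fact (d - Suc m)" by (simp add: e)
  also have "\<dots> \<le> real d * fact (d - Suc m)" by (intro mult_right_mono) (auto simp: e)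
  finally have "fact (d - m) * real d ^ m \<le> real d * fact (d - Suc m) * real d ^ m"
    by (intro mult_right_mono) auto
  moreover have "fact d \<le> fact (d - m) * real d ^ m" using Suc by simp
  ultimately have "fact d \<le> real d * fact (d - Suc m) * real d ^ m" by linarith
  then show ?case by (simp add: mult_ac)
qed simp

lemma fact_ratio_le: "m \<le> d \<Longrightarrow> fact d / (fact (d - m) * real d ^ m) \<le> 1"
  using fact_le_fact_diff_mult_power[of m d] by (cases "d = 0") simp_all

lemma fact_ratio_tendsto: "(\<lambda>d. if m \<le> d then fact d / (fact (d - m) * real d ^ m) else 0) \<longlonglongrightarrow> 1"
proof (induction m)
  case 0
  then show ?case by simp
next
  case (Suc m)
  have "(\<lambda>d. (real d - real m) / real d) \<longlonglongrightarrow> 1" by real_asymp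
  then have "(\<lambda>d. (if m \<le> d then fact d / (fact (d - m) * real d ^ m) else 0) * ((real d
    - real m) / real d)) \<longlonglongrightarrow> 1 * 1"
    by (intro tendsto_mult Suc.IH)
  moreover have "\<forall>\<^sub>F d in sequentially. (if m
    \<le> d then fact d / (fact (d - m) * real d ^ m) else 0) * ((real d - real m) / real d)
      = (if Suc m \<le> d then fact d / (fact (d - Suc m) * real d ^ Suc m) else 0)"
  proof (rule eventually_sequentiallyI[of "Suc m"])
    fix d assume d: "Suc m \<le> d"
    then obtain e where e: "d = Suc (m + e)" using le_Suc_ex by (metis add_Suc)
    have "fact (d - m) = (real d - real m) * fact (d - Suc m)" by (simp add: e)
    moreover have "real d - real m \<noteq> 0" using d by simp
    ultimately show "(if m \<le> d then fact d / (fact (d - m) * real d ^ m) else 0) * ((real d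
      - real m) / real d)
      = (if Suc m \<le> d then fact d / (fact (d - Suc m) * real d ^ Suc m) else 0)"
      using d by simp
  qed
  ultimately show ?case using tendsto_cong by fastforce
qed

lemma xi_sqrt_real_zeros:
  assumes Q: "\<And>d. d \<ge> 1 \<Longrightarrow> only_real_zeros (Q_poly d 0 0)" and w: "xi_sqrt w = 0"
  shows "w \<in> \<real>"
proof -
  define C where "C = xi_sqrt_fps * bessel_fps"
  define G where "G = eval_fps C"
  \<comment> \<open>The ratio of the coefficients of \<open>x^m\<close> in the rescaled polynomial
    and in its limit. It lies in \<open>[0, 1]\<close>, tends to 1 and is 0 beyond the degree, so
    the polynomials become series dominated by that of the limit.\<close>
  define \<rho> where "\<rho> d m = (if m \<le> d then fact d / (fact (d - m) * real d ^ m) else 0)" for d m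
  define f where "f d x = poly (Q_poly (Suc d) 0 0) (x / of_nat (Suc d))" for d x
  have rad: "fps_conv_radius C = \<infinity>"
    using fps_conv_radius_mult[of xi_sqrt_fps bessel_fps]
      by (simp add: C_def fps_conv_radius_xi_sqrt fps_conv_radius_bessel)
  have G: "G x = xi_sqrt x * eval_fps bessel_fps x" for x
    unfolding G_def C_def xi_sqrt_def
      by (rule eval_fps_mult) (simp_all add: fps_conv_radius_xi_sqrt fps_conv_radius_bessel)
  have \<rho>: "0 \<le> \<rho> d m" "\<rho> d m \<le> 1" "(\<lambda>d. \<rho> (Suc d) m) \<longlonglongrightarrow> 1" for d m
    using fact_ratio_le[of m d] LIMSEQ_Suc[OF fact_ratio_tendsto[of m]] by (auto simp: \<rho>_def)
  have summ: "summable (\<lambda>m. norm (fps_nth C m) * R ^ m)" if "R > 0" for R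
  proof -
    have "ereal (norm (complex_of_real R)) < conv_radius (fps_nth C)" using rad
      by (simp add: fps_conv_radius_def)
    from abs_summable_in_conv_radius[OF this] show ?thesis using that
      by (simp add: norm_mult norm_power)
  qed
  have f_eq: "f d x = (\<Sum>m. of_real (\<rho> (Suc d) m) * (fps_nth C m * x ^ m))" for d x
  proof -
    have "degree (Q_poly (Suc d) 0 0) \<le> Suc d" by (rule degree_le) (simp add: coeff_Q_poly_0_0)
    then have "f d x = (\<Sum>m\<le>Suc d. coeff (Q_poly (Suc d) 0 0) m * (x / of_nat (Suc d)) ^ m)"
      unfolding f_def poly_altdef by (intro sum.mono_neutral_left) (auto simp: coeff_eq_0)
    also have "\<dots> = (\<Sum>m\<le>Suc d. of_real (\<rho> (Suc d) m) * (fps_nth C m * x ^ m))"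
      by (rule sum.cong) (simp_all add: coeff_Q_poly_0_0[folded C_def] \<rho>_def power_divide
        mult_ac del: of_nat_Suc fact_Suc)
    also have "\<dots> = (\<Sum>m. of_real (\<rho> (Suc d) m) * (fps_nth C m * x ^ m))"
      by (rule suminf_finite[symmetric]) (auto simp: \<rho>_def)
    finally show ?thesis .
  qed
  show ?thesis
  proof (rule real_zeros_limit[of f G 0 w])
    show "f n holomorphic_on UNIV" for n unfolding f_def by (intro holomorphic_intros) auto
    show "G holomorphic_on UNIV" unfolding G_def by (rule holomorphic_on_eval_fps) (simp add: rad)
    show "x \<in> \<real>" if "f n x = 0" for n x
    proof -
      have "x / of_nat (Suc n) \<in> \<real>" using Q[of "Suc n"] that
        by (simp add: f_def only_real_zeros_def del: of_nat_Suc)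
      then have "x / of_nat (Suc n) * of_nat (Suc n) \<in> \<real>" by (intro Reals_mult) auto
      then show ?thesis by (simp del: of_nat_Suc)
    qed
    show "G w = 0" by (simp add: G w)
    show "G 0 \<noteq> 0" using xi_sqrt_0 by (simp add: G eval_fps_at_0 bessel_fps_def)
    fix R :: real assume R: "R > 0"
    \<comment> \<open>A bound for the error on the whole disc at once: Tannery's theorem for this
      series of numbers gives convergence uniform in \<open>x\<close>.\<close>
    define E where "E d = (\<Sum>m. (1 - \<rho> (Suc d) m) * (norm (fps_nth C m) * R ^ m))" for d
    have sE: "summable (\<lambda>m. (1 - \<rho> (Suc d) m) * (norm (fps_nth C m) * R ^ m))" for d
    proof (rule summable_comparison_test'[OF summ[OF R], of 0])
      show "norm ((1 - \<rho> (Suc d) m) * (norm (fps_nth C m) * R ^ m)) \<le> norm (fps_nth C m) * R ^ m"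
        for m
        using \<rho>(1,2)[of "Suc d" m] R by (simp add: abs_mult mult_left_le_one_le)
    qed
    have bound: "norm (f d x - G x) \<le> E d" if "norm x \<le> R" for d x
    proof -
      have le: "norm (fps_nth C m * x ^ m) \<le> norm (fps_nth C m) * R ^ m" for m
        using that by (simp add: norm_mult norm_power mult_left_mono power_mono)
      have s2: "summable (\<lambda>m. fps_nth C m * x ^ m)"
        by (rule summable_comparison_test'[OF summ[OF R], of 0]) (rule le)
      have s1: "summable (\<lambda>m. of_real (\<rho> (Suc d) m) * (fps_nth C m * x ^ m))"
      proof (rule summable_comparison_test'[OF summ[OF R], of 0])
        show "norm (of_real (\<rho> (Suc d) m) * (fps_nth C m * x ^ m)) \<le> norm (fps_nth C m) * R ^ m"
          for m
          unfolding norm_mult[of "of_real _"] using \<rho>(1,2)[of "Suc d" m] le[of m]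
          by (simp add: order_trans[OF mult_left_le_one_le])
      qed
      have "G x - f d x = (\<Sum>m. fps_nth C m * x ^ m - of_real (\<rho> (Suc d) m) * (fps_nth C m * x ^ m))"
        unfolding G_def eval_fps_def f_eq by (rule suminf_diff[OF s2 s1])
      also have "\<dots> = (\<Sum>m. of_real (1 - \<rho> (Suc d) m) * (fps_nth C m * x ^ m))"
        by (rule suminf_cong) (simp add: algebra_simps)
      also have "norm \<dots> \<le> E d"
        unfolding E_def
      proof (rule norm_suminf_le[OF _ sE])
        show "norm (of_real (1 - \<rho> (Suc d) m) * (fps_nth C m * x ^ m))
          \<le> (1 - \<rho> (Suc d) m) * (norm (fps_nth C m) * R ^ m)" for m
          unfolding norm_mult[of "of_real _"] norm_of_real using \<rho>(1,2)[of "Suc d" m] le[of m]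
            by (simp add: mult_left_mono)
      qed
      finally show ?thesis by (simp add: norm_minus_commute)
    qed
    have "E \<longlonglongrightarrow> (\<Sum>m. 0)"
      unfolding E_def
    proof (rule tannerys_theorem[where M
      = "\<lambda>m. norm (fps_nth C m) * R ^ m", THEN conjunct2, THEN conjunct2])
      show "((\<lambda>d. (1 - \<rho> (Suc d) m) * (norm (fps_nth C m) * R ^ m)) \<longlongrightarrow> 0) sequentially" for m
        using tendsto_mult[OF tendsto_diff[OF tendsto_const \<rho>(3)[of m], of 1] tendsto_const[of
          "norm (fps_nth C m) * R ^ m"]] by simp
      show "\<forall>\<^sub>F (m, d) in at_top \<times>\<^sub>F sequentially. norm ((1 - \<rho> (Suc d) m)
        * (norm (fps_nth C m) * R ^ m)) \<le> norm (fps_nth C m) * R ^ m"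
        using \<rho>(1,2) R by (intro always_eventually) (auto simp: abs_mult mult_left_le_one_le)
    qed (use summ[OF R] in auto)
    then have E: "E \<longlonglongrightarrow> 0" by simp
    show "uniform_limit (cball 0 R) f G sequentially"
      unfolding uniform_limit_iff
    proof (intro allI impI)
      fix e :: real assume "e > 0"
      then have "\<forall>\<^sub>F d in sequentially. E d < e" using E order_tendstoD(2) by blast
      then show "\<forall>\<^sub>F d in sequentially. \<forall>x\<in>cball 0 R. dist (f d x) (G x) < e"
      proof eventually_elim
        case (elim d)
        show ?case
        proof
          fix x :: complex assume "x \<in> cball 0 R"
          then show "dist (f d x) (G x) < e" using bound[of x d] elim by (simp add: dist_norm)
        qed
      qed
    qed
  qed
qed

theorem theorem3p9:
  "riemann_hypothesis \<longleftrightarrow>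
     (\<forall>(d::nat) (n::nat) (\<alpha>::real). d \<ge> 1 \<and> \<alpha> \<ge> - 2 \<longrightarrow> only_real_zeros (Q_poly d n \<alpha>))"
proof
  assume riemann_hypothesis
  then show "\<forall>(d::nat) (n::nat) (\<alpha>::real). d \<ge> 1 \<and> \<alpha> \<ge> - 2 \<longrightarrow> only_real_zeros (Q_poly d n \<alpha>)"
    using only_real_zeros_Q_poly unfolding riemann_hypothesis_iff by blast
next
  assume "\<forall>(d::nat) (n::nat) (\<alpha>::real). d \<ge> 1 \<and> \<alpha> \<ge> - 2 \<longrightarrow> only_real_zeros (Q_poly d n \<alpha>)"
  then have "only_real_zeros (Q_poly d 0 0)" if "d \<ge> 1" for d using that by simp
  then show riemann_hypothesis
    unfolding riemann_hypothesis_iff using xi_sqrt_real_zeros by blast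
qed

end
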